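(* Let $\mathcal C\subset \mathbb T^2$ be a smooth curve with nowhere-zero curvature. Then there exist constants $c>0$ and $\lambda_0>0$, depending only on $\mathcal C$, such that for every $\lambda\ge\lambda_0$ and every nonzero real-valued function $F$ on $\mathbb T^2$ with $-\Delta F=\lambda^2F$, $$N_{F,\mathcal C}\ \ge\ c\,\frac{\lambda}{B_\lambda^{5/2}} .$$
   Context: $\mathbb T^2=\mathbb R^2/2\pi\mathbb Z^2$ is the standard flat torus and $\Delta$ its Laplacian. The curve $\mathcal C$ is of finite positive length, with a smooth arc-length parameterization $\gamma:[0,L]\to\mathcal C$. $N_{F,\mathcal C}=\#(\{x: F(x)=0\}\cap\mathcal C)$ is the number of zeros of $F$ on $\mathcal C$ (possibly $\infty$). For $\lambda>0$, $\mathcal E_\lambda=\{\mu\in\mathbb Z^2:|\mu|=\lambda\}$ is the set of lattice points on the circle of radius $\lambda$, and $$B_\lambda=\max_{x\in\mathbb R^2,\ |x|=\lambda}\#\{\xi\in\mathcal E_\lambda: |x-\xi|\le\sqrt\lambda\}.$$ *)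

theory Defs
  imports "HOL-Analysis.Analysis"
begin

definition torus_rel :: "real^2 \<Rightarrow> real^2 \<Rightarrow> bool" where
  "torus_rel x y \<longleftrightarrow> (\<forall>i. \<exists>k::int. x $ i - y $ i = 2 * pi * of_int k)"

lemma equivp_torus_rel: "equivp torus_rel"
proof (rule equivpI)
  show "reflp torus_rel"
    by (auto simp: reflp_def torus_rel_def intro!: exI[of _ "0::int"])
  show "symp torus_rel"
  proof (rule sympI, unfold torus_rel_def, rule allI)
    fix x y :: "real^2" and i
    assume "\<forall>i. \<exists>k::int. x $ i - y $ i = 2 * pi * of_int k"
    then obtain k :: int where "x $ i - y $ i = 2 * pi * of_int k" by blast
    then have "y $ i - x $ i = 2 * pi * of_int (- k)" by simp
    then show "\<exists>k::int. y $ i - x $ i = 2 * pi * of_int k" by blast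
  qed
  show "transp torus_rel"
  proof (rule transpI, unfold torus_rel_def, rule allI)
    fix x y z :: "real^2" and i
    assume "\<forall>i. \<exists>k::int. x $ i - y $ i = 2 * pi * of_int k"
      and "\<forall>i. \<exists>k::int. y $ i - z $ i = 2 * pi * of_int k"
    then obtain k l :: int
      where "x $ i - y $ i = 2 * pi * of_int k" "y $ i - z $ i = 2 * pi * of_int l" by blast
    then have "x $ i - z $ i = 2 * pi * of_int (k + l)" by (simp add: algebra_simps)
    then show "\<exists>k::int. x $ i - z $ i = 2 * pi * of_int k" by blast
  qed
qed

quotient_type torus = "real^2" / torus_rel
  by (rule equivp_torus_rel)

definition torus_proj :: "real^2 \<Rightarrow> torus" where
  "torus_proj x = abs_torus x"

definition partial :: "2 \<Rightarrow> (real^2 \<Rightarrow> real) \<Rightarrow> real^2 \<Rightarrow> real" where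
  "partial i f x = frechet_derivative f (at x) (axis i 1)"

fun C_k :: "nat \<Rightarrow> (real^2 \<Rightarrow> real) \<Rightarrow> bool" where
  "C_k 0 f \<longleftrightarrow> continuous_on UNIV f"
| "C_k (Suc k) f \<longleftrightarrow> (\<forall>x. f differentiable (at x)) \<and> (\<forall>i. C_k k (partial i f))"

definition laplacian :: "(real^2 \<Rightarrow> real) \<Rightarrow> real^2 \<Rightarrow> real" where
  "laplacian f x = (\<Sum>i\<in>UNIV. partial i (partial i f) x)"

text \<open>Since the covering map is a local isometry, regularity and the Laplacian on the flat torus
  are computed on the periodic lift; the value does not depend on the representative
  (lemma \<open>torus_laplacian_proj\<close>).\<close>

definition torus_C2 :: "(torus \<Rightarrow> real) \<Rightarrow> bool" where
  "torus_C2 F \<longleftrightarrow> C_k 2 (F \<circ> torus_proj)"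

definition torus_laplacian :: "(torus \<Rightarrow> real) \<Rightarrow> torus \<Rightarrow> real" where
  "torus_laplacian F p = laplacian (F \<circ> torus_proj) (rep_torus p)"

lemma partial_periodic:
  assumes "\<And>y. f (y + v) = f y"
  shows "partial i f (x + v) = partial i f x"
proof -
  have shift: "(f has_derivative f') (at (z + w))"
    if "(f has_derivative f') (at z)" "\<And>y. f (y - w) = f y" for f' z w
  proof -
    have "((\<lambda>y. y - w) has_derivative (\<lambda>y. y)) (at (z + w))"
      by (auto intro!: derivative_eq_intros)
    from has_derivative_compose[OF this, of f f'] that show ?thesis by simp
  qed
  have "f (y - v) = f y" for y using assms[of "y - v"] by simp
  then have "(f has_derivative f') (at (x + v)) \<longleftrightarrow> (f has_derivative f') (at x)" for f'
    using shift[of f' x v] shift[of f' "x + v" "- v"] assms by auto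
  then show ?thesis by (simp add: partial_def frechet_derivative_def)
qed

lemma torus_laplacian_proj: "torus_laplacian F (torus_proj x) = laplacian (F \<circ> torus_proj) x"
proof -
  define v where "v = rep_torus (torus_proj x) - x"
  have "torus_rel (rep_torus (torus_proj x)) x"
    unfolding torus_proj_def
    by (metis Quotient3_abs_rep Quotient3_torus torus.abs_eq_iff)
  then have v: "\<forall>i. \<exists>k::int. v $ i = 2 * pi * of_int k"
    by (simp add: torus_rel_def v_def)
  have "(F \<circ> torus_proj) (y + v) = (F \<circ> torus_proj) y" for y
  proof -
    have "torus_rel (y + v) y" using v by (simp add: torus_rel_def)
    then have "abs_torus (y + v) = abs_torus y" by (rule torus.abs_eq_iff[THEN iffD2])
    then show ?thesis by (simp add: torus_proj_def)
  qed
  then have "partial i (partial i (F \<circ> torus_proj)) (x + v)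
      = partial i (partial i (F \<circ> torus_proj)) x" for i
    by (intro partial_periodic)
  then show ?thesis by (simp add: torus_laplacian_def laplacian_def v_def)
qed

text \<open>Derivatives of paths on a compact interval are one-sided at the endpoints, so smoothness
  is smoothness up to the boundary.\<close>

definition path_deriv :: "real \<Rightarrow> (real \<Rightarrow> real^2) \<Rightarrow> real \<Rightarrow> real^2" where
  "path_deriv L g t = vector_derivative g (at t within {0..L})"

definition smooth_path :: "real \<Rightarrow> (real \<Rightarrow> real^2) \<Rightarrow> bool" where
  "smooth_path L g \<longleftrightarrow>
     (\<forall>n. \<forall>t\<in>{0..L}. ((path_deriv L ^^ n) g) differentiable (at t within {0..L}))"

text \<open>A path in the torus is represented by a lift \<open>g\<close> to the plane. The parameterization is not
  required to be injective.\<close>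

definition arclength_param :: "torus set \<Rightarrow> real \<Rightarrow> (real \<Rightarrow> real^2) \<Rightarrow> bool" where
  "arclength_param C L g \<longleftrightarrow>
     0 < L \<and> smooth_path L g \<and> (\<forall>t\<in>{0..L}. norm (path_deriv L g t) = 1) \<and>
     C = (torus_proj \<circ> g) ` {0..L}"

text \<open>Unsigned curvature; this formula is specific to arc-length parameterizations.\<close>

definition curvature :: "real \<Rightarrow> (real \<Rightarrow> real^2) \<Rightarrow> real \<Rightarrow> real" where
  "curvature L g t = norm (path_deriv L (path_deriv L g) t)"

definition smooth_curve_nonzero_curvature :: "torus set \<Rightarrow> bool" where
  "smooth_curve_nonzero_curvature C \<longleftrightarrow>
     (\<exists>L g. arclength_param C L g \<and> (\<forall>t\<in>{0..L}. curvature L g t \<noteq> 0))"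

definition lattice_circle :: "real \<Rightarrow> (real^2) set" where
  "lattice_circle lam = {\<mu>. (\<forall>i. \<mu> $ i \<in> \<int>) \<and> norm \<mu> = lam}"

definition B_max :: "real \<Rightarrow> nat" where
  "B_max lam = Max {card {\<xi> \<in> lattice_circle lam. norm (x - \<xi>) \<le> sqrt lam} | x :: real^2. norm x = lam}"

definition num_zeros :: "(torus \<Rightarrow> real) \<Rightarrow> torus set \<Rightarrow> enat" where
  "num_zeros F C =
     (let Z = {p. F p = 0} \<inter> C in if finite Z then enat (card Z) else \<infinity>)"

end

theory Submission
  imports Defs "HOL-Computational_Algebra.Primes"
begin

text \<open>Along the curve an eigenfunction \<open>F\<close> is a real exponential sum
  \<open>f t = (\<Sum>\<xi>. a \<xi> * cis (\<xi> \<bullet> g t))\<close> over the lattice points \<open>\<xi>\<close> of the circle of radius \<open>lam\<close>.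
  If \<open>f\<close> has few zeros, then on most windows of length \<open>h\<close> the integral of \<open>f\<close> is as large as that
  of \<open>\<bar>f\<bar>\<close>. But a window integral is small: van der Corput's lemma gives
  \<open>\<integral> \<bar>\<integral>\<^sub>t\<^sup>t\<^sup>+\<^sup>h f\<bar>\<^sup>2 dt \<le> C h / lam * \<Sum>\<bar>a\<bar>\<^sup>2\<close>, while \<open>\<integral> \<bar>f\<bar>\<close> is bounded below by interpolating between
  \<open>\<integral> f\<^sup>2 \<ge> c \<Sum>\<bar>a\<bar>\<^sup>2\<close> and \<open>\<integral> f\<^sup>4 \<le> C B (\<Sum>\<bar>a\<bar>\<^sup>2)\<^sup>2\<close>. Taking \<open>h\<close> of size \<open>B / lam\<close> gives at least
  \<open>c lam / B\<^sup>2\<close> zeros. Throughout, the divisor bound makes the number of lattice points smaller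
  than any power of \<open>lam\<close>, so that interactions of distant frequencies, which oscillation
  makes smaller by a fixed power of \<open>lam\<close>, are negligible; an arc of length \<open>lam powr (1/4)\<close> carries at
  most two lattice points, so that the close interactions are harmless, except in the fourth moment,
  where they are counted by \<open>B\<close>.\<close>

section \<open>Lattice points on circles\<close>

text \<open>Let A be the sum of the squared coefficients. Up to constants, the moments make the L1
  norm of \<open>f\<close> at least sqrt (A / B), while the window integrals have L1 norm at most
  sqrt (A h / lam); h times the former beats the latter once h is a large multiple of B / lam. Each
  zero spoils window starts of measure at most h, and by Cauchy-Schwarz these can carry the L1 norm
  only if h times the number of zeros is at least of order 1 / B. This gives lam / B^2, hence the
  claim since B \<ge> 1.

  The obstacle in the second moment is that a lattice point may keep a neighbour at bounded
  distance, whose interaction does not decay as \<open>lam\<close> grows. A gap between such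
  interactions and the diagonal, uniform over all nonzero integer frequencies, replaces decay there.

  All estimates live on one short arc on which tangent and curvature vector are almost constant.
  They span the plane, so every frequency has a large component along one of them, hence a phase
  with large first or second derivative of constant sign.\<close>

lemma card_divisors_mult_le:
  fixes a b :: nat
  assumes "a > 0" "b > 0"
  shows "card {d. d dvd a * b} \<le> card {d. d dvd a} * card {d. d dvd b}"
proof -
  \<comment> \<open>A divisor of \<open>a * b\<close> splits into its common part with
    \<open>a\<close> and a cofactor that divides \<open>b\<close>; the product of the two recovers
    it.\<close>
  let ?f = "\<lambda>d. (gcd d a, d div gcd d a)"
  have fin: "finite {d. d dvd a}" "finite {d. d dvd b}" "finite {d. d dvd a * b}"
    using assms by (auto intro!: finite_divisors_nat)
  have "inj_on ?f {d. d dvd a * b}"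
  proof (rule inj_onI)
    fix x y assume "?f x = ?f y"
    then have "gcd x a * (x div gcd x a) = gcd y a * (y div gcd y a)" by auto
    then show "x = y" by simp
  qed
  moreover have "?f ` {d. d dvd a * b} \<subseteq> {d. d dvd a} \<times> {d. d dvd b}"
  proof clarsimp
    fix d assume d: "d dvd a * b"
    define g where "g = gcd d a"
    obtain d' a' where *: "d = g * d'" "a = g * a'" unfolding g_def by (meson dvdE gcd_dvd1 gcd_dvd2)
    have "g > 0" using assms by (simp add: g_def)
    then have "d div g = d'" "a div g = a'" using * by auto
    then have "d div gcd d a = d'" "a div gcd d a = a'" by (simp_all add: g_def)
    moreover have "d' dvd a' * b"
      using d * \<open>g > 0\<close> by (simp add: mult.assoc)
    moreover have "coprime (d div gcd d a) (a div gcd d a)"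
      using assms by (intro div_gcd_coprime) auto
    ultimately show "d div gcd d a dvd b"
      using coprime_dvd_mult_right_iff by blast
  qed
  ultimately show ?thesis
    using card_inj_on_le[of ?f "{d. d dvd a * b}" "{d. d dvd a} \<times> {d. d dvd b}"] fin
    by (simp add: card_cartesian_product)
qed

text \<open>Multiplies in one prime power at a time with the previous bound, a power
  \<open>p ^ k\<close> having exactly \<open>k + 1\<close> divisors.\<close>

lemma card_divisors_le_prod:
  fixes n :: nat
  assumes "n > 0"
  shows "card {d. d dvd n} \<le> (\<Prod>p\<in>prime_factors n. multiplicity p n + 1)"
proof -
  have *: "card {d. d dvd (\<Prod>p\<in>S. p ^ k p)} \<le> (\<Prod>p\<in>S. k p + 1)"
    if "finite S" "\<forall>p\<in>S. prime p" for S :: "nat set" and k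
    using that
  proof (induction S rule: finite_induct)
    case (insert p S)
    have "card {d. d dvd p ^ k p} = k p + 1"
    proof -
      have "{d. d dvd p ^ k p} = (\<lambda>i. p ^ i) ` {..k p}"
        using insert.prems by (auto simp: divides_primepow_nat le_imp_power_dvd)
      moreover have "inj_on (\<lambda>i. p ^ i) {..k p}"
        using insert.prems prime_gt_1_nat by (auto intro!: inj_onI simp: power_inject_exp)
      ultimately show ?thesis by (simp add: card_image)
    qed
    moreover have "(\<Prod>p\<in>S. p ^ k p) > 0" "p ^ k p > 0"
      using insert.prems by (auto intro!: prod_pos simp: prime_gt_0_nat)
    ultimately show ?case
      using card_divisors_mult_le[of "p ^ k p" "\<Prod>p\<in>S. p ^ k p"] insert
      by (simp add: insert.hyps) (metis (no_types, lifting) add_mono_thms_linordered_semiring(1) le_trans mult_le_mono mult_Suc le_refl)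
  qed simp
  have "n = (\<Prod>p\<in>prime_factors n. p ^ multiplicity p n)"
    using assms by (simp add: prime_factorization_nat)
  then show ?thesis using *[of "prime_factors n" "\<lambda>p. multiplicity p n"] by auto
qed

lemma divisor_bound:
  fixes \<epsilon> :: real
  assumes "\<epsilon> > 0"
  shows "\<exists>C\<ge>1. \<forall>n>0. real (card {d::nat. d dvd n}) \<le> C * real n powr \<epsilon>"
proof -
  \<comment> \<open>Chosen so that \<open>k + 1 \<le> C0 * (1 + \<epsilon> * ln 2 * k) \<le> C0 * 2
    powr (\<epsilon> * k)\<close>: this is the cost of a small prime.\<close>
  define C0 where "C0 = 1 + 1 / (\<epsilon> * ln 2)"
  have C0: "C0 \<ge> 1" "C0 * (\<epsilon> * ln 2) \<ge> 1"
    using assms by (auto simp: C0_def field_simps)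
  \<comment> \<open>From \<open>P\<close> on, \<open>p powr \<epsilon> \<ge> 2\<close>, so a factor
    \<open>k + 1 \<le> 2 ^ k\<close> costs no constant; at most \<open>P\<close> primes pay
    \<open>C0\<close>.\<close>
  define P where "P = nat \<lceil>2 powr (1 / \<epsilon>)\<rceil>"
  have "real (card {d. d dvd n}) \<le> C0 ^ P * real n powr \<epsilon>" if "n > 0" for n :: nat
  proof -
    let ?c = "\<lambda>p::nat. if p < P then C0 else 1"
    have prime_power: "real (k + 1) \<le> ?c p * real (p ^ k) powr \<epsilon>" if "prime p" for p k
    proof -
      have p2: "p \<ge> 2" using that by (simp add: prime_ge_2_nat)
      have pk: "real (p ^ k) powr \<epsilon> = (real p powr \<epsilon>) ^ k"
      proof -
        have "real (p ^ k) powr \<epsilon> = (real p powr real k) powr \<epsilon>"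
          using p2 by (simp add: powr_realpow)
        also have "\<dots> = (real p powr \<epsilon>) powr real k" by (simp add: powr_powr mult.commute)
        finally show ?thesis using p2 by (simp add: powr_realpow)
      qed
      show ?thesis
      proof (cases "p < P")
        case True
        have "(2::real) powr (\<epsilon> * k) \<le> real p powr (\<epsilon> * k)"
          using p2 assms by (intro powr_mono2) auto
        also have "\<dots> = (real p powr \<epsilon>) powr k" by (simp add: powr_powr)
        also have "\<dots> = (real p powr \<epsilon>) ^ k" using p2 by (simp add: powr_realpow)
        finally have 1: "2 powr (\<epsilon> * k) \<le> (real p powr \<epsilon>) ^ k" .
        have "1 + \<epsilon> * ln 2 * k \<le> exp (\<epsilon> * ln 2 * k)" by (rule exp_ge_add_one_self)
        also have "\<dots> = 2 powr (\<epsilon> * k)" by (simp add: powr_def mult_ac)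
        finally have "C0 * (1 + \<epsilon> * ln 2 * k) \<le> C0 * (real p powr \<epsilon>) ^ k"
          using 1 C0 by (intro mult_left_mono) auto
        moreover have "1 * real k \<le> C0 * (\<epsilon> * ln 2) * k" using C0 by (intro mult_right_mono) auto
        ultimately show ?thesis using C0 True pk by (simp add: algebra_simps)
      next
        case False
        then have "2 powr (1 / \<epsilon>) \<le> real p" unfolding P_def by linarith
        then have "(2 powr (1 / \<epsilon>)) powr \<epsilon> \<le> real p powr \<epsilon>"
          using assms by (intro powr_mono2) auto
        then have "2 \<le> real p powr \<epsilon>" using assms by (simp add: powr_powr)
        then have "2 ^ k \<le> (real p powr \<epsilon>) ^ k" by (intro power_mono) auto
        moreover have "real (k + 1) \<le> 2 ^ k"
          by (metis Suc_eq_plus1 Suc_leI less_exp of_nat_le_iff of_nat_numeral of_nat_power)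
        ultimately show ?thesis using False pk by simp
      qed
    qed
    have "real (card {d. d dvd n}) \<le> (\<Prod>p\<in>prime_factors n. real (multiplicity p n + 1))"
      using card_divisors_le_prod[OF that] by (metis of_nat_le_iff of_nat_prod)
    also have "\<dots> \<le> (\<Prod>p\<in>prime_factors n. ?c p * real (p ^ multiplicity p n) powr \<epsilon>)"
      by (intro prod_mono conjI prime_power) auto
    also have "\<dots> = (\<Prod>p\<in>prime_factors n. ?c p) * (\<Prod>p\<in>prime_factors n. real (p ^ multiplicity p n) powr \<epsilon>)"
      by (rule prod.distrib)
    also have "(\<Prod>p\<in>prime_factors n. real (p ^ multiplicity p n) powr \<epsilon>)
        = real (\<Prod>p\<in>prime_factors n. p ^ multiplicity p n) powr \<epsilon>"
      by (simp add: prod_powr_distrib)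
    also have "(\<Prod>p\<in>prime_factors n. p ^ multiplicity p n) = n"
      using that by (rule prime_factorization_nat[symmetric])
    also have "(\<Prod>p\<in>prime_factors n. ?c p) = (\<Prod>p\<in>prime_factors n \<inter> {..<P}. C0)"
      by (rule prod.mono_neutral_cong_right) auto
    also have "\<dots> = C0 ^ card (prime_factors n \<inter> {..<P})" by simp
    also have "\<dots> \<le> C0 ^ P"
      using C0 by (intro power_increasing) (auto intro: card_mono[of "{..<P}", simplified])
    finally show ?thesis by (simp add: mult_right_mono)
  qed
  then show ?thesis using C0 by (intro exI[of _ "C0 ^ P"]) auto
qed


section \<open>Representations of an integer as a sum of two squares\<close>

lemma coprime_sum_squares:
  fixes a b :: int
  assumes "coprime a b"
  shows "coprime a (a\<^sup>2 + b\<^sup>2)"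
proof -
  have "coprime a (b\<^sup>2)" using assms by simp
  then show ?thesis
    using gcd_add_mult[of a a "b\<^sup>2"]
    by (simp add: coprime_iff_gcd_eq_1 power2_eq_square add.commute)
qed

text \<open>Modulo a power of an odd prime dividing \<open>m\<close>, a primitive solution has ratio
  \<open>y : x\<close> equal to plus or minus \<open>b : a\<close>. The divisor
  \<open>gcd m (a * y - b * x)\<close> records where the sign is plus and its cofactor where it is
  minus, so two solutions with the same divisor are proportional modulo both. The factor 2 pays for
  the prime 2, where the signs can coincide.\<close>

lemma primitive_representations_dvd:
  fixes m a b x y x' y' :: int
  assumes "m > 0"
    and ab: "coprime a b" "a\<^sup>2 + b\<^sup>2 = m"
    and xy: "coprime x y" "x\<^sup>2 + y\<^sup>2 = m"
    and xy': "x'\<^sup>2 + y'\<^sup>2 = m"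
    and eq: "gcd m (a * y - b * x) = gcd m (a * y' - b * x')"
  shows "m dvd 2 * (x * y' - x' * y)"
proof -
  define d where "d = gcd m (a * y - b * x)"
  have d0: "d \<noteq> 0" using \<open>m > 0\<close> by (simp add: d_def)
  obtain m1 where m1: "m = d * m1" unfolding d_def by (meson dvdE gcd_dvd1)
  have cop_a: "coprime a m" using coprime_sum_squares[OF ab(1)] ab(2) by simp
  have cop_b: "coprime b m"
    using coprime_sum_squares[of b a] ab by (simp add: coprime_commute add.commute)
  have m1_dvd: "m1 dvd a * v + b * u"
    if uv: "u\<^sup>2 + v\<^sup>2 = m" "d = gcd m (a * v - b * u)" for u v
  proof -
    obtain e where e: "a * v - b * u = d * e" using uv(2) by (metis dvdE gcd_dvd2)
    have "gcd (d * m1) (d * e) = d" using uv(2) e m1 by simp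
    then have "\<bar>d\<bar> * gcd m1 e = d" by (simp add: gcd_mult_distrib_int)
    moreover have "d > 0" using d0 by (simp add: d_def)
    ultimately have "coprime m1 e" by (simp add: coprime_iff_gcd_eq_1)
    \<comment> \<open>The product is divisible by \<open>m\<close>; cancelling \<open>d\<close> and
      then the cofactor \<open>e\<close>, which is coprime to \<open>m1\<close>, leaves divisibility
      of the second factor by \<open>m1\<close>.\<close>
    have "(a * v - b * u) * (a * v + b * u) = m * (a\<^sup>2 - u\<^sup>2)"
    proof -
      have *: "v\<^sup>2 = m - u\<^sup>2" "b\<^sup>2 = m - a\<^sup>2" using uv(1) ab(2) by auto
      have "(a * v - b * u) * (a * v + b * u) = a\<^sup>2 * v\<^sup>2 - b\<^sup>2 * u\<^sup>2"
        by (simp add: algebra_simps power2_eq_square)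
      also have "\<dots> = m * (a\<^sup>2 - u\<^sup>2)" unfolding * by (simp add: algebra_simps)
      finally show ?thesis .
    qed
    then have "e * (a * v + b * u) = m1 * (a\<^sup>2 - u\<^sup>2)" using e m1 d0 by simp
    then have "m1 dvd e * (a * v + b * u)" by simp
    then show ?thesis using \<open>coprime m1 e\<close> by (simp only: coprime_dvd_mult_right_iff)
  qed
  let ?T = "x * y' - x' * y"
  have d1: "d dvd a * y - b * x" "d dvd a * y' - b * x'"
    unfolding d_def by (simp, simp add: eq)
  have d2: "m1 dvd a * y + b * x" "m1 dvd a * y' + b * x'"
    using m1_dvd[OF xy(2) d_def] m1_dvd[OF xy' d_def[unfolded eq]] by blast+
  have "a * ?T = x * (a * y' - b * x') - x' * (a * y - b * x)" by (simp add: algebra_simps)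
  then have "d dvd a * ?T" using d1 by (simp only: dvd_diff dvd_mult)
  moreover have "coprime d a" using cop_a m1 by (simp add: coprime_commute)
  ultimately have dT: "d dvd ?T" by (simp only: coprime_dvd_mult_right_iff)
  have "a * ?T = x * (a * y' + b * x') - x' * (a * y + b * x)" by (simp add: algebra_simps)
  then have "m1 dvd a * ?T" using d2 by (simp only: dvd_diff dvd_mult)
  moreover have cm1: "coprime m1 a" using cop_a m1 by (simp add: coprime_commute)
  ultimately have m1T: "m1 dvd ?T" by (simp only: coprime_dvd_mult_right_iff)
  \<comment> \<open>\<open>d\<close> and \<open>m1\<close> may share a factor, but it divides both
    \<open>2 * x\<close> and \<open>2 * y\<close>, hence 2.\<close>
  define q where "q = gcd d m1"
  have q: "q dvd d" "q dvd m1" by (simp_all add: q_def)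
  have "q dvd m" using q m1 by (simp add: dvd_mult)
  then have "coprime a q" "coprime b q"
    using coprime_divisors[OF dvd_refl _ cop_a] coprime_divisors[OF dvd_refl _ cop_b] by blast+
  then have "coprime q a" "coprime q b" by (simp_all only: coprime_commute)
  have "q dvd a * y - b * x" "q dvd a * y + b * x"
    using dvd_trans[OF q(1) d1(1)] dvd_trans[OF q(2) d2(1)] by auto
  from dvd_add[OF this] dvd_diff[OF this(2,1)] have "q dvd a * (2 * y)" "q dvd b * (2 * x)" by (simp_all add: algebra_simps)
  then have "q dvd 2 * y" "q dvd 2 * x"
    using \<open>coprime q a\<close> \<open>coprime q b\<close> by (simp_all only: coprime_dvd_mult_right_iff)
  then have "q dvd gcd (2 * x) (2 * y)" by simp
  also have "gcd (2 * x) (2 * y) = 2 * gcd x y" using gcd_mult_distrib_int[of 2 x y] by simp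
  finally have "q dvd 2" using xy(1) by simp
  have "lcm d m1 dvd ?T" using dT m1T by (rule lcm_least)
  with \<open>q dvd 2\<close> have "q * lcm d m1 dvd 2 * ?T" by (rule mult_dvd_mono)
  moreover have "m dvd q * lcm d m1"
    using prod_gcd_lcm_int[of d m1] by (simp add: q_def m1 flip: abs_mult)
  ultimately show ?thesis using dvd_trans by blast
qed

text \<open>For a fixed solution \<open>(x, y)\<close>, \<open>S\<close> and \<open>T\<close> are
  the real and imaginary part of the Gaussian integer \<open>(x - i y) * (u + i v)\<close>, which
  lies on the circle of radius \<open>m\<close>. Since \<open>m\<close> divides
  \<open>2 * T p\<close>, five values of \<open>2 * T p div m\<close> and two signs of
  \<open>S p\<close> remain: 10 = 5 * 2.\<close>

lemma card_primitive_fiber: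
  fixes m a b d :: int
  assumes "m > 0" "coprime a b" "a\<^sup>2 + b\<^sup>2 = m"
  defines "A \<equiv> {(x, y). coprime x y \<and> x\<^sup>2 + y\<^sup>2 = m \<and> gcd m (a * y - b * x) = d}"
  shows "finite A" "card A \<le> 10"
proof -
  have "finite A \<and> card A \<le> 10"
  proof (cases "A = {}")
    case False
    then obtain x y where xy: "coprime x y" "x\<^sup>2 + y\<^sup>2 = m" "gcd m (a * y - b * x) = d"
      by (auto simp: A_def)
    define S where "S = (\<lambda>(u, v). x * u + y * v)"
    define T where "T = (\<lambda>(u, v). x * v - u * y)"
    have ST: "(S p)\<^sup>2 + (T p)\<^sup>2 = m\<^sup>2" if "p \<in> A" for p
  
    proof -
      obtain u v where p: "p = (u, v)" by fastforce
      have "(x * u + y * v)\<^sup>2 + (x * v - u * y)\<^sup>2 = (x\<^sup>2 + y\<^sup>2) * (u\<^sup>2 + v\<^sup>2)"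
        by (simp add: algebra_simps power2_eq_square)
      moreover have "u\<^sup>2 + v\<^sup>2 = m" using that by (simp add: A_def p)
      ultimately show ?thesis using xy(2) by (simp add: S_def T_def p power2_eq_square)
    qed
    have dvd: "m dvd 2 * T p" if "p \<in> A" for p
      using that primitive_representations_dvd[OF assms(1-3) xy(1,2)] xy(3)
      by (auto simp: A_def T_def split: prod.splits)
    define f where "f = (\<lambda>p. ((2 * T p) div m, S p \<ge> 0))"
    have "inj_on f A"
    proof (rule inj_onI)
      fix p q assume p: "p \<in> A" and q: "q \<in> A" and "f p = f q"
      then have "2 * T p div m = 2 * T q div m" and s: "S p \<ge> 0 \<longleftrightarrow> S q \<ge> 0"
        by (auto simp: f_def)
      then have T: "T p = T q" using dvd[OF p] dvd[OF q] by (metis dvd_mult_div_cancel mult_cancel_left zero_neq_numeral)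
      then have "(S p)\<^sup>2 = (S q)\<^sup>2" using ST[OF p] ST[OF q] by simp
      then have S: "S p = S q" using s by (auto simp: power2_eq_iff)
      obtain u v u' v' where uv: "p = (u, v)" "q = (u', v')" by fastforce
      have "m * u = x * S p - y * T p" "m * v = y * S p + x * T p"
        "m * u' = x * S q - y * T q" "m * v' = y * S q + x * T q"
        unfolding xy(2)[symmetric] uv S_def T_def by (simp_all add: algebra_simps power2_eq_square)
      then have "m * u = m * u'" "m * v = m * v'" using S T by simp_all
      then show "p = q" using \<open>m > 0\<close> uv by simp
    qed
    moreover have "f ` A \<subseteq> {-2..2} \<times> UNIV"
    proof
      fix z assume "z \<in> f ` A"
      then obtain u v where p: "(u, v) \<in> A" and z: "z = f (u, v)" by auto
      obtain j where j: "2 * T (u, v) = m * j" using dvd[OF p] by blast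
      have "(T (u, v))\<^sup>2 \<le> m\<^sup>2" using ST[OF p] zero_le_power2[of "S (u, v)"] by linarith
      then have "(2 * T (u, v))\<^sup>2 \<le> (2 * m)\<^sup>2" by (simp add: power_mult_distrib)
      then have "m\<^sup>2 * j\<^sup>2 \<le> m\<^sup>2 * 2\<^sup>2" unfolding j by (simp add: power_mult_distrib mult.commute)
      then have "j\<^sup>2 \<le> 2\<^sup>2" using \<open>m > 0\<close> by simp
      then have "\<bar>j\<bar> \<le> 2" by (metis abs_le_square_iff abs_numeral)
      then show "z \<in> {-2..2} \<times> UNIV" using z j \<open>m > 0\<close> by (simp add: f_def abs_le_iff)
    qed
    ultimately show ?thesis
      using card_inj_on_le[of f A "{-2..2} \<times> UNIV"] inj_on_finite[of f A "{-2..2} \<times> UNIV"]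
      by (simp add: card_cartesian_product)
  qed simp
  then show "finite A" "card A \<le> 10" by auto
qed

text \<open>One solution \<open>(a, b)\<close> sorts all solutions by the divisor
  \<open>gcd m (a * y - b * x)\<close>, and each class has at most ten members.\<close>

lemma card_primitive_representations:
  fixes m :: nat
  assumes "m > 0"
  defines "P \<equiv> {(x::int, y). coprime x y \<and> x\<^sup>2 + y\<^sup>2 = int m}"
  shows "finite P" "card P \<le> 10 * card {d. d dvd m}"
proof -
  have "finite P \<and> card P \<le> 10 * card {d. d dvd m}"
  proof (cases "P = {}")
    case False
    then obtain a b where ab: "coprime a b" "a\<^sup>2 + b\<^sup>2 = int m" by (auto simp: P_def)
    define A where "A = (\<lambda>d. {(x, y). coprime x y \<and> x\<^sup>2 + y\<^sup>2 = int m \<and> gcd (int m) (a * y - b * x) = int d})"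
    have A: "finite (A d)" "card (A d) \<le> 10" for d
      using card_primitive_fiber[of "int m" a b "int d"] ab assms by (auto simp: A_def)
    have fin: "finite {d. d dvd m}" using assms by simp
    have P: "P = (\<Union>d\<in>{d. d dvd m}. A d)"
    proof -
      have "\<exists>d. d dvd m \<and> gcd (int m) k = int d" for k
        by (metis gcd_dvd1 gcd_ge_0_int int_dvd_int_iff nat_0_le)
      then show ?thesis by (auto simp: P_def A_def)
    qed
    have "card P \<le> (\<Sum>d | d dvd m. card (A d))" unfolding P by (rule card_UN_le[OF fin])
    also have "\<dots> \<le> (\<Sum>d | d dvd m. 10)" by (intro sum_mono A)
    finally show ?thesis using P fin A by auto
  qed simp
  then show "finite P" "card P \<le> 10 * card {d. d dvd m}" by auto
qed

text \<open>Dividing a solution by \<open>g = gcd x y\<close> makes it primitive for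
  \<open>n div g^2\<close>. The choice of \<open>g\<close> and the choice of the primitive solution
  each contribute one divisor count.\<close>

lemma card_sum_two_squares_le:
  fixes n :: nat
  assumes "n > 0"
  defines "R \<equiv> {(x::int, y). x\<^sup>2 + y\<^sup>2 = int n}"
  shows "finite R" "card R \<le> 10 * (card {d. d dvd n})\<^sup>2"
proof -
  define G where "G = {g. g\<^sup>2 dvd n}"
  have GD: "G \<subseteq> {d. d dvd n}" by (auto simp: G_def power2_eq_square dvd_mult_left)
  have finD: "finite {d. d dvd n}" using assms by simp
  have finG: "finite G" using GD finD by (rule finite_subset)
  define P where "P = (\<lambda>m::nat. {(x::int, y). coprime x y \<and> x\<^sup>2 + y\<^sup>2 = int m})"
  define Q where "Q = (\<lambda>g. (\<lambda>(x, y). (int g * x, int g * y)) ` P (n div g\<^sup>2))"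
  have R: "R \<subseteq> (\<Union>g\<in>G. Q g)"
  proof clarsimp
    fix x y assume "(x, y) \<in> R"
    then have xy: "x\<^sup>2 + y\<^sup>2 = int n" by (simp add: R_def)
    define g where "g = nat (gcd x y)"
    have g: "int g = gcd x y" by (simp add: g_def)
    have nz: "gcd x y \<noteq> 0" using xy assms by auto
    then obtain x' y' where *: "x = x' * int g" "y = y' * int g" "coprime x' y'"
      unfolding g using gcd_coprime_exists[of x y] by blast
    have eq: "int (g\<^sup>2) * (x'\<^sup>2 + y'\<^sup>2) = int n"
      unfolding xy[symmetric] * by (simp add: power_mult_distrib algebra_simps)
    then have "int (g\<^sup>2) dvd int n" by (metis dvd_triv_left)
    then have dvd: "g\<^sup>2 dvd n" by (simp only: int_dvd_int_iff)
    then obtain k where k: "n = g\<^sup>2 * k" by blast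
    have "g > 0" using nz g by (cases "g = 0") auto
    then have "x'\<^sup>2 + y'\<^sup>2 = int (n div g\<^sup>2)" using eq k by simp
    moreover have "g \<in> G" using dvd by (simp add: G_def)
    ultimately have "g \<in> G" "x'\<^sup>2 + y'\<^sup>2 = int (n div g\<^sup>2)" by simp_all
    then show "\<exists>g\<in>G. (x, y) \<in> Q g"
      using *(3) unfolding *(1,2)
      by (intro bexI[of _ g]) (auto simp: Q_def P_def mult.commute intro!: image_eqI[of _ _ "(x', y')"])
  qed
  have Q: "finite (Q g) \<and> card (Q g) \<le> 10 * card {d. d dvd n}" if "g \<in> G" for g
  proof -
    have m: "n div g\<^sup>2 > 0" "n div g\<^sup>2 dvd n"
    proof -
      from that have "g\<^sup>2 dvd n" by (simp add: G_def)
      then obtain k where k: "n = g\<^sup>2 * k" by blast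
      then have "g > 0" "k > 0" using assms by auto
      then show "n div g\<^sup>2 > 0" "n div g\<^sup>2 dvd n" using k by simp_all
    qed
    have "card (Q g) \<le> card (P (n div g\<^sup>2))"
      unfolding Q_def P_def using card_primitive_representations(1)[OF m(1)] by (rule card_image_le)
    also have "\<dots> \<le> 10 * card {d. d dvd n div g\<^sup>2}"
      unfolding P_def by (rule card_primitive_representations(2)[OF m(1)])
    also have "card {d. d dvd n div g\<^sup>2} \<le> card {d. d dvd n}"
      using finD m(2) by (intro card_mono) (auto intro: dvd_trans)
    finally show ?thesis
      unfolding Q_def P_def using card_primitive_representations(1)[OF m(1)] by simp
  qed
  show "finite R" by (rule finite_subset[OF R]) (use finG Q in auto)
  have "card R \<le> card (\<Union>g\<in>G. Q g)" by (rule card_mono[OF _ R]) (use finG Q in auto)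
  also have "\<dots> \<le> (\<Sum>g\<in>G. card (Q g))" by (rule card_UN_le[OF finG])
  also have "\<dots> \<le> (\<Sum>g\<in>G. 10 * card {d. d dvd n})" using Q by (intro sum_mono) auto
  also have "\<dots> = card G * (10 * card {d. d dvd n})" by simp
  also have "\<dots> \<le> card {d. d dvd n} * (10 * card {d. d dvd n})"
    using card_mono[OF finD GD] by (rule mult_right_mono) simp
  finally show "card R \<le> 10 * (card {d. d dvd n})\<^sup>2" by (simp add: power2_eq_square)
qed


section \<open>Lattice points on a whole circle and on short arcs\<close>

lemma finite_lattice_cball: "finite {v :: real^2. (\<forall>i. v $ i \<in> \<int>) \<and> norm v \<le> r}"
proof (rule finite_subset)
  let ?f = "\<lambda>(i, j). vector [of_int i, of_int j] :: real^2"
  show "{v :: real^2. (\<forall>i. v $ i \<in> \<int>) \<and> norm v \<le> r} \<subseteq> ?f ` ({-\<lceil>r\<rceil>..\<lceil>r\<rceil>} \<times> {-\<lceil>r\<rceil>..\<lceil>r\<rceil>})"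
  proof clarify
    fix v :: "real^2" assume v: "\<forall>i. v $ i \<in> \<int>" "norm v \<le> r"
    obtain i j where ij: "v $ 1 = of_int i" "v $ 2 = of_int j" using v(1) by (meson Ints_cases)
    have "\<bar>v $ 1\<bar> \<le> r" "\<bar>v $ 2\<bar> \<le> r"
      using v(2) component_le_norm_cart[of v] by (meson order_trans)+
    then have "\<bar>i\<bar> \<le> \<lceil>r\<rceil>" "\<bar>j\<bar> \<le> \<lceil>r\<rceil>" unfolding ij by linarith+
    moreover have "v = ?f (i, j)" using ij by (simp add: vec_eq_iff forall_2)
    ultimately show "v \<in> ?f ` ({-\<lceil>r\<rceil>..\<lceil>r\<rceil>} \<times> {-\<lceil>r\<rceil>..\<lceil>r\<rceil>})" by (intro image_eqI[of _ _ "(i, j)"]) (auto simp: abs_le_iff)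
  qed
qed simp

lemma finite_lattice_circle: "finite (lattice_circle lam)"
  by (rule finite_subset[OF _ finite_lattice_cball[of lam]]) (auto simp: lattice_circle_def)

lemma norm_sq_2: "(norm (x :: real^2))\<^sup>2 = (x $ 1)\<^sup>2 + (x $ 2)\<^sup>2"
  unfolding power2_norm_eq_inner inner_vec_def sum_2 by (simp add: power2_eq_square)

lemma inner_2: "(x :: real^2) \<bullet> y = x $ 1 * y $ 1 + x $ 2 * y $ 2"
  by (simp add: inner_vec_def sum_2)

lemma card_lattice_circle_le:
  assumes "\<epsilon> > 0"
  shows "\<exists>C\<ge>1. \<forall>lam\<ge>1. real (card (lattice_circle lam)) \<le> C * lam powr \<epsilon>"
proof -
  \<comment> \<open>The exponent is divided by 4 because \<open>n = lam^2\<close> and the divisor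
    count enters squared.\<close>
  obtain C where C: "C \<ge> 1" "\<And>n. n > 0 \<Longrightarrow> real (card {d::nat. d dvd n}) \<le> C * real n powr (\<epsilon> / 4)"
    using divisor_bound[of "\<epsilon> / 4"] assms by auto
  have "real (card (lattice_circle lam)) \<le> 10 * C\<^sup>2 * lam powr \<epsilon>" if lam: "lam \<ge> 1" for lam
  proof (cases "lattice_circle lam = {}")
    case False
    have coord: "\<exists>i j. v $ 1 = of_int i \<and> v $ 2 = of_int j \<and> real_of_int (i\<^sup>2 + j\<^sup>2) = lam\<^sup>2"
      if v: "v \<in> lattice_circle lam" for v
    proof -
      have "v $ 1 \<in> \<int>" "v $ 2 \<in> \<int>" "norm v = lam" using v by (auto simp: lattice_circle_def)
      moreover from this obtain i j where "v $ 1 = of_int i" "v $ 2 = of_int j" by (meson Ints_cases)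
      ultimately show ?thesis using norm_sq_2[of v] by auto
    qed
    then obtain i0 j0 :: int where "real_of_int (i0\<^sup>2 + j0\<^sup>2) = lam\<^sup>2" using False by blast
    moreover define n where "n = nat (i0\<^sup>2 + j0\<^sup>2)"
    ultimately have n: "real n = lam\<^sup>2" by simp
    then have "n > 0" using lam by (cases "n = 0") auto
    let ?f = "\<lambda>v::real^2. (\<lfloor>v $ 1\<rfloor>, \<lfloor>v $ 2\<rfloor>)"
    have "card (lattice_circle lam) \<le> card {(x::int, y). x\<^sup>2 + y\<^sup>2 = int n}"
    proof (rule card_inj_on_le[of ?f])
      show "inj_on ?f (lattice_circle lam)"
        by (rule inj_onI) (auto dest!: coord simp: vec_eq_iff forall_2)
      show "?f ` lattice_circle lam \<subseteq> {(x::int, y). x\<^sup>2 + y\<^sup>2 = int n}"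
      proof clarify
        fix v assume "v \<in> lattice_circle lam"
        from coord[OF this] obtain i j where ij: "v $ 1 = of_int i" "v $ 2 = of_int j"
          "real_of_int (i\<^sup>2 + j\<^sup>2) = lam\<^sup>2" by auto
        then have "real_of_int (i\<^sup>2 + j\<^sup>2) = real_of_int (int n)" using n by (simp only: of_int_of_nat_eq)
        then have "i\<^sup>2 + j\<^sup>2 = int n" by (simp only: of_int_eq_iff)
        then show "\<lfloor>v $ 1\<rfloor>\<^sup>2 + \<lfloor>v $ 2\<rfloor>\<^sup>2 = int n" using ij by simp
      qed
      show "finite {(x::int, y). x\<^sup>2 + y\<^sup>2 = int n}" by (rule card_sum_two_squares_le(1)[OF \<open>n > 0\<close>])
    qed
    also have "\<dots> \<le> 10 * (card {d. d dvd n})\<^sup>2" by (rule card_sum_two_squares_le(2)[OF \<open>n > 0\<close>])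
    finally have "real (card (lattice_circle lam)) \<le> real (10 * (card {d. d dvd n})\<^sup>2)"
      by (simp only: of_nat_le_iff)
    also have "\<dots> = 10 * (real (card {d. d dvd n}))\<^sup>2" by simp
    also have "\<dots> \<le> 10 * (C * real n powr (\<epsilon> / 4))\<^sup>2"
      using C(2)[OF \<open>n > 0\<close>] by (intro mult_left_mono power_mono) auto
    also have "real n powr (\<epsilon> / 4) = (lam powr 2) powr (\<epsilon> / 4)" using n lam by (simp add: powr_numeral)
    also have "\<dots> = lam powr (\<epsilon> / 2)" by (simp add: powr_powr)
    also have "(C * lam powr (\<epsilon> / 2))\<^sup>2 = C\<^sup>2 * lam powr \<epsilon>"
      by (simp add: power_mult_distrib power2_eq_square flip: powr_add)
    finally show ?thesis by simp
  qed (use C in auto)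
  moreover have "10 * C\<^sup>2 \<ge> 1" using C(1) one_le_power[of C 2] by linarith
  ultimately show ?thesis by blast
qed

text \<open>Three points of a circle of radius \<open>lam\<close> span a triangle whose area is the product of its
  sides over \<open>4 lam\<close>, while a lattice triangle has area at least \<open>1/2\<close>.\<close>

lemma lattice_circle_three_points:
  assumes "x \<in> lattice_circle lam" "y \<in> lattice_circle lam" "z \<in> lattice_circle lam"
    and "y \<noteq> x" "z \<noteq> x" "y \<noteq> z"
    and "norm (y - x) \<le> d" "norm (z - x) \<le> d"
  shows "lam \<le> d ^ 3"
proof -
  define a where "a = y - x"
  define b where "b = z - x"
  define D where "D = a $ 1 * b $ 2 - a $ 2 * b $ 1"
  have ax: "a \<bullet> x = - (norm a)\<^sup>2 / 2" and bx: "b \<bullet> x = - (norm b)\<^sup>2 / 2"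
    using assms(1-3) dot_square_norm[of x] dot_square_norm[of y] dot_square_norm[of z]
    by (auto simp: a_def b_def lattice_circle_def power2_norm_eq_inner inner_diff_left inner_diff_right
        inner_commute)
  have ab: "a \<noteq> 0" "b \<noteq> 0" "a \<noteq> b" using assms(4-6) by (auto simp: a_def b_def)
  \<comment> \<open>\<open>w\<close> is \<open>D\<close> times \<open>x\<close> turned by a right
    angle, so its norm is twice the area of the triangle times \<open>lam\<close>; computed from the
    chords, it is at most \<open>d ^ 3\<close>.\<close>
  define w where "w = (b \<bullet> x) *\<^sub>R a - (a \<bullet> x) *\<^sub>R b"
  have "w $ 1 = D * x $ 2" "w $ 2 = - D * x $ 1"
    unfolding w_def D_def by (simp_all add: inner_2 algebra_simps)
  then have "(norm w)\<^sup>2 = (\<bar>D\<bar> * norm x)\<^sup>2"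
    unfolding norm_sq_2[of w] power_mult_distrib norm_sq_2[of x] by (simp add: power_mult_distrib algebra_simps)
  then have w: "norm w = \<bar>D\<bar> * lam"
    using assms(1) by (simp add: lattice_circle_def power2_eq_iff_nonneg)
  \<comment> \<open>With \<open>D = 0\<close> the chords are parallel and the circle equations force
    \<open>a = b\<close>: a line meets a circle in at most two points.\<close>
  have "D \<noteq> 0"
  proof
    assume "D = 0"
    then have "2 *\<^sub>R w = 0" using w by simp
    moreover have "2 *\<^sub>R w = (norm a)\<^sup>2 *\<^sub>R b - (norm b)\<^sup>2 *\<^sub>R a"
      by (simp add: w_def ax bx scaleR_diff_right)
    ultimately have *: "(norm b)\<^sup>2 *\<^sub>R a = (norm a)\<^sup>2 *\<^sub>R b" by simp
    then have "(norm b)\<^sup>2 * norm a = (norm a)\<^sup>2 * norm b"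
      by (metis norm_scaleR abs_power2)
    then have "norm a = norm b" using ab by (simp add: power2_eq_square)
    then show False using * ab by simp
  qed
  moreover have "D \<in> \<int>"
    using assms(1-3) unfolding D_def a_def b_def lattice_circle_def by auto
  ultimately have "\<bar>D\<bar> \<ge> 1" by (simp add: Ints_nonzero_abs_ge1)
  have d0: "0 \<le> d" using assms(7) norm_ge_zero order_trans by blast
  have "0 \<le> lam" using assms(1) by (auto simp: lattice_circle_def)
  then have "lam \<le> \<bar>D\<bar> * lam" using \<open>\<bar>D\<bar> \<ge> 1\<close> by (simp add: mult_le_cancel_right1)
  also have "\<dots> \<le> norm ((b \<bullet> x) *\<^sub>R a) + norm ((a \<bullet> x) *\<^sub>R b)"
    unfolding w[symmetric] w_def by (rule norm_triangle_ineq4)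
  also have "\<dots> = (norm b)\<^sup>2 / 2 * norm a + (norm a)\<^sup>2 / 2 * norm b" by (simp add: ax bx)
  also have "\<dots> \<le> d\<^sup>2 / 2 * d + d\<^sup>2 / 2 * d"
    using assms(7,8) d0 unfolding a_def[symmetric] b_def[symmetric]
    by (intro add_mono mult_mono divide_right_mono power_mono) auto
  finally show ?thesis by (simp add: power3_eq_cube power2_eq_square)
qed

text \<open>Points of the disc are at most \<open>2 * d\<close> apart, whence the factor 8 =
  2^3.\<close>

lemma card_lattice_circle_ball_le_2:
  assumes "8 * d ^ 3 < lam"
  shows "card {x \<in> lattice_circle lam. norm (x - p) \<le> d} \<le> 2"
proof (rule ccontr)
  let ?A = "{x \<in> lattice_circle lam. norm (x - p) \<le> d}"
  assume "\<not> ?thesis"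
  then have "card ?A \<ge> 3" by simp
  then obtain T where "T \<subseteq> ?A" "card T = 3" by (meson obtain_subset_with_card_n)
  then obtain x y z where xyz: "x \<in> ?A" "y \<in> ?A" "z \<in> ?A" "y \<noteq> x" "z \<noteq> x" "y \<noteq> z"
    by (auto simp: card_3_iff)
  have "norm (u - v) \<le> 2 * d" if "u \<in> ?A" "v \<in> ?A" for u v
    using that norm_triangle_ineq4[of "u - p" "v - p"] by simp
  then have "lam \<le> (2 * d) ^ 3" using xyz by (intro lattice_circle_three_points[of x lam y z]) auto
  then show False using assms by (simp add: power_mult_distrib)
qed

lemma finite_B_max_counts:
  "finite {card {\<xi> \<in> lattice_circle lam. norm (x - \<xi>) \<le> sqrt lam} | x :: real^2. norm x = lam}"
  by (rule finite_subset[of _ "{..card (lattice_circle lam)}"])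
    (auto intro!: card_mono finite_lattice_circle)

text \<open>\<open>B_max\<close> counts in discs centred on the circle; a set of diameter at most
  \<open>sqrt lam\<close> lies in such a disc around any of its members.\<close>

lemma card_le_B_max:
  assumes "A \<subseteq> lattice_circle lam" "\<And>x y. x \<in> A \<Longrightarrow> y \<in> A \<Longrightarrow> norm (x - y) \<le> sqrt lam"
  shows "card A \<le> B_max lam"
proof (cases "A = {}")
  case False
  then obtain x where x: "x \<in> A" by blast
  have "card A \<le> card {\<xi> \<in> lattice_circle lam. norm (x - \<xi>) \<le> sqrt lam}"
    using assms x by (intro card_mono) (auto simp: finite_lattice_circle)
  also have "\<dots> \<le> B_max lam"
    unfolding B_max_def using assms(1) x
    by (intro Max_ge finite_B_max_counts) (auto simp: lattice_circle_def)
  finally show ?thesis .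
qed simp

lemma B_max_ge_1:
  assumes "lattice_circle lam \<noteq> {}" "lam \<ge> 0"
  shows "1 \<le> B_max lam"
proof -
  obtain x where "x \<in> lattice_circle lam" using assms by blast
  then show ?thesis using card_le_B_max[of "{x}" lam] assms(2) by simp
qed

text \<open>Together with the divisor bound this makes \<open>B_max\<close> smaller than any power
  of \<open>lam\<close>.\<close>

lemma B_max_le_card:
  assumes "lattice_circle lam \<noteq> {}"
  shows "B_max lam \<le> card (lattice_circle lam)"
  unfolding B_max_def
proof (rule Max.boundedI[OF finite_B_max_counts])
  show "{card {\<xi> \<in> lattice_circle lam. norm (x - \<xi>) \<le> sqrt lam} | x :: real^2. norm x = lam} \<noteq> {}"
    using assms by (auto simp: lattice_circle_def)
qed (auto intro!: card_mono finite_lattice_circle)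

section \<open>Fourier expansion of toral eigenfunctions\<close>

definition square :: "(real \<times> real) set" where
  "square = cbox (0, 0) (2 * pi, 2 * pi)"

definition fourier_null :: "(real \<times> real \<Rightarrow> complex) set" where
  "fourier_null = {v. continuous_on square v \<and>
     (\<forall>(k::int) (l::int). integral square (\<lambda>(x, y). v (x, y) * cis (of_int k * x + of_int l * y)) = 0)}"

lemma compact_square: "compact square"
  by (simp add: square_def)

lemma integrable_square:
  "continuous_on square f \<Longrightarrow> f integrable_on square" for f :: "real \<times> real \<Rightarrow> 'a::banach"
  unfolding square_def by (rule integrable_continuous)

lemma continuous_on_cis_linear [continuous_intros]:
  "continuous_on S (\<lambda>(x, y). cis (a * x + b * y))"
  by (simp add: case_prod_unfold) (intro continuous_intros)

lemma fourier_null_continuous: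
  "v \<in> fourier_null \<Longrightarrow> continuous_on square (\<lambda>(x, y). v (x, y) * cis (of_int k * x + of_int l * y))"
  unfolding fourier_null_def case_prod_unfold
  by (auto intro!: continuous_intros)

lemma fourier_null_combine:
  assumes "v \<in> fourier_null" "w \<in> fourier_null"
  shows "(\<lambda>z. a * v z + b * w z) \<in> fourier_null"
proof -
  have "integral square (\<lambda>(x, y). (a * v (x, y) + b * w (x, y)) * cis (of_int k * x + of_int l * y)) = 0" for k l :: int
  proof -
    let ?f = "\<lambda>v (x, y). v (x, y) * cis (of_int k * x + of_int l * y)"
    have "integral square (\<lambda>(x, y). (a * v (x, y) + b * w (x, y)) * cis (of_int k * x + of_int l * y))
      = integral square (\<lambda>z. a * ?f v z + b * ?f w z)"
      by (rule integral_cong) (auto simp: algebra_simps)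
    also have "\<dots> = a * integral square (?f v) + b * integral square (?f w)"
      using integrable_square[OF fourier_null_continuous] assms
      by (subst integral_add) (auto intro!: integrable_on_mult_right)
    also have "\<dots> = 0" using assms by (simp add: fourier_null_def)
    finally show ?thesis .
  qed
  then show ?thesis using assms by (auto simp: fourier_null_def intro!: continuous_intros)
qed

text \<open>Multiplication by a character only shifts the indices of the Fourier
  coefficients.\<close>

lemma fourier_null_cis:
  assumes "v \<in> fourier_null"
  shows "(\<lambda>z. cis (of_int m * fst z + of_int n * snd z) * v z) \<in> fourier_null"
proof -
  have "(\<lambda>(x, y). cis (of_int m * x + of_int n * y) * v (x, y) * cis (of_int k * x + of_int l * y))
    = (\<lambda>(x, y). v (x, y) * cis (of_int (k + m) * x + of_int (l + n) * y))" for k l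
    by (auto simp: fun_eq_iff algebra_simps cis_mult)
  moreover have "integral square (\<lambda>(x, y). v (x, y) * cis (of_int (k + m) * x + of_int (l + n) * y)) = 0"
    for k l
    using assms unfolding fourier_null_def by blast
  ultimately show ?thesis using assms
    by (auto simp: fourier_null_def intro!: continuous_intros)
qed

text \<open>Stands in for trigonometric polynomials: all that matters of such a polynomial is that
  multiplication by it preserves the vanishing of every Fourier coefficient. The property passes to
  sums and products, as the Stone-Weierstrass theorem requires, and spares a normal form for the
  polynomials.\<close>

definition fourier_multiplier :: "(real \<times> real \<Rightarrow> real) \<Rightarrow> bool" where
  "fourier_multiplier p \<longleftrightarrow> (\<forall>v\<in>fourier_null. (\<lambda>z. of_real (p z) * v z) \<in> fourier_null)"

lemma fourier_multiplier_const: "fourier_multiplier (\<lambda>_. c)"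
  unfolding fourier_multiplier_def using fourier_null_combine[of _ _ "of_real c" 0] by simp

lemma fourier_multiplier_add:
  "fourier_multiplier p \<Longrightarrow> fourier_multiplier q \<Longrightarrow> fourier_multiplier (\<lambda>z. p z + q z)"
  unfolding fourier_multiplier_def
proof
  fix v assume "\<forall>v\<in>fourier_null. (\<lambda>z. of_real (p z) * v z) \<in> fourier_null"
    "\<forall>v\<in>fourier_null. (\<lambda>z. of_real (q z) * v z) \<in> fourier_null" "v \<in> fourier_null"
  then have "(\<lambda>z. 1 * (of_real (p z) * v z) + 1 * (of_real (q z) * v z)) \<in> fourier_null"
    by (intro fourier_null_combine) blast+
  then show "(\<lambda>z. of_real (p z + q z) * v z) \<in> fourier_null" by (simp add: distrib_right)
qed

lemma fourier_multiplier_mult: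
  "fourier_multiplier p \<Longrightarrow> fourier_multiplier q \<Longrightarrow> fourier_multiplier (\<lambda>z. p z * q z)"
  unfolding fourier_multiplier_def by (simp add: mult.assoc)

lemma fourier_multiplier_trig:
  "fourier_multiplier (\<lambda>z. cos (of_int m * fst z + of_int n * snd z))"
  "fourier_multiplier (\<lambda>z. sin (of_int m * fst z + of_int n * snd z))"
proof -
  let ?c = "\<lambda>m n z. cis (of_int m * fst z + of_int n * snd z)"
  have c: "of_real (cos (of_int m * fst z + of_int n * snd z)) * v z
      = 1/2 * (?c m n z * v z) + 1/2 * (?c (-m) (-n) z * v z)"
    and s: "of_real (sin (of_int m * fst z + of_int n * snd z)) * v z
      = (-\<i>/2) * (?c m n z * v z) + (\<i>/2) * (?c (-m) (-n) z * v z)"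
    for z :: "real \<times> real" and v :: "real \<times> real \<Rightarrow> complex"
  proof -
    define a where "a = of_int m * fst z + of_int n * snd z"
    have "of_int (-m) * fst z + of_int (-n) * snd z = - a" by (simp add: a_def)
    then have *: "?c (-m) (-n) z = cis (- a)" "?c m n z = cis a" by (simp_all only: a_def)
    have cs: "of_real (cos a) = 1/2 * cis a + 1/2 * cis (- a)"
      "of_real (sin a) = (-\<i>/2) * cis a + (\<i>/2) * cis (- a)"
      by (simp_all add: complex_eq_iff)
    show "of_real (cos (of_int m * fst z + of_int n * snd z)) * v z
        = 1/2 * (?c m n z * v z) + 1/2 * (?c (-m) (-n) z * v z)"
      "of_real (sin (of_int m * fst z + of_int n * snd z)) * v z
        = (-\<i>/2) * (?c m n z * v z) + (\<i>/2) * (?c (-m) (-n) z * v z)"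
      unfolding * a_def[symmetric] cs by (simp_all only: distrib_right mult.assoc)
  qed
  show "fourier_multiplier (\<lambda>z. cos (of_int m * fst z + of_int n * snd z))"
    "fourier_multiplier (\<lambda>z. sin (of_int m * fst z + of_int n * snd z))"
    unfolding fourier_multiplier_def c s
    by (intro ballI fourier_null_combine fourier_null_cis; assumption)+
qed

text \<open>Lets a doubly periodic function be read as a function on the product of two unit
  circles.\<close>

lemma periodic_Arg2pi:
  fixes w :: "real \<times> real \<Rightarrow> 'a"
  assumes "\<And>x y (k::int) (l::int). w (x + 2 * pi * k, y + 2 * pi * l) = w (x, y)"
  shows "w (Arg2pi (cis x), Arg2pi (cis y)) = w (x, y)"
proof -
  have "\<exists>k::int. Arg2pi (cis x) = x + 2 * pi * k" for x
  proof -
    have "exp (\<i> * of_real (Arg2pi (cis x))) = exp (\<i> * of_real x)"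
      using Arg2pi_eq[of "cis x"] by (simp add: cis_conv_exp)
    then obtain k :: int where "\<i> * of_real (Arg2pi (cis x)) = \<i> * of_real x + (of_int (2 * k) * pi) * \<i>"
      by (auto simp: exp_eq)
    then have "\<i> * of_real (Arg2pi (cis x)) = \<i> * of_real (x + 2 * pi * k)" by (simp add: algebra_simps)
    then have "Arg2pi (cis x) = x + 2 * pi * k" by (simp only: mult_cancel_left of_real_eq_iff) simp
    then show ?thesis by blast
  qed
  then obtain k l :: int where "Arg2pi (cis x) = x + 2 * pi * k" "Arg2pi (cis y) = y + 2 * pi * l" by meson
  then show ?thesis using assms by simp
qed

text \<open>Stone-Weierstrass on the product of two unit circles, where \<open>w\<close> becomes
  \<open>W\<close>. The real and imaginary parts of the two coordinates separate points and are
  multipliers.\<close>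

lemma trig_approximation:
  fixes w :: "real \<times> real \<Rightarrow> real"
  assumes per: "\<And>x y (k::int) (l::int). w (x + 2 * pi * k, y + 2 * pi * l) = w (x, y)"
    and cont: "continuous_on square w" and e: "e > 0"
  obtains p where "fourier_multiplier p" "continuous_on square p"
    "\<And>z. z \<in> square \<Longrightarrow> \<bar>w z - p z\<bar> < e"
proof -
  let ?S = "sphere (0::complex) 1 \<times> sphere (0::complex) 1"
  let ?q = "\<lambda>z. (cis (fst z), cis (snd z))"
  define W where "W = (\<lambda>z. w (Arg2pi (fst z), Arg2pi (snd z)))"
  have Wq: "W (?q z) = w z" for z
    unfolding W_def using periodic_Arg2pi[of w "fst z" "snd z", OF per] by simp
  have qS: "?q ` square = ?S"
  proof -
    have 1: "\<exists>x\<in>{0..2*pi}. cis x = c" if "norm c = 1" for c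
      using Arg2pi_eq[of c] Arg2pi_ge_0[of c] Arg2pi_lt_2pi[of c] that
      by (intro bexI[of _ "Arg2pi c"]) (auto simp: cis_conv_exp)
    show ?thesis
    proof (rule set_eqI, rule iffI)
      fix z assume "z \<in> ?S"
      then obtain x y where "x \<in> {0..2*pi}" "y \<in> {0..2*pi}" "cis x = fst z" "cis y = snd z"
        using 1[of "fst z"] 1[of "snd z"] by auto
      then show "z \<in> ?q ` square"
        by (intro image_eqI[of _ _ "(x, y)"]) (auto simp: square_def cbox_Pair_eq)
    qed auto
  qed
  have qcont: "continuous_on square ?q" by (intro continuous_intros)
  \<comment> \<open>\<open>Arg2pi\<close> jumps at 1, so continuity comes from the quotient map
    \<open>?q\<close> instead: on the compact square it is a closed map, and it carries the preimage
    of \<open>B\<close> under \<open>w\<close> onto the preimage under \<open>W\<close>.\<close>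
  have contW: "continuous_on ?S W"
    unfolding continuous_on_closed_invariant
  proof (intro allI impI)
    fix B :: "real set" assume B: "closed B"
    have "closed (w -` B \<inter> square)"
      using cont B compact_imp_closed[OF compact_square] by (simp add: continuous_on_closed_vimage)
    then have "compact (square \<inter> (w -` B \<inter> square))"
      using compact_square by (rule compact_Int_closed[rotated])
    then have "compact (w -` B \<inter> square)" by (simp add: Int_absorb1)
    then have "compact (?q ` (w -` B \<inter> square))"
      by (rule compact_continuous_image[rotated]) (rule continuous_on_subset[OF qcont], simp)
    moreover have "?q ` (w -` B \<inter> square) \<inter> ?S = W -` B \<inter> ?S"
      unfolding qS[symmetric] using Wq by (auto; metis vimage_eq Wq fst_conv snd_conv)
    ultimately show "\<exists>A. closed A \<and> A \<inter> ?S = W -` B \<inter> ?S"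
      using compact_imp_closed by blast
  qed
  let ?P = "\<lambda>f. continuous_on ?S f \<and> fourier_multiplier (\<lambda>z. f (?q z))"
  have "\<exists>g. ?P g \<and> (\<forall>x\<in>?S. \<bar>W x - g x\<bar> < e)"
  proof (rule Stone_Weierstrass_HOL[OF _ _ _ _ _ _ contW e])
    show "compact ?S" by (intro compact_Times) auto
    fix x y assume xy: "x \<in> ?S \<and> y \<in> ?S \<and> x \<noteq> y"
    have "?P (\<lambda>z. Re (fst z))" "?P (\<lambda>z. Im (fst z))" "?P (\<lambda>z. Re (snd z))" "?P (\<lambda>z. Im (snd z))"
      using fourier_multiplier_trig[of 1 0] fourier_multiplier_trig[of 0 1]
      by (auto intro!: continuous_intros)
    moreover have "Re (fst x) \<noteq> Re (fst y) \<or> Im (fst x) \<noteq> Im (fst y) \<or> Re (snd x) \<noteq> Re (snd y) \<or> Im (snd x) \<noteq> Im (snd y)"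
      using xy by (auto simp: prod_eq_iff complex_eq_iff)
    ultimately show "\<exists>f. ?P f \<and> f x \<noteq> f y" by blast
  qed (auto intro!: continuous_intros fourier_multiplier_const fourier_multiplier_add fourier_multiplier_mult)
  then obtain g where g: "?P g" "\<And>x. x \<in> ?S \<Longrightarrow> \<bar>W x - g x\<bar> < e" by blast
  show ?thesis
  proof
    show "fourier_multiplier (\<lambda>z. g (?q z))" using g by blast
    show "continuous_on square (\<lambda>z. g (?q z))"
      using continuous_on_compose2[OF conjunct1[OF g(1)] qcont] qS by simp
    fix z assume "z \<in> square"
    then have "?q z \<in> ?S" using qS by blast
    from g(2)[OF this] show "\<bar>w z - g (?q z)\<bar> < e" by (simp only: Wq)
  qed
qed

text \<open>If the multiplier \<open>p\<close> approximates \<open>Re w\<close>, then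
  \<open>p * w\<close> has integral zero, so the integral of \<open>(Re w)^2\<close> equals that of
  \<open>(Re w - p) * Re w\<close> and is as small as desired. The real part is what the expansion
  of a real eigenfunction calls for.\<close>

lemma fourier_null_Re_eq_0:
  assumes per: "\<And>x y (k::int) (l::int). w (x + 2 * pi * k, y + 2 * pi * l) = w (x, y)"
    and null: "w \<in> fourier_null" and z: "z \<in> square"
  shows "Re (w z) = 0"
proof -
  let ?r = "\<lambda>z. Re (w z)"
  have contw: "continuous_on square w" using null by (simp add: fourier_null_def)
  then have cont: "continuous_on square ?r" by (intro continuous_intros)
  let ?M = "integral square (\<lambda>z. \<bar>?r z\<bar>)"
  have "?M \<ge> 0" by (rule integral_nonneg) (auto intro!: integrable_square continuous_intros contw)
  have "integral square (\<lambda>z. (?r z)\<^sup>2) \<le> e * ?M" if e: "e > 0" for e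
  proof -
    obtain p where p: "fourier_multiplier p" "continuous_on square p"
      "\<And>z. z \<in> square \<Longrightarrow> \<bar>?r z - p z\<bar> < e"
      using trig_approximation[of ?r e] per cont e by auto
    have "(\<lambda>z. of_real (p z) * w z) \<in> fourier_null" using p(1) null by (simp add: fourier_multiplier_def)
    then have "integral square (\<lambda>(x, y). of_real (p (x, y)) * w (x, y) * cis (of_int 0 * x + of_int 0 * y)) = 0"
      unfolding fourier_null_def by blast
    then have "integral square (\<lambda>z. of_real (p z) * w z) = 0" by (simp add: case_prod_unfold)
    moreover have "((\<lambda>z. of_real (p z) * w z) has_integral integral square (\<lambda>z. of_real (p z) * w z)) square"
      by (intro integrable_integral integrable_square continuous_intros p contw)
    ultimately have "((\<lambda>z. of_real (p z) * w z) has_integral 0) square" by simp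
    from has_integral_linear[OF this bounded_linear_Re]
    have "((\<lambda>z. p z * ?r z) has_integral 0) square" by (simp add: o_def)
    then have 0: "integral square (\<lambda>z. p z * ?r z) = 0" by (simp add: integral_unique)
    have "integral square (\<lambda>z. (?r z)\<^sup>2) = integral square (\<lambda>z. p z * ?r z) + integral square (\<lambda>z. (?r z - p z) * ?r z)"
      by (subst integral_add[symmetric])
        (auto intro!: integrable_square continuous_intros p contw integral_cong simp: algebra_simps power2_eq_square)
    also have "integral square (\<lambda>z. (?r z - p z) * ?r z) \<le> integral square (\<lambda>z. e * \<bar>?r z\<bar>)"
    proof (rule integral_le)
      fix z assume "z \<in> square"
      have "(?r z - p z) * ?r z \<le> \<bar>?r z - p z\<bar> * \<bar>?r z\<bar>" by (metis abs_ge_self abs_mult)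
      also have "\<dots> \<le> e * \<bar>?r z\<bar>" using p(3)[OF \<open>z \<in> square\<close>] by (intro mult_right_mono) auto
      finally show "(?r z - p z) * ?r z \<le> e * \<bar>?r z\<bar>" .
    qed (auto intro!: integrable_square continuous_intros p contw)
    finally show ?thesis using 0 by simp
  qed
  then have "integral square (\<lambda>z. (?r z)\<^sup>2) \<le> 0"
  proof -
    have "integral square (\<lambda>z. (?r z)\<^sup>2) \<le> 0 + e" if "e > 0" for e
    proof -
      have "e / (?M + 1) * ?M \<le> e" using \<open>?M \<ge> 0\<close> that by (simp add: field_simps)
      then show ?thesis
        using \<open>\<And>e. 0 < e \<Longrightarrow> integral square (\<lambda>z. (?r z)\<^sup>2) \<le> e * ?M\<close>[of "e / (?M + 1)"] that \<open>?M \<ge> 0\<close>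
        by simp
    qed
    then show ?thesis by (rule field_le_epsilon)
  qed
  moreover have "0 \<le> integral square (\<lambda>z. (?r z)\<^sup>2)"
    by (rule integral_nonneg) (auto intro!: integrable_square continuous_intros contw)
  ultimately have "integral square (\<lambda>z. (?r z)\<^sup>2) = 0" by simp
  then have "(?r z)\<^sup>2 = 0"
    using z unfolding square_def
    by (subst (asm) integral_cbox_eq_0_iff)
      (auto intro!: continuous_intros contw[unfolded square_def] simp: box_eq_empty content_cbox_if inner_Pair Basis_prod_def not_le)
  then show ?thesis by simp
qed

section \<open>Exponential integrals over periods and the coefficients of an eigenfunction\<close>

lemma cis_compose_has_vector_derivative:
  assumes "(\<psi> has_real_derivative d) (at t within S)"
  shows "((\<lambda>t. cis (\<psi> t)) has_vector_derivative \<i> * of_real d * cis (\<psi> t)) (at t within S)"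
  using assms unfolding has_vector_derivative_complex_iff
  by (auto intro!: derivative_eq_intros)

lemma cis_has_vector_derivative:
  "((\<lambda>t. cis (a * t)) has_vector_derivative \<i> * of_real a * cis (a * t)) (at t within S)"
  by (rule cis_compose_has_vector_derivative) (auto intro!: derivative_eq_intros)

lemma cis_2pi_int: "cis (of_int k * (2 * pi)) = 1"
  using cis_multiple_2pi[of "of_int k"] by (simp add: mult_ac)

lemma integral_cis_int:
  fixes m :: int
  shows "integral {0..2*pi} (\<lambda>t. cis (of_int m * t)) = (if m = 0 then 2 * pi else 0)"
proof (cases "m = 0")
  case False
  have "((\<lambda>t. cis (of_int m * t)) has_integral
      (cis (of_int m * (2 * pi)) / (\<i> * of_int m) - cis (of_int m * 0) / (\<i> * of_int m))) {0..2*pi}"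
  proof (rule fundamental_theorem_of_calculus)
    fix t
    show "((\<lambda>t. cis (of_int m * t) / (\<i> * of_int m)) has_vector_derivative cis (of_int m * t)) (at t within {0..2 * pi})"
      using has_vector_derivative_divide[OF cis_has_vector_derivative[of "of_int m" t], of "\<i> * of_int m"] False
      by simp
  qed simp
  then show ?thesis using False by (simp add: integral_unique cis_2pi_int)
qed (simp add: scaleR_conv_of_real)

lemma integral_square_iterate:
  fixes f :: "real \<times> real \<Rightarrow> complex"
  assumes "continuous_on square f"
  shows "integral square f = integral {0..2*pi} (\<lambda>x. integral {0..2*pi} (\<lambda>y. f (x, y)))"
    and "integral square f = integral {0..2*pi} (\<lambda>y. integral {0..2*pi} (\<lambda>x. f (x, y)))"
proof -
  have "continuous_on (cbox (0, 0) (2*pi, 2*pi)) (\<lambda>(x, y). f (x, y))"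
    using assms by (simp add: square_def)
  from integral_prod_continuous[OF this] integral_swap_continuous[OF this]
  show "integral square f = integral {0..2*pi} (\<lambda>x. integral {0..2*pi} (\<lambda>y. f (x, y)))"
    "integral square f = integral {0..2*pi} (\<lambda>y. integral {0..2*pi} (\<lambda>x. f (x, y)))"
    by (simp_all add: square_def)
qed

lemma integral_square_cis:
  fixes m n :: int
  shows "integral square (\<lambda>(x, y). cis (of_int m * x + of_int n * y)) = (if m = 0 \<and> n = 0 then (2 * pi)\<^sup>2 else 0)"
proof -
  have "integral square (\<lambda>(x, y). cis (of_int m * x + of_int n * y))
      = integral {0..2*pi} (\<lambda>x. integral {0..2*pi} (\<lambda>y. cis (of_int m * x) * cis (of_int n * y)))"
    by (subst integral_square_iterate(1)) (auto intro!: continuous_intros simp: cis_mult)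
  also have "\<dots> = integral {0..2*pi} (\<lambda>x. cis (of_int m * x)) * integral {0..2*pi} (\<lambda>y. cis (of_int n * y))"
    by simp
  also have "\<dots> = (if m = 0 \<and> n = 0 then (2 * pi)\<^sup>2 else 0)"
    unfolding integral_cis_int by (simp add: power2_eq_square)
  finally show ?thesis .
qed

lemma integral_second_derivative_cis:
  fixes f :: "real \<Rightarrow> real" and k :: int
  assumes "\<And>t. (f has_real_derivative f1 t) (at t)" "\<And>t. (f1 has_real_derivative f2 t) (at t)"
    and "f (2 * pi) = f 0" "f1 (2 * pi) = f1 0" "continuous_on UNIV f2"
  shows "integral {0..2*pi} (\<lambda>t. of_real (f2 t) * cis (of_int k * t))
    = - (of_int k)\<^sup>2 * integral {0..2*pi} (\<lambda>t. of_real (f t) * cis (of_int k * t))"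
proof -
  define K :: complex where "K = of_int k"
  define c where "c = (\<lambda>t. cis (of_int k * t))"
  \<comment> \<open>Performs both integrations by parts at once: \<open>h\<close> is an
    antiderivative of \<open>f2 * c + K^2 * f * c\<close>, and periodicity gives it equal values at
    the two ends.\<close>
  define h where "h = (\<lambda>t. of_real (f1 t) * c t - \<i> * K * (of_real (f t) * c t))"
  have cont: "continuous_on S f" for S
    using assms(1) by (meson DERIV_isCont continuous_at_imp_continuous_on)
  have contc: "continuous_on S c" for S unfolding c_def by (intro continuous_intros)
  have "((\<lambda>t. of_real (f2 t) * c t + K\<^sup>2 * (of_real (f t) * c t)) has_integral (h (2 * pi) - h 0)) {0..2*pi}"
  proof (rule fundamental_theorem_of_calculus)
    fix t :: real
    have c: "(c has_vector_derivative \<i> * K * c t) (at t within {0..2*pi})"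
      using cis_has_vector_derivative[of "of_int k"] by (simp add: c_def K_def)
    have r: "((\<lambda>t. complex_of_real (f t)) has_vector_derivative of_real (f1 t)) (at t within {0..2*pi})"
      "((\<lambda>t. complex_of_real (f1 t)) has_vector_derivative of_real (f2 t)) (at t within {0..2*pi})"
      using assms(1,2)[of t, THEN has_field_derivative_at_within]
      by (simp_all only: has_vector_derivative_of_real has_real_derivative_iff_has_vector_derivative)
    note d = has_vector_derivative_diff[OF has_vector_derivative_mult[OF r(2) c]
        has_vector_derivative_mult_right[OF has_vector_derivative_mult[OF r(1) c], of "\<i> * K"]]
    show "(h has_vector_derivative of_real (f2 t) * c t + K\<^sup>2 * (of_real (f t) * c t)) (at t within {0..2*pi})"
      unfolding h_def
      by (rule has_vector_derivative_eq_rhs[OF d]) (simp add: algebra_simps power2_eq_square)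
  qed simp
  moreover have "c (2 * pi) = c 0" using cis_2pi_int by (simp add: c_def)
  then have "h (2 * pi) - h 0 = 0" using assms by (simp add: h_def)
  ultimately have "integral {0..2*pi} (\<lambda>t. of_real (f2 t) * c t + K\<^sup>2 * (of_real (f t) * c t)) = 0"
    by (simp add: integral_unique)
  also have "integral {0..2*pi} (\<lambda>t. of_real (f2 t) * c t + K\<^sup>2 * (of_real (f t) * c t))
    = integral {0..2*pi} (\<lambda>t. of_real (f2 t) * c t) + integral {0..2*pi} (\<lambda>t. K\<^sup>2 * (of_real (f t) * c t))"
    by (rule integral_add)
      (intro integrable_continuous_real continuous_intros cont contc continuous_on_subset[OF assms(5)]; simp)+
  finally show ?thesis by (simp add: add_eq_0_iff2 c_def K_def)
qed


text \<open>Integrating by parts twice in each variable turns the eigenvalue equation into the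
  coefficient times \<open>lam^2 - k^2 - l^2\<close> being zero.\<close>

lemma fourier_coefficient_eq_0:
  fixes U :: "real \<times> real \<Rightarrow> real" and k l :: int
  assumes dx: "\<And>x y. ((\<lambda>x. U (x, y)) has_real_derivative Ux (x, y)) (at x)"
    and dxx: "\<And>x y. ((\<lambda>x. Ux (x, y)) has_real_derivative Uxx (x, y)) (at x)"
    and dy: "\<And>x y. ((\<lambda>y. U (x, y)) has_real_derivative Uy (x, y)) (at y)"
    and dyy: "\<And>x y. ((\<lambda>y. Uy (x, y)) has_real_derivative Uyy (x, y)) (at y)"
    and cont: "continuous_on UNIV U" "continuous_on UNIV Uxx" "continuous_on UNIV Uyy"
    and per: "\<And>y. U (2 * pi, y) = U (0, y)" "\<And>x. U (x, 2 * pi) = U (x, 0)"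
      "\<And>y. Ux (2 * pi, y) = Ux (0, y)" "\<And>x. Uy (x, 2 * pi) = Uy (x, 0)"
    and eq: "\<And>z. Uxx z + Uyy z = - lam\<^sup>2 * U z"
    and ne: "real_of_int (k\<^sup>2 + l\<^sup>2) \<noteq> lam\<^sup>2"
  shows "integral square (\<lambda>(x, y). of_real (U (x, y)) * cis (of_int k * x + of_int l * y)) = 0"
proof -
  let ?c = "\<lambda>V (x, y). complex_of_real (V (x, y)) * cis (of_int k * x + of_int l * y)"
  have cc: "continuous_on S (?c V)" if "continuous_on UNIV V" for V S
    using continuous_on_subset[OF that, of S] unfolding case_prod_unfold
    by (auto intro!: continuous_intros)
  have slice: "continuous_on UNIV (\<lambda>x. V (x, y))" "continuous_on UNIV (\<lambda>y. V (x, y))"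
    if "continuous_on UNIV V" for V :: "real \<times> real \<Rightarrow> real" and x y
    by (rule continuous_on_compose2[OF that]; auto intro!: continuous_intros)+
  have iter: "integral square (?c V)
      = integral {0..2*pi} (\<lambda>x. cis (of_int k * x) * integral {0..2*pi} (\<lambda>y. of_real (V (x, y)) * cis (of_int l * y)))"
    "integral square (?c V)
      = integral {0..2*pi} (\<lambda>y. cis (of_int l * y) * integral {0..2*pi} (\<lambda>x. of_real (V (x, y)) * cis (of_int k * x)))"
    if "continuous_on UNIV V" for V
  proof -
    have eq: "?c V (x, y) = cis (of_int k * x) * (of_real (V (x, y)) * cis (of_int l * y))"
      "?c V (x, y) = cis (of_int l * y) * (of_real (V (x, y)) * cis (of_int k * x))" for x y
      by (simp_all only: prod.case cis_mult[symmetric] mult_ac)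
    show "integral square (?c V)
      = integral {0..2*pi} (\<lambda>x. cis (of_int k * x) * integral {0..2*pi} (\<lambda>y. of_real (V (x, y)) * cis (of_int l * y)))"
      unfolding integral_square_iterate(1)[OF cc[OF that]] eq(1) integral_mult_right by (rule refl)
    show "integral square (?c V)
      = integral {0..2*pi} (\<lambda>y. cis (of_int l * y) * integral {0..2*pi} (\<lambda>x. of_real (V (x, y)) * cis (of_int k * x)))"
      unfolding integral_square_iterate(2)[OF cc[OF that]] eq(2) integral_mult_right by (rule refl)
  qed
  have y: "integral square (?c Uyy) = - (of_int l)\<^sup>2 * integral square (?c U)"
  proof -
    have "integral square (?c Uyy)
        = integral {0..2*pi} (\<lambda>x. cis (of_int k * x) * integral {0..2*pi} (\<lambda>y. of_real (Uyy (x, y)) * cis (of_int l * y)))"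
      by (rule iter(1)[OF cont(3)])
    also have "\<dots> = integral {0..2*pi} (\<lambda>x. - (of_int l)\<^sup>2 * (cis (of_int k * x) * integral {0..2*pi} (\<lambda>y. of_real (U (x, y)) * cis (of_int l * y))))"
    proof (rule integral_cong)
      fix x
      have "integral {0..2*pi} (\<lambda>y. of_real (Uyy (x, y)) * cis (of_int l * y))
        = - (of_int l)\<^sup>2 * integral {0..2*pi} (\<lambda>y. of_real (U (x, y)) * cis (of_int l * y))"
        by (rule integral_second_derivative_cis) (rule dy dyy per slice cont)+
      then show "cis (of_int k * x) * integral {0..2*pi} (\<lambda>y. of_real (Uyy (x, y)) * cis (of_int l * y))
        = - (of_int l)\<^sup>2 * (cis (of_int k * x) * integral {0..2*pi} (\<lambda>y. of_real (U (x, y)) * cis (of_int l * y)))"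
        by (simp only: mult_ac)
    qed
    also have "\<dots> = - (of_int l)\<^sup>2 * integral square (?c U)"
      unfolding integral_mult_right[of _ "- (of_int l)\<^sup>2"] iter(1)[OF cont(1)] by (rule refl)
    finally show ?thesis .
  qed
  have x: "integral square (?c Uxx) = - (of_int k)\<^sup>2 * integral square (?c U)"
  proof -
    have "integral square (?c Uxx)
        = integral {0..2*pi} (\<lambda>y. cis (of_int l * y) * integral {0..2*pi} (\<lambda>x. of_real (Uxx (x, y)) * cis (of_int k * x)))"
      by (rule iter(2)[OF cont(2)])
    also have "\<dots> = integral {0..2*pi} (\<lambda>y. - (of_int k)\<^sup>2 * (cis (of_int l * y) * integral {0..2*pi} (\<lambda>x. of_real (U (x, y)) * cis (of_int k * x))))"
    proof (rule integral_cong)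
      fix y
      have "integral {0..2*pi} (\<lambda>x. of_real (Uxx (x, y)) * cis (of_int k * x))
        = - (of_int k)\<^sup>2 * integral {0..2*pi} (\<lambda>x. of_real (U (x, y)) * cis (of_int k * x))"
        by (rule integral_second_derivative_cis) (rule dx dxx per slice cont)+
      then show "cis (of_int l * y) * integral {0..2*pi} (\<lambda>x. of_real (Uxx (x, y)) * cis (of_int k * x))
        = - (of_int k)\<^sup>2 * (cis (of_int l * y) * integral {0..2*pi} (\<lambda>x. of_real (U (x, y)) * cis (of_int k * x)))"
        by (simp only: mult_ac)
    qed
    also have "\<dots> = - (of_int k)\<^sup>2 * integral square (?c U)"
      unfolding integral_mult_right[of _ "- (of_int k)\<^sup>2"] iter(2)[OF cont(1)] by (rule refl)
    finally show ?thesis .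
  qed
  have "integral square (?c Uxx) + integral square (?c Uyy) = integral square (\<lambda>z. ?c Uxx z + ?c Uyy z)"
    by (rule integral_add[symmetric]) (intro integrable_square cc cont)+
  also have "\<dots> = integral square (\<lambda>z. - (of_real lam)\<^sup>2 * ?c U z)"
  proof (rule integral_cong)
    fix z :: "real \<times> real"
    have "complex_of_real (Uxx z) + of_real (Uyy z) = - (of_real lam)\<^sup>2 * of_real (U z)"
      using arg_cong[OF eq[of z], of complex_of_real] by simp
    then show "?c Uxx z + ?c Uyy z = - (of_real lam)\<^sup>2 * ?c U z"
      by (cases z) (simp only: prod.case mult.assoc[symmetric] distrib_right[symmetric])
  qed
  also have "\<dots> = - (of_real lam)\<^sup>2 * integral square (?c U)" by simp
  finally have "complex_of_real (lam\<^sup>2 - real_of_int (k\<^sup>2 + l\<^sup>2)) * integral square (?c U) = 0"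
    unfolding x y by (simp add: algebra_simps)
  then show ?thesis using ne by (simp only: mult_eq_0_iff of_real_eq_0_iff) simp
qed

lemma vector_2_eq: "(vector [x, y] :: real^2) = x *\<^sub>R axis 1 1 + y *\<^sub>R axis 2 1"
  by (simp add: vec_eq_iff forall_2 axis_def)

lemma partial_has_real_derivative:
  assumes "u differentiable (at (vector [x, y]))"
  shows "((\<lambda>x. u (vector [x, y])) has_real_derivative partial 1 u (vector [x, y])) (at x)"
    and "((\<lambda>y. u (vector [x, y])) has_real_derivative partial 2 u (vector [x, y])) (at y)"
proof -
  let ?D = "frechet_derivative u (at (vector [x, y]))"
  have D: "(u has_derivative ?D) (at (vector [x, y]))" using assms by (simp add: frechet_derivative_works)
  have lin: "?D (h *\<^sub>R e) = h * ?D e" for h e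
    using linear_scale[OF has_derivative_linear[OF D]] by simp
  have 1: "((\<lambda>x. vector [x, y] :: real^2) has_derivative (\<lambda>h. h *\<^sub>R axis 1 1)) (at x)"
    and 2: "((\<lambda>y. vector [x, y] :: real^2) has_derivative (\<lambda>h. h *\<^sub>R axis 2 1)) (at y)"
    unfolding vector_2_eq by (auto intro!: derivative_eq_intros)
  show "((\<lambda>x. u (vector [x, y])) has_real_derivative partial 1 u (vector [x, y])) (at x)"
    "((\<lambda>y. u (vector [x, y])) has_real_derivative partial 2 u (vector [x, y])) (at y)"
    using has_derivative_compose[OF 1 D] has_derivative_compose[OF 2 D]
    by (simp_all add: has_field_derivative_def partial_def lin mult_commute_abs)
qed

lemma torus_proj_eq_iff: "torus_proj x = torus_proj y \<longleftrightarrow> torus_rel x y"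
  by (simp add: torus_proj_def torus.abs_eq_iff)

lemma torus_proj_translate: "torus_proj (x + vector [2 * pi * of_int k, 2 * pi * of_int l]) = torus_proj x"
  unfolding torus_proj_eq_iff torus_rel_def forall_2 by simp

lemma torus_proj_square: "\<exists>z\<in>square. torus_proj p = torus_proj (vector [fst z, snd z])"
proof -
  have 1: "\<exists>t k::int. t \<in> {0..2*pi} \<and> s = t + 2 * pi * of_int k" for s :: real
  proof (intro exI conjI)
    have "s = 2 * pi * (s / (2 * pi))" by simp
    then have "s = 2 * pi * frac (s / (2 * pi)) + 2 * pi * of_int \<lfloor>s / (2 * pi)\<rfloor>"
      by (simp add: frac_def algebra_simps)
    then show "s = 2 * pi * frac (s / (2 * pi)) + 2 * pi * of_int \<lfloor>s / (2 * pi)\<rfloor>" .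
    show "2 * pi * frac (s / (2 * pi)) \<in> {0..2*pi}"
      using frac_ge_0[of "s / (2 * pi)"] frac_lt_1[of "s / (2 * pi)"] by simp
  qed
  obtain x k where x: "x \<in> {0..2*pi}" "p $ 1 = x + 2 * pi * of_int k" using 1 by blast
  obtain y l where y: "y \<in> {0..2*pi}" "p $ 2 = y + 2 * pi * of_int l" using 1 by blast
  have "torus_proj p = torus_proj (vector [x, y])"
    using x(2) y(2) unfolding torus_proj_eq_iff torus_rel_def forall_2 by auto
  then show ?thesis
    using x(1) y(1) by (intro bexI[of _ "(x, y)"]) (auto simp: square_def cbox_Pair_eq)
qed

text \<open>Coefficients off the circle vanish, so subtracting the finitely many terms on the circle
  leaves a continuous periodic function with no Fourier coefficients at all.\<close>

lemma eigenfunction_expansion: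
  fixes F :: "torus \<Rightarrow> real"
  assumes "torus_C2 F" and eigen: "\<forall>p. - torus_laplacian F p = lam\<^sup>2 * F p" and lam: "lam \<ge> 0"
  obtains a where "\<And>x. of_real (F (torus_proj x)) = (\<Sum>\<xi>\<in>lattice_circle lam. a \<xi> * cis (\<xi> \<bullet> x))"
proof -
  define u where "u = F \<circ> torus_proj"
  define E where "E = lattice_circle lam"
  have fin: "finite E" unfolding E_def by (rule finite_lattice_circle)
  have C2: "\<And>x. u differentiable (at x)" "\<And>i x. partial i u differentiable (at x)"
    "\<And>i j. continuous_on UNIV (partial j (partial i u))"
    using assms(1) by (auto simp: torus_C2_def u_def numeral_2_eq_2)
  define vec where "vec = (\<lambda>z. vector [fst z, snd z] :: real^2)"
  have contvec: "continuous_on S vec" for S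
    unfolding vec_def vector_2_eq by (intro continuous_intros)
  define U where "U = (\<lambda>z. u (vec z))"
  have contu: "continuous_on UNIV u"
    using C2(1) by (auto intro!: continuous_at_imp_continuous_on differentiable_imp_continuous_within)
  have contU: "continuous_on S U" for S
    unfolding U_def by (rule continuous_on_compose2[OF contu contvec]) simp
  have per_u: "u (x + vector [2 * pi * of_int k, 2 * pi * of_int l]) = u x" for x k l
    by (simp add: u_def torus_proj_translate)
  have per_p: "partial i u (x + vector [2 * pi * of_int k, 2 * pi * of_int l]) = partial i u x" for i x k l
    by (rule partial_periodic) (rule per_u)
  have shift: "vec (x + 2 * pi * of_int k, y + 2 * pi * of_int l)
      = vec (x, y) + vector [2 * pi * of_int k, 2 * pi * of_int l]" for x y k l
    by (simp add: vec_def vec_eq_iff forall_2)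
  have s1: "vec (2 * pi, y) = vec (0, y) + vector [2 * pi * of_int 1, 2 * pi * of_int 0]"
    and s2: "vec (x, 2 * pi) = vec (x, 0) + vector [2 * pi * of_int 0, 2 * pi * of_int 1]" for x y
    by (simp_all add: vec_def vec_eq_iff forall_2)
  have lap: "partial 1 (partial 1 u) x + partial 2 (partial 2 u) x = - lam\<^sup>2 * u x" for x
    using spec[OF eigen, of "torus_proj x"]
    by (simp add: torus_laplacian_proj laplacian_def sum_2 u_def[symmetric]) (simp add: u_def)
  let ?c = "\<lambda>k l (x, y). complex_of_real (U (x, y)) * cis (of_int k * x + of_int l * y)"
  have coeff: "integral square (?c k l) = 0" if "real_of_int (k\<^sup>2 + l\<^sup>2) \<noteq> lam\<^sup>2" for k l :: int
  proof (rule fourier_coefficient_eq_0[OF _ _ _ _ _ _ _ _ _ _ _ _ that])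
    show "((\<lambda>x. U (x, y)) has_real_derivative partial 1 u (vec (x, y))) (at x)"
      "((\<lambda>x. partial 1 u (vec (x, y))) has_real_derivative partial 1 (partial 1 u) (vec (x, y))) (at x)"
      "((\<lambda>y. U (x, y)) has_real_derivative partial 2 u (vec (x, y))) (at y)"
      "((\<lambda>y. partial 2 u (vec (x, y))) has_real_derivative partial 2 (partial 2 u) (vec (x, y))) (at y)" for x y
      using partial_has_real_derivative C2 by (simp_all add: U_def vec_def)
    show "continuous_on UNIV U" by (rule contU)
    show "continuous_on UNIV (\<lambda>z. partial 1 (partial 1 u) (vec z))"
      "continuous_on UNIV (\<lambda>z. partial 2 (partial 2 u) (vec z))"
      by (rule continuous_on_compose2[OF C2(3) contvec]; simp)+
    show "U (2 * pi, y) = U (0, y)" "U (x, 2 * pi) = U (x, 0)"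
      "partial 1 u (vec (2 * pi, y)) = partial 1 u (vec (0, y))"
      "partial 2 u (vec (x, 2 * pi)) = partial 2 u (vec (x, 0))" for x y
      unfolding U_def s1 s2 by (rule per_u per_p)+
    show "partial 1 (partial 1 u) (vec z) + partial 2 (partial 2 u) (vec z) = - lam\<^sup>2 * U z" for z
      unfolding U_def by (rule lap)
  qed
  define X where "X = (\<lambda>\<xi>::real^2. \<lfloor>\<xi> $ 1\<rfloor>)"
  define Y where "Y = (\<lambda>\<xi>::real^2. \<lfloor>\<xi> $ 2\<rfloor>)"
  have XY: "\<xi> $ 1 = of_int (X \<xi>)" "\<xi> $ 2 = of_int (Y \<xi>)" if "\<xi> \<in> E" for \<xi>
    using that by (auto simp: E_def lattice_circle_def X_def Y_def elim: Ints_cases)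
  \<comment> \<open>The signs are reversed because \<open>?c k l\<close> carries the character of
    \<open>(k, l)\<close> itself, not its conjugate.\<close>
  define a where "a = (\<lambda>\<xi>. integral square (?c (- X \<xi>) (- Y \<xi>)) / (2 * pi)\<^sup>2)"
  define e where "e = (\<lambda>\<xi>::real^2. \<lambda>(x, y). cis (of_int (X \<xi>) * x + of_int (Y \<xi>) * y))"
  define w where "w = (\<lambda>z. complex_of_real (U z) - (\<Sum>\<xi>\<in>E. a \<xi> * e \<xi> z))"
  have conte: "continuous_on S (e \<xi>)" for \<xi> S
    unfolding e_def case_prod_unfold by (intro continuous_intros)
  have per_w: "w (x + 2 * pi * of_int k, y + 2 * pi * of_int l) = w (x, y)" for x y k l
  proof -
    have "e \<xi> (x + 2 * pi * of_int k, y + 2 * pi * of_int l) = e \<xi> (x, y)" for \<xi>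
    proof -
      have "of_int (X \<xi>) * (x + 2 * pi * of_int k) + of_int (Y \<xi>) * (y + 2 * pi * of_int l)
        = (of_int (X \<xi>) * x + of_int (Y \<xi>) * y) + of_int (X \<xi> * k + Y \<xi> * l) * (2 * pi)"
        by (simp add: algebra_simps)
      then show ?thesis unfolding e_def prod.case by (simp only: cis_mult[symmetric] cis_2pi_int) simp
    qed
    then show ?thesis unfolding w_def U_def shift per_u by simp
  qed
  have null: "w \<in> fourier_null"
    unfolding fourier_null_def
  proof (intro CollectI conjI allI)
    show "continuous_on square w" unfolding w_def by (intro continuous_intros contU conte)
    fix k l :: int
    define \<eta> where "\<eta> = (vector [- of_int k, - of_int l] :: real^2)"
    have in_E: "\<eta> \<in> E \<longleftrightarrow> real_of_int (k\<^sup>2 + l\<^sup>2) = lam\<^sup>2"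
    proof -
      have "norm \<eta> = lam \<longleftrightarrow> (norm \<eta>)\<^sup>2 = lam\<^sup>2" using lam by (auto simp: power2_eq_iff_nonneg)
      then show ?thesis unfolding norm_sq_2 by (simp add: E_def lattice_circle_def \<eta>_def forall_2)
    qed
    have prod: "(\<lambda>(x, y). e \<xi> (x, y) * cis (of_int k * x + of_int l * y))
        = (\<lambda>(x, y). cis (of_int (X \<xi> + k) * x + of_int (Y \<xi> + l) * y))" for \<xi>
      by (auto simp: fun_eq_iff e_def cis_mult algebra_simps)
    have orth: "integral square (\<lambda>(x, y). e \<xi> (x, y) * cis (of_int k * x + of_int l * y))
        = (if \<xi> = \<eta> then (2 * pi)\<^sup>2 else 0)" if "\<xi> \<in> E" for \<xi>
    proof -
      have "X \<xi> + k = 0 \<and> Y \<xi> + l = 0 \<longleftrightarrow> \<xi> = \<eta>"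
        using XY[OF that] by (auto simp: \<eta>_def vec_eq_iff forall_2 add_eq_0_iff2 simp flip: of_int_minus)
      then show ?thesis unfolding prod integral_square_cis by simp
    qed
    have int_e: "(\<lambda>(x, y). a \<xi> * (e \<xi> (x, y) * cis (of_int k * x + of_int l * y))) integrable_on square" for \<xi>
      using conte by (auto simp: case_prod_unfold intro!: integrable_square continuous_intros)
    have int_e': "(\<lambda>z. a \<xi> * (e \<xi> z * cis (of_int k * fst z + of_int l * snd z))) integrable_on square" for \<xi>
      using int_e[of \<xi>] by (simp add: case_prod_unfold)
    have "integral square (\<lambda>(x, y). w (x, y) * cis (of_int k * x + of_int l * y))
      = integral square (\<lambda>z. ?c k l z - (\<Sum>\<xi>\<in>E. (\<lambda>(x, y). a \<xi> * (e \<xi> (x, y) * cis (of_int k * x + of_int l * y))) z))"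
      by (rule integral_cong) (auto simp: w_def algebra_simps sum_distrib_left sum_distrib_right)
    also have "\<dots> = integral square (?c k l) - (\<Sum>\<xi>\<in>E. integral square (\<lambda>(x, y). a \<xi> * (e \<xi> (x, y) * cis (of_int k * x + of_int l * y))))"
      by (subst integral_diff, rule integrable_square)
        (auto simp: case_prod_unfold integral_sum[OF fin int_e'] simp del: integral_mult_right
          intro!: continuous_intros contU integrable_sum int_e' fin)
    also have "(\<Sum>\<xi>\<in>E. integral square (\<lambda>(x, y). a \<xi> * (e \<xi> (x, y) * cis (of_int k * x + of_int l * y))))
        = (\<Sum>\<xi>\<in>E. if \<xi> = \<eta> then a \<xi> * (2 * pi)\<^sup>2 else 0)"
    proof (rule sum.cong[OF refl])
      fix \<xi> assume "\<xi> \<in> E"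
      have "integral square (\<lambda>(x, y). a \<xi> * (e \<xi> (x, y) * cis (of_int k * x + of_int l * y)))
        = a \<xi> * integral square (\<lambda>(x, y). e \<xi> (x, y) * cis (of_int k * x + of_int l * y))"
        unfolding case_prod_unfold by simp
      then show "integral square (\<lambda>(x, y). a \<xi> * (e \<xi> (x, y) * cis (of_int k * x + of_int l * y)))
        = (if \<xi> = \<eta> then a \<xi> * (2 * pi)\<^sup>2 else 0)" unfolding orth[OF \<open>\<xi> \<in> E\<close>] by simp
    qed
    also have "\<dots> = (if \<eta> \<in> E then a \<eta> * (2 * pi)\<^sup>2 else 0)" using fin by simp
    also have "integral square (?c k l) - (if \<eta> \<in> E then a \<eta> * (2 * pi)\<^sup>2 else 0) = 0"
    proof (cases "\<eta> \<in> E")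
      case True
      have "X \<eta> = - k" "Y \<eta> = - l" by (simp_all add: X_def Y_def \<eta>_def flip: of_int_minus)
      then show ?thesis using True by (simp add: a_def)
    next
      case False
      then show ?thesis using coeff in_E by simp
    qed
    finally show "integral square (\<lambda>(x, y). w (x, y) * cis (of_int k * x + of_int l * y)) = 0" .
  qed
  have expand: "u (vec z) = Re (\<Sum>\<xi>\<in>E. a \<xi> * cis (\<xi> \<bullet> vec z))" if "z \<in> square" for z
  proof -
    have "(\<Sum>\<xi>\<in>E. a \<xi> * e \<xi> z) = (\<Sum>\<xi>\<in>E. a \<xi> * cis (\<xi> \<bullet> vec z))"
      by (intro sum.cong) (auto simp: e_def vec_def inner_2 XY case_prod_unfold)
    then show ?thesis using fourier_null_Re_eq_0[OF per_w null that] by (simp add: w_def U_def)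
  qed
  have expand': "u x = Re (\<Sum>\<xi>\<in>E. a \<xi> * cis (\<xi> \<bullet> x))" for x
  proof -
    obtain z where z: "z \<in> square" "torus_proj x = torus_proj (vec z)"
      using torus_proj_square unfolding vec_def by blast
    then have "torus_rel x (vec z)" by (simp only: torus_proj_eq_iff)
    then obtain k l :: int where kl: "x $ 1 - vec z $ 1 = 2 * pi * k" "x $ 2 - vec z $ 2 = 2 * pi * l"
      unfolding torus_rel_def by meson
    have "cis (\<xi> \<bullet> x) = cis (\<xi> \<bullet> vec z)" if "\<xi> \<in> E" for \<xi>
    proof -
      have "x $ 1 = vec z $ 1 + 2 * pi * k" "x $ 2 = vec z $ 2 + 2 * pi * l" using kl by simp_all
      then have "\<xi> \<bullet> x = \<xi> \<bullet> vec z + of_int (X \<xi> * k + Y \<xi> * l) * (2 * pi)"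
        by (simp add: inner_2 XY[OF that] algebra_simps)
      then show ?thesis by (simp only: cis_mult[symmetric] cis_2pi_int) simp
    qed
    then have "(\<Sum>\<xi>\<in>E. a \<xi> * cis (\<xi> \<bullet> x)) = (\<Sum>\<xi>\<in>E. a \<xi> * cis (\<xi> \<bullet> vec z))" by simp
    moreover have "u x = u (vec z)" using z(2) by (simp add: u_def)
    ultimately show ?thesis using expand[OF z(1)] by simp
  qed
  \<comment> \<open>So far only the real part of the sum is known to be \<open>u\<close>. Averaging
    \<open>a \<xi>\<close> with the conjugate of \<open>a (- \<xi>)\<close> replaces the sum by its
    real part.\<close>
  have neg: "bij_betw uminus E E"
    by (rule bij_betwI[of _ _ _ uminus]) (auto simp: E_def lattice_circle_def)
  show ?thesis
  proof
    fix x
    let ?S = "\<Sum>\<xi>\<in>E. a \<xi> * cis (\<xi> \<bullet> x)"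
    have "cnj ?S = (\<Sum>\<xi>\<in>E. cnj (a (- \<xi>)) * cis (\<xi> \<bullet> x))"
      using sum.reindex_bij_betw[OF neg, of "\<lambda>\<xi>. cnj (a (- \<xi>)) * cis (\<xi> \<bullet> x)"]
      by (simp add: cis_cnj)
    then have "of_real (u x) = (\<Sum>\<xi>\<in>E. a \<xi> * cis (\<xi> \<bullet> x) + cnj (a (- \<xi>)) * cis (\<xi> \<bullet> x)) / 2"
      using complex_add_cnj[of ?S] expand'[of x] by (simp add: sum.distrib)
    also have "\<dots> = (\<Sum>\<xi>\<in>E. ((a \<xi> + cnj (a (- \<xi>))) / 2) * cis (\<xi> \<bullet> x))"
      by (simp add: sum_divide_distrib distrib_right add_divide_distrib)
    finally show "of_real (F (torus_proj x)) = (\<Sum>\<xi>\<in>lattice_circle lam. ((a \<xi> + cnj (a (- \<xi>))) / 2) * cis (\<xi> \<bullet> x))"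
      by (simp add: u_def E_def)
  qed
qed

section \<open>Oscillatory integrals along curved arcs\<close>

text \<open>Reduces phases with negative derivatives to those with positive ones.\<close>

lemma norm_integral_cis_uminus:
  "norm (integral S (\<lambda>t. cis (- \<psi> t))) = norm (integral S (\<lambda>t. cis (\<psi> t)))"
proof -
  have "integral S (\<lambda>t. cis (- \<psi> t)) = cnj (integral S (\<lambda>t. cis (\<psi> t)))"
    by (simp add: integral_cnj cis_cnj)
  then show ?thesis by simp
qed

lemma norm_integral_cis_le:
  assumes "p \<le> q" "continuous_on {p..q} \<psi>"
  shows "norm (integral {p..q} (\<lambda>t. cis (\<psi> t))) \<le> q - p"
proof -
  have "norm (integral {p..q} (\<lambda>t. cis (\<psi> t))) \<le> integral {p..q} (\<lambda>_. 1)"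
    using assms by (intro integral_norm_bound_integral) (auto intro!: integrable_continuous_real continuous_intros)
  then show ?thesis using assms(1) by simp
qed

text \<open>Derivatives are taken within the interval, hence one-sided at its ends, so that a phase
  can be restricted to any closed subinterval.\<close>

locale phase =
  fixes \<psi> \<psi>1 \<psi>2 :: "real \<Rightarrow> real" and p q :: real
  assumes pq: "p \<le> q"
    and der1: "\<And>t. t \<in> {p..q} \<Longrightarrow> (\<psi> has_real_derivative \<psi>1 t) (at t within {p..q})"
    and der2: "\<And>t. t \<in> {p..q} \<Longrightarrow> (\<psi>1 has_real_derivative \<psi>2 t) (at t within {p..q})"
    and cont2: "continuous_on {p..q} \<psi>2"
begin

lemma cont0: "continuous_on {p..q} \<psi>" and cont1: "continuous_on {p..q} \<psi>1"
  by (rule DERIV_continuous_on[OF der1] DERIV_continuous_on[OF der2]; assumption)+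

lemma subphase:
  assumes "{r..s} \<subseteq> {p..q}" "r \<le> s"
  shows "phase \<psi> \<psi>1 \<psi>2 r s"
proof
  show "continuous_on {r..s} \<psi>2" using cont2 assms(1) by (rule continuous_on_subset)
  show "(\<psi> has_real_derivative \<psi>1 t) (at t within {r..s})"
    "(\<psi>1 has_real_derivative \<psi>2 t) (at t within {r..s})" if "t \<in> {r..s}" for t
    using der1[of t] der2[of t] that assms(1) by (auto intro: has_field_derivative_subset)
qed fact

lemma phase_uminus: "phase (\<lambda>t. - \<psi> t) (\<lambda>t. - \<psi>1 t) (\<lambda>t. - \<psi>2 t) p q"
  by standard (auto intro!: pq der1 der2 cont2 DERIV_minus continuous_intros)

text \<open>One integration by parts: the boundary values of \<open>cis \<psi> / (i \<psi>1)\<close>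
  give \<open>2 / \<mu>\<close>, and the derivative of \<open>1 / \<psi>1\<close> gives the
  remaining integral. The two bounds that follow differ only in how they treat that
  integral.\<close>

lemma van_der_Corput_1_aux:
  assumes mu: "\<mu> > 0" "\<And>t. t \<in> {p..q} \<Longrightarrow> \<mu> \<le> \<psi>1 t"
  shows "norm (integral {p..q} (\<lambda>t. cis (\<psi> t))) \<le> 2 / \<mu> + integral {p..q} (\<lambda>t. \<bar>\<psi>2 t\<bar> / (\<psi>1 t)\<^sup>2)"
proof -
  have pos: "\<psi>1 t > 0" if "t \<in> {p..q}" for t using mu that by force
  have nz: "\<psi>1 t \<noteq> 0" if "t \<in> {p..q}" for t using pos[OF that] by simp
  define h where "h = (\<lambda>t. - \<i> * of_real (inverse (\<psi>1 t)) * cis (\<psi> t))"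
  define e where "e = (\<lambda>t. \<i> * of_real (\<psi>2 t / (\<psi>1 t)\<^sup>2) * cis (\<psi> t))"
  have conte: "continuous_on {p..q} e" unfolding e_def
    by (intro continuous_intros cont0 cont1 cont2) (simp add: nz)
  have "((\<lambda>t. cis (\<psi> t) + e t) has_integral (h q - h p)) {p..q}"
  proof (rule fundamental_theorem_of_calculus[OF pq])
    fix t assume t: "t \<in> {p..q}"
    have inv: "((\<lambda>t. inverse (\<psi>1 t)) has_real_derivative - (\<psi>2 t / (\<psi>1 t)\<^sup>2)) (at t within {p..q})"
      using DERIV_inverse_fun[OF der2[OF t]] pos[OF t] by (simp add: power2_eq_square divide_inverse mult_ac)
    note d = has_vector_derivative_mult[OF has_vector_derivative_mult_right[OF has_vector_derivative_of_real[OF inv], of "- \<i>"]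
        cis_compose_has_vector_derivative[OF der1[OF t]]]
    show "(h has_vector_derivative cis (\<psi> t) + e t) (at t within {p..q})"
      unfolding h_def e_def
      by (rule has_vector_derivative_eq_rhs[OF d]) (use pos[OF t] in \<open>simp add: field_simps\<close>)
  qed
  then have "integral {p..q} (\<lambda>t. cis (\<psi> t) + e t) = h q - h p" by (rule integral_unique)
  moreover have "integral {p..q} (\<lambda>t. cis (\<psi> t) + e t) = integral {p..q} (\<lambda>t. cis (\<psi> t)) + integral {p..q} e"
    by (intro integral_add integrable_continuous_real conte continuous_intros cont0)
  ultimately have "integral {p..q} (\<lambda>t. cis (\<psi> t)) = h q - h p - integral {p..q} e" by (simp add: algebra_simps)
  then have "norm (integral {p..q} (\<lambda>t. cis (\<psi> t))) \<le> norm (h q) + norm (h p) + norm (integral {p..q} e)"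
    using norm_triangle_ineq4[of "h q - h p" "integral {p..q} e"] norm_triangle_ineq4[of "h q" "h p"] by simp
  moreover have "norm (h t) \<le> 1 / \<mu>" if "t \<in> {p..q}" for t
  proof -
    have "norm (h t) = 1 / \<psi>1 t"
      using pos[OF that] by (simp add: h_def norm_mult norm_inverse norm_divide divide_inverse)
    then show ?thesis using mu(1) mu(2)[OF that] by (simp add: frac_le)
  qed
  then have "norm (h q) \<le> 1 / \<mu>" "norm (h p) \<le> 1 / \<mu>" using pq by auto
  moreover have "norm (integral {p..q} e) \<le> integral {p..q} (\<lambda>t. \<bar>\<psi>2 t\<bar> / (\<psi>1 t)\<^sup>2)"
  proof (rule integral_norm_bound_integral)
    show "(\<lambda>t. \<bar>\<psi>2 t\<bar> / (\<psi>1 t)\<^sup>2) integrable_on {p..q}"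
      by (intro integrable_continuous_real continuous_intros cont1 cont2) (simp add: nz)
    show "e integrable_on {p..q}" by (rule integrable_continuous_real[OF conte])
    show "norm (e t) \<le> \<bar>\<psi>2 t\<bar> / (\<psi>1 t)\<^sup>2" if "t \<in> {p..q}" for t
      by (simp add: e_def norm_mult norm_divide norm_power)
  qed
  ultimately show ?thesis by simp
qed

text \<open>For a phase \<open>v \<bullet> g\<close> along the arc, \<mu> and \<open>D\<close> are
  both of order \<open>norm v\<close>, so the bound is of order \<open>1 / norm v\<close> without
  any monotonicity.\<close>

lemma van_der_Corput_1:
  assumes mu: "\<mu> > 0" "(\<forall>t\<in>{p..q}. \<mu> \<le> \<psi>1 t) \<or> (\<forall>t\<in>{p..q}. \<psi>1 t \<le> - \<mu>)"
    and D: "\<And>t. t \<in> {p..q} \<Longrightarrow> \<bar>\<psi>2 t\<bar> \<le> D"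
  shows "norm (integral {p..q} (\<lambda>t. cis (\<psi> t))) \<le> 2 / \<mu> + D * (q - p) / \<mu>\<^sup>2"
  using mu(2)
proof
  have *: "norm (integral {p..q} (\<lambda>t. cis (\<phi> t))) \<le> 2 / \<mu> + D * (q - p) / \<mu>\<^sup>2"
    if "phase \<phi> \<phi>1 \<phi>2 p q" "\<And>t. t \<in> {p..q} \<Longrightarrow> \<mu> \<le> \<phi>1 t" "\<And>t. t \<in> {p..q} \<Longrightarrow> \<bar>\<phi>2 t\<bar> \<le> D" for \<phi> \<phi>1 \<phi>2
  proof -
    interpret P: phase \<phi> \<phi>1 \<phi>2 p q by fact
    have pos: "\<phi>1 t > 0" if "t \<in> {p..q}" for t using mu(1) \<open>\<And>t. t \<in> {p..q} \<Longrightarrow> \<mu> \<le> \<phi>1 t\<close>[OF that] by linarith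
    have D0: "D \<ge> 0" using that(3)[of p] pq by auto
    have "integral {p..q} (\<lambda>t. \<bar>\<phi>2 t\<bar> / (\<phi>1 t)\<^sup>2) \<le> integral {p..q} (\<lambda>t. D / \<mu>\<^sup>2)"
    proof (rule integral_le)
      show "(\<lambda>t. \<bar>\<phi>2 t\<bar> / (\<phi>1 t)\<^sup>2) integrable_on {p..q}"
        by (intro integrable_continuous_real continuous_intros P.cont1 P.cont2) (use pos in force)
      show "\<bar>\<phi>2 t\<bar> / (\<phi>1 t)\<^sup>2 \<le> D / \<mu>\<^sup>2" if "t \<in> {p..q}" for t
        using \<open>\<And>t. t \<in> {p..q} \<Longrightarrow> \<bar>\<phi>2 t\<bar> \<le> D\<close>[OF that] \<open>\<And>t. t \<in> {p..q} \<Longrightarrow> \<mu> \<le> \<phi>1 t\<close>[OF that] mu(1) D0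
        by (intro frac_le power_mono) auto
    qed (rule integrable_const_ivl)
    also have "\<dots> = D * (q - p) / \<mu>\<^sup>2" using pq by simp
    finally show ?thesis using P.van_der_Corput_1_aux[OF mu(1) that(2)] by simp
  qed
  show ?thesis if "\<forall>t\<in>{p..q}. \<mu> \<le> \<psi>1 t"
    using *[OF phase_axioms] that D by blast
  show ?thesis if "\<forall>t\<in>{p..q}. \<psi>1 t \<le> - \<mu>"
    using *[OF phase_uminus] that D by (force simp: norm_integral_cis_uminus)
qed

text \<open>With \<open>\<psi>2\<close> of constant sign the remaining integral is a difference of
  values of \<open>1 / \<psi>1\<close>; it costs one more \<open>1 / \<mu>\<close> whatever the
  length of the interval.\<close>

lemma van_der_Corput_1_mono:
  assumes mu: "\<mu> > 0" "(\<forall>t\<in>{p..q}. \<mu> \<le> \<psi>1 t) \<or> (\<forall>t\<in>{p..q}. \<psi>1 t \<le> - \<mu>)"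
    and mono: "(\<forall>t\<in>{p..q}. 0 \<le> \<psi>2 t) \<or> (\<forall>t\<in>{p..q}. \<psi>2 t \<le> 0)"
  shows "norm (integral {p..q} (\<lambda>t. cis (\<psi> t))) \<le> 3 / \<mu>"
  using mu(2)
proof
  have *: "norm (integral {p..q} (\<lambda>t. cis (\<phi> t))) \<le> 3 / \<mu>"
    if "phase \<phi> \<phi>1 \<phi>2 p q" and lower: "\<And>t. t \<in> {p..q} \<Longrightarrow> \<mu> \<le> \<phi>1 t"
      and sign: "(\<forall>t\<in>{p..q}. 0 \<le> \<phi>2 t) \<or> (\<forall>t\<in>{p..q}. \<phi>2 t \<le> 0)" for \<phi> \<phi>1 \<phi>2
  proof -
    interpret P: phase \<phi> \<phi>1 \<phi>2 p q by fact
    have pos: "\<phi>1 t > 0" if "t \<in> {p..q}" for t using mu(1) lower[OF that] by linarith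
    have "((\<lambda>t. \<phi>2 t / (\<phi>1 t)\<^sup>2) has_integral (- inverse (\<phi>1 q) - (- inverse (\<phi>1 p)))) {p..q}"
    proof (rule fundamental_theorem_of_calculus[OF pq])
      fix t assume t: "t \<in> {p..q}"
      have "((\<lambda>t. - inverse (\<phi>1 t)) has_real_derivative (\<phi>2 t / (\<phi>1 t)\<^sup>2)) (at t within {p..q})"
        using DERIV_minus[OF DERIV_inverse_fun[OF P.der2[OF t]]] pos[OF t]
        by (simp add: power2_eq_square divide_inverse mult_ac)
      then show "((\<lambda>t. - inverse (\<phi>1 t)) has_vector_derivative (\<phi>2 t / (\<phi>1 t)\<^sup>2)) (at t within {p..q})"
        by (simp add: has_real_derivative_iff_has_vector_derivative)
    qed
    then have I: "integral {p..q} (\<lambda>t. \<phi>2 t / (\<phi>1 t)\<^sup>2) = inverse (\<phi>1 p) - inverse (\<phi>1 q)"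
      by (simp add: integral_unique)
    have inv: "0 \<le> inverse (\<phi>1 t) \<and> inverse (\<phi>1 t) \<le> 1 / \<mu>" if "t \<in> {p..q}" for t
      using pos[OF that] lower[OF that] mu(1) by (simp add: field_simps)
    have ends: "0 \<le> inverse (\<phi>1 p)" "inverse (\<phi>1 p) \<le> 1 / \<mu>" "0 \<le> inverse (\<phi>1 q)" "inverse (\<phi>1 q) \<le> 1 / \<mu>"
      using inv[of p] inv[of q] pq by auto
    from sign have "integral {p..q} (\<lambda>t. \<bar>\<phi>2 t\<bar> / (\<phi>1 t)\<^sup>2) \<le> 1 / \<mu>"
    proof
      assume "\<forall>t\<in>{p..q}. 0 \<le> \<phi>2 t"
      then have "integral {p..q} (\<lambda>t. \<bar>\<phi>2 t\<bar> / (\<phi>1 t)\<^sup>2) = integral {p..q} (\<lambda>t. \<phi>2 t / (\<phi>1 t)\<^sup>2)"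
        by (intro integral_cong) auto
      then show ?thesis using I ends by linarith
    next
      assume "\<forall>t\<in>{p..q}. \<phi>2 t \<le> 0"
      then have "integral {p..q} (\<lambda>t. \<bar>\<phi>2 t\<bar> / (\<phi>1 t)\<^sup>2) = integral {p..q} (\<lambda>t. - (\<phi>2 t / (\<phi>1 t)\<^sup>2))"
        by (intro integral_cong) auto
      also have "\<dots> = - integral {p..q} (\<lambda>t. \<phi>2 t / (\<phi>1 t)\<^sup>2)" by (rule integral_neg)
      finally show ?thesis using I ends by linarith
    qed
    then show ?thesis using P.van_der_Corput_1_aux[OF mu(1) lower] by simp
  qed
  show ?thesis if "\<forall>t\<in>{p..q}. \<mu> \<le> \<psi>1 t"
    using *[OF phase_axioms] that mono by blast
  show ?thesis if "\<forall>t\<in>{p..q}. \<psi>1 t \<le> - \<mu>"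
  proof -
    have "norm (integral {p..q} (\<lambda>t. cis (- \<psi> t))) \<le> 3 / \<mu>"
    proof (rule *[OF phase_uminus])
      show "\<mu> \<le> - \<psi>1 t" if "t \<in> {p..q}" for t using \<open>\<forall>t\<in>{p..q}. \<psi>1 t \<le> - \<mu>\<close> that by force
    qed (use mono in auto)
    then show ?thesis by (simp add: norm_integral_cis_uminus)
  qed
qed

text \<open>\<open>\<psi>1\<close> grows at rate at least \<mu>. The point \<open>c\<close> is its
  zero if there is one, otherwise the endpoint at which it comes closest to zero.\<close>

lemma stationary_point:
  assumes mu: "\<mu> > 0" and conv: "\<And>t. t \<in> {p..q} \<Longrightarrow> \<mu> \<le> \<psi>2 t"
  obtains c where "c \<in> {p..q}" "\<And>t. t \<in> {p..q} \<Longrightarrow> c < t \<Longrightarrow> \<mu> * (t - c) \<le> \<psi>1 t"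
    "\<And>t. t \<in> {p..q} \<Longrightarrow> t < c \<Longrightarrow> \<psi>1 t \<le> - (\<mu> * (c - t))"
proof -
  have inc: "\<mu> * (t - s) \<le> \<psi>1 t - \<psi>1 s" if st: "s \<in> {p..q}" "t \<in> {p..q}" "s \<le> t" for s t
  proof -
    have sub: "{s..t} \<subseteq> {p..q}" using st by auto
    have I2: "(\<psi>2 has_integral (\<psi>1 t - \<psi>1 s)) {s..t}"
      using sub der2 st(3) has_field_derivative_subset
      by (intro fundamental_theorem_of_calculus)
        (auto simp flip: has_real_derivative_iff_has_vector_derivative intro: has_field_derivative_subset[OF _ sub])
    have const: "((\<lambda>_. \<mu>) has_integral \<mu> * (t - s)) {s..t}"
      using has_integral_const_real[of \<mu> s t] st(3) by (simp add: mult.commute)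
    show ?thesis
      by (rule has_integral_le[OF const I2]) (use conv sub in auto)
  qed
  consider "\<psi>1 p \<ge> 0" | "\<psi>1 q \<le> 0" | "\<psi>1 p \<le> 0" "0 \<le> \<psi>1 q" by linarith
  then show ?thesis
  proof cases
    case 1
    show ?thesis
    proof (rule that[of p])
      show "\<mu> * (t - p) \<le> \<psi>1 t" if "t \<in> {p..q}" "p < t" for t
        using inc[of p t] 1 that by simp
    qed (use pq in auto)
  next
    case 2
    show ?thesis
    proof (rule that[of q])
      show "\<psi>1 t \<le> - (\<mu> * (q - t))" if "t \<in> {p..q}" "t < q" for t
        using inc[of t q] 2 that by simp
    qed (use pq in auto)
  next
    case 3
    then obtain c where c: "p \<le> c" "c \<le> q" "\<psi>1 c = 0" using IVT'[of \<psi>1 p 0 q] cont1 pq by blast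
    show ?thesis
    proof (rule that[of c])
      show "\<mu> * (t - c) \<le> \<psi>1 t" if "t \<in> {p..q}" "c < t" for t
        using inc[of c t] c that by simp
      show "\<psi>1 t \<le> - (\<mu> * (c - t))" if "t \<in> {p..q}" "t < c" for t
        using inc[of t c] c that by simp
    qed (use c in simp)
  qed
qed

text \<open>At distance \<delta> from the stationary point the derivative is monotone and at least
  \<open>\<mu> * \<delta>\<close> in absolute value. The quantifiers over \<open>r\<close>,
  \<open>s\<close> and \<delta> stand inside, so that a single \<open>c\<close> serves both the
  bound on the whole interval and all moving windows.\<close>

lemma van_der_Corput_away:
  assumes mu: "\<mu> > 0" and "\<forall>t\<in>{p..q}. \<mu> \<le> \<psi>2 t"
  shows "\<exists>c\<in>{p..q}. \<forall>r s \<delta>. {r..s} \<subseteq> {p..q} \<longrightarrow> r \<le> s \<longrightarrow> \<delta> > 0 \<longrightarrow> c + \<delta> \<le> r \<or> s \<le> c - \<delta> \<longrightarrow>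
      norm (integral {r..s} (\<lambda>t. cis (\<psi> t))) \<le> 3 / (\<mu> * \<delta>)"
proof -
  have conv: "\<mu> \<le> \<psi>2 t" if "t \<in> {p..q}" for t using assms(2) that by blast
  obtain c where c: "c \<in> {p..q}" "\<And>t. t \<in> {p..q} \<Longrightarrow> c < t \<Longrightarrow> \<mu> * (t - c) \<le> \<psi>1 t"
    "\<And>t. t \<in> {p..q} \<Longrightarrow> t < c \<Longrightarrow> \<psi>1 t \<le> - (\<mu> * (c - t))"
    using stationary_point[OF mu conv] by metis
  show ?thesis
  proof (intro bexI[OF _ c(1)] allI impI)
    fix r s \<delta> :: real
    assume rs: "{r..s} \<subseteq> {p..q}" "r \<le> s" "\<delta> > 0" and away: "c + \<delta> \<le> r \<or> s \<le> c - \<delta>"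
    interpret S: phase \<psi> \<psi>1 \<psi>2 r s by (rule subphase[OF rs(1,2)])
    show "norm (integral {r..s} (\<lambda>t. cis (\<psi> t))) \<le> 3 / (\<mu> * \<delta>)"
    proof (rule S.van_der_Corput_1_mono)
      show "0 < \<mu> * \<delta>" using mu rs by simp
      show "(\<forall>t\<in>{r..s}. 0 \<le> \<psi>2 t) \<or> (\<forall>t\<in>{r..s}. \<psi>2 t \<le> 0)"
        using conv rs(1) mu by (meson less_imp_le order_trans subsetD)
      from away show "(\<forall>t\<in>{r..s}. \<mu> * \<delta> \<le> \<psi>1 t) \<or> (\<forall>t\<in>{r..s}. \<psi>1 t \<le> - (\<mu> * \<delta>))"
      proof
        assume a: "c + \<delta> \<le> r"
        have "\<mu> * \<delta> \<le> \<psi>1 t" if "t \<in> {r..s}" for t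
        proof -
          have "\<mu> * \<delta> \<le> \<mu> * (t - c)" using a that mu by (intro mult_left_mono) auto
          also have "\<dots> \<le> \<psi>1 t" using a that rs by (intro c(2)) auto
          finally show ?thesis .
        qed
        then show ?thesis by blast
      next
        assume a: "s \<le> c - \<delta>"
        have "\<psi>1 t \<le> - (\<mu> * \<delta>)" if "t \<in> {r..s}" for t
        proof -
          have "\<psi>1 t \<le> - (\<mu> * (c - t))" using a that rs by (intro c(3)) auto
          also have "\<dots> \<le> - (\<mu> * \<delta>)" using a that mu by (simp add: mult_left_mono)
          finally show ?thesis .
        qed
        then show ?thesis by blast
      qed
    qed
  qed
qed

lemma van_der_Corput_2_aux:
  assumes mu: "\<mu> > 0" and conv: "\<And>t. t \<in> {p..q} \<Longrightarrow> \<mu> \<le> \<psi>2 t"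
  shows "norm (integral {p..q} (\<lambda>t. cis (\<psi> t))) \<le> 8 / sqrt \<mu>"
proof -
  have *: "\<forall>t\<in>{p..q}. \<mu> \<le> \<psi>2 t" by (intro ballI conv)
  from van_der_Corput_away[OF mu *, unfolded Bex_def]
  obtain c where c0: "c \<in> {p..q} \<and> (\<forall>r s \<delta>. {r..s} \<subseteq> {p..q} \<longrightarrow> r \<le> s \<longrightarrow> \<delta> > 0 \<longrightarrow> c + \<delta> \<le> r \<or> s \<le> c - \<delta> \<longrightarrow>
      norm (integral {r..s} (\<lambda>t. cis (\<psi> t))) \<le> 3 / (\<mu> * \<delta>))" ..
  note c = conjunct1[OF c0] conjunct2[OF c0, rule_format]
  \<comment> \<open>Balances the trivial bound \<open>2 * \<delta>\<close> around \<open>c\<close>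
    against \<open>3 / (\<mu> * \<delta>)\<close> on either side: 8 = 3 + 2 + 3.\<close>
  define \<delta> where "\<delta> = 1 / sqrt \<mu>"
  have \<delta>: "\<delta> > 0" "3 / (\<mu> * \<delta>) = 3 / sqrt \<mu>"
    using mu by (auto simp: \<delta>_def real_div_sqrt)
  define r where "r = max p (c - \<delta>)"
  define s where "s = min q (c + \<delta>)"
  have rs: "p \<le> r" "r \<le> s" "s \<le> q" "s - r \<le> 2 * \<delta>" using c(1) \<delta>(1) by (auto simp: r_def s_def)
  have int: "(\<lambda>t. cis (\<psi> t)) integrable_on {u..v}" if "{u..v} \<subseteq> {p..q}" for u v
    by (intro integrable_continuous_real continuous_intros continuous_on_subset[OF cont0 that])
  let ?I = "\<lambda>u v. integral {u..v} (\<lambda>t. cis (\<psi> t))"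
  have "?I p q = ?I p r + ?I r s + ?I s q"
    using rs Henstock_Kurzweil_Integration.integral_combine[of p r q "\<lambda>t. cis (\<psi> t)"]
      Henstock_Kurzweil_Integration.integral_combine[of r s q "\<lambda>t. cis (\<psi> t)"] int by (simp add: add.assoc)
  then have "norm (?I p q) \<le> norm (?I p r) + norm (?I r s) + norm (?I s q)"
    using norm_triangle_ineq[of "?I p r + ?I r s" "?I s q"] norm_triangle_ineq[of "?I p r" "?I r s"] by simp
  also have "norm (?I p r) \<le> 3 / sqrt \<mu>"
  proof (cases "r = p")
    case False
    then show ?thesis using c(2)[of p r \<delta>] rs \<delta> by (auto simp: r_def max_def split: if_splits)
  qed (use mu in simp)
  also have "norm (?I s q) \<le> 3 / sqrt \<mu>"
  proof (cases "s = q")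
    case False
    then show ?thesis using c(2)[of s q \<delta>] rs \<delta> by (auto simp: s_def min_def split: if_splits)
  qed (use mu in simp)
  also have "norm (?I r s) \<le> 2 / sqrt \<mu>"
  proof -
    have "norm (?I r s) \<le> s - r"
      using rs by (intro norm_integral_cis_le continuous_on_subset[OF cont0]) auto
    then show ?thesis using rs(4) by (simp add: \<delta>_def)
  qed
  finally show ?thesis by (simp add: add_divide_distrib[symmetric])
qed

lemma van_der_Corput_2:
  assumes mu: "\<mu> > 0" and conv: "(\<forall>t\<in>{p..q}. \<mu> \<le> \<psi>2 t) \<or> (\<forall>t\<in>{p..q}. \<psi>2 t \<le> - \<mu>)"
  shows "norm (integral {p..q} (\<lambda>t. cis (\<psi> t))) \<le> 8 / sqrt \<mu>"
  using conv
proof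
  show ?thesis if "\<forall>t\<in>{p..q}. \<mu> \<le> \<psi>2 t"
    using van_der_Corput_2_aux[OF mu] that by blast
  show ?thesis if *: "\<forall>t\<in>{p..q}. \<psi>2 t \<le> - \<mu>"
  proof -
    interpret U: phase "\<lambda>t. - \<psi> t" "\<lambda>t. - \<psi>1 t" "\<lambda>t. - \<psi>2 t" p q by (rule phase_uminus)
    have "\<mu> \<le> - \<psi>2 t" if "t \<in> {p..q}" for t using * that by force
    from U.van_der_Corput_2_aux[OF mu this] show ?thesis by (simp only: norm_integral_cis_uminus)
  qed
qed

text \<open>A window whose start is at least \<open>2 * h\<close> from \<open>c\<close> stays at
  least half of that distance away from it, on whichever side it lies; hence 6 = 3 * 2.\<close>

lemma van_der_Corput_window:
  assumes mu: "\<mu> > 0" and h: "h > 0"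
    and conv: "(\<forall>t\<in>{p..q}. \<mu> \<le> \<psi>2 t) \<or> (\<forall>t\<in>{p..q}. \<psi>2 t \<le> - \<mu>)"
  shows "\<exists>c. \<forall>r. p \<le> r \<longrightarrow> r + h \<le> q \<longrightarrow> 2 * h \<le> \<bar>r - c\<bar> \<longrightarrow>
      norm (integral {r..r + h} (\<lambda>t. cis (\<psi> t))) \<le> 6 / (\<mu> * \<bar>r - c\<bar>)"
proof -
  have *: "\<exists>c. \<forall>r s \<delta>. {r..s} \<subseteq> {p..q} \<longrightarrow> r \<le> s \<longrightarrow> \<delta> > 0 \<longrightarrow> c + \<delta> \<le> r \<or> s \<le> c - \<delta> \<longrightarrow>
      norm (integral {r..s} (\<lambda>t. cis (\<psi> t))) \<le> 3 / (\<mu> * \<delta>)"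
    using conv
  proof
    show ?thesis if "\<forall>t\<in>{p..q}. \<mu> \<le> \<psi>2 t"
      using van_der_Corput_away[OF mu that] by (elim bexE) (rule exI)
    show ?thesis if *: "\<forall>t\<in>{p..q}. \<psi>2 t \<le> - \<mu>"
    proof -
      interpret U: phase "\<lambda>t. - \<psi> t" "\<lambda>t. - \<psi>1 t" "\<lambda>t. - \<psi>2 t" p q by (rule phase_uminus)
      have "\<forall>t\<in>{p..q}. \<mu> \<le> - \<psi>2 t" using * by force
      from U.van_der_Corput_away[OF mu this] show ?thesis unfolding norm_integral_cis_uminus by (elim bexE) (rule exI)
    qed
  qed
  then obtain c where c: "\<And>r s \<delta>. {r..s} \<subseteq> {p..q} \<Longrightarrow> r \<le> s \<Longrightarrow> \<delta> > 0 \<Longrightarrow> c + \<delta> \<le> r \<or> s \<le> c - \<delta> \<Longrightarrow>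
      norm (integral {r..s} (\<lambda>t. cis (\<psi> t))) \<le> 3 / (\<mu> * \<delta>)" by blast
  show ?thesis
  proof (intro exI[of _ c] allI impI)
    fix r assume r: "p \<le> r" "r + h \<le> q" "2 * h \<le> \<bar>r - c\<bar>"
    have "c + \<bar>r - c\<bar> / 2 \<le> r \<or> r + h \<le> c - \<bar>r - c\<bar> / 2" 
    proof (cases "c \<le> r")
      case True
      then have "\<bar>r - c\<bar> = r - c" by simp
      then have "c + \<bar>r - c\<bar> / 2 \<le> r" using True by (simp add: field_simps)
      then show ?thesis ..
    next
      case False
      then have "\<bar>r - c\<bar> = c - r" by simp
      then have "r + h \<le> c - \<bar>r - c\<bar> / 2" using r(3) by (simp add: field_simps)
      then show ?thesis ..
    qed
    then have "norm (integral {r..r + h} (\<lambda>t. cis (\<psi> t))) \<le> 3 / (\<mu> * (\<bar>r - c\<bar> / 2))"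
      using r h by (intro c) auto
    then show "norm (integral {r..r + h} (\<lambda>t. cis (\<psi> t))) \<le> 6 / (\<mu> * \<bar>r - c\<bar>)"
      by (simp add: field_simps)
  qed
qed

end

section \<open>Phases along an arc with nonvanishing curvature\<close>

text \<open>Curvature enters through \<open>curved\<close>: for every \<open>v\<close>, the
  component along the tangent or the one along the curvature vector keeps its sign and has size at
  least \<open>c * norm v\<close> on the whole arc. \<open>K\<close> bounds the second derivative
  and is a Lipschitz constant for both derivatives.\<close>

locale curved_arc =
  fixes g g1 g2 :: "real \<Rightarrow> real^2" and a b c K :: real
  assumes ab: "a < b" and c: "c > 0" and K: "K \<ge> 1"
    and der1: "\<And>t. t \<in> {a..b} \<Longrightarrow> (g has_vector_derivative g1 t) (at t within {a..b})"
    and der2: "\<And>t. t \<in> {a..b} \<Longrightarrow> (g1 has_vector_derivative g2 t) (at t within {a..b})"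
    and bound2: "\<And>t. t \<in> {a..b} \<Longrightarrow> norm (g2 t) \<le> K"
    and lip1: "\<And>s t. s \<in> {a..b} \<Longrightarrow> t \<in> {a..b} \<Longrightarrow> norm (g1 s - g1 t) \<le> K * \<bar>s - t\<bar>"
    and lip2: "\<And>s t. s \<in> {a..b} \<Longrightarrow> t \<in> {a..b} \<Longrightarrow> norm (g2 s - g2 t) \<le> K * \<bar>s - t\<bar>"
    and curved: "\<And>v. (\<forall>t\<in>{a..b}. c * norm v \<le> v \<bullet> g1 t) \<or> (\<forall>t\<in>{a..b}. v \<bullet> g1 t \<le> - (c * norm v))
      \<or> (\<forall>t\<in>{a..b}. c * norm v \<le> v \<bullet> g2 t) \<or> (\<forall>t\<in>{a..b}. v \<bullet> g2 t \<le> - (c * norm v))"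
begin

lemma cont_g: "continuous_on {a..b} g"
  by (simp add: continuous_on_eq_continuous_within has_vector_derivative_continuous[OF der1])

lemma cont_g2: "continuous_on {a..b} g2"
proof (rule continuous_onI)
  fix x e :: real assume x: "x \<in> {a..b}" "e > 0"
  have "dist (g2 y) (g2 x) < e" if "y \<in> {a..b}" "dist y x < e / (2 * K)" for y
  proof -
    have "dist (g2 y) (g2 x) \<le> K * dist y x" using lip2[of y x] that x by (simp add: dist_norm)
    also have "\<dots> \<le> K * (e / (2 * K))" using that(2) K by (intro mult_left_mono) auto
    also have "\<dots> < e" using K x by simp
    finally show ?thesis .
  qed
  then show "\<exists>d>0. \<forall>y\<in>{a..b}. dist y x < d \<longrightarrow> dist (g2 y) (g2 x) \<le> e"
    using K x by (intro exI[of _ "e / (2 * K)"]) (auto intro: less_imp_le)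
qed

lemma inner_shift_derivative:
  assumes "(f has_vector_derivative f' (t + s)) (at (t + s) within {a..b})" "a \<le> p + s" "q + s \<le> b"
  shows "((\<lambda>t. \<xi> \<bullet> f (t + s)) has_real_derivative \<xi> \<bullet> f' (t + s)) (at t within {p..q})"
proof -
  have 1: "((\<lambda>t. t + s) has_vector_derivative 1) (at t within {p..q})"
    by (auto intro!: derivative_eq_intros)
  have "(f has_vector_derivative f' (t + s)) (at (t + s) within (\<lambda>t. t + s) ` {p..q})"
    by (rule has_vector_derivative_within_subset[OF assms(1)]) (use assms in auto)
  from vector_diff_chain_within[OF 1 this]
  have "((\<lambda>t. f (t + s)) has_vector_derivative f' (t + s)) (at t within {p..q})" by (simp add: o_def)
  from bounded_linear.has_vector_derivative[OF bounded_linear_inner_right this, of \<xi>]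
  show ?thesis by (simp add: has_real_derivative_iff_has_vector_derivative)
qed

lemma shift_phase:
  assumes "p \<le> q" "a \<le> p" "0 \<le> s" "0 \<le> s'" "q + s \<le> b" "q + s' \<le> b"
  shows "phase (\<lambda>t. \<xi> \<bullet> g (t + s) - \<eta> \<bullet> g (t + s')) (\<lambda>t. \<xi> \<bullet> g1 (t + s) - \<eta> \<bullet> g1 (t + s'))
    (\<lambda>t. \<xi> \<bullet> g2 (t + s) - \<eta> \<bullet> g2 (t + s')) p q"
proof
  show "continuous_on {p..q} (\<lambda>t. \<xi> \<bullet> g2 (t + s) - \<eta> \<bullet> g2 (t + s'))"
    by (intro continuous_intros continuous_on_compose2[OF cont_g2]) (use assms in auto)
  fix t assume t: "t \<in> {p..q}"
  show "((\<lambda>t. \<xi> \<bullet> g (t + s) - \<eta> \<bullet> g (t + s')) has_real_derivative \<xi> \<bullet> g1 (t + s) - \<eta> \<bullet> g1 (t + s')) (at t within {p..q})"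
    by (intro DERIV_diff inner_shift_derivative der1) (use assms t in auto)
  show "((\<lambda>t. \<xi> \<bullet> g1 (t + s) - \<eta> \<bullet> g1 (t + s')) has_real_derivative \<xi> \<bullet> g2 (t + s) - \<eta> \<bullet> g2 (t + s')) (at t within {p..q})"
    by (intro DERIV_diff inner_shift_derivative der2) (use assms t in auto)
qed fact

text \<open>The first two terms come from the first-derivative estimate, the last from the
  second-derivative estimate, both with \<mu> equal to half of \<open>c * norm v\<close>.\<close>

definition decay :: real where
  "decay = 4 / c + 4 * (K + c) * (b - a) / c\<^sup>2 + 8 / sqrt (c / 2)"

lemma decay_pos: "decay > 0"
  unfolding decay_def using c K ab by (intro add_pos_pos divide_pos_pos add_pos_nonneg) auto

text \<open>The perturbation by the shifts \<open>s\<close>, \<open>s'\<close> is dominated by the frequency \<open>\<xi> - \<eta>\<close>.\<close>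

lemma shifted_oscillation:
  assumes pq: "p \<le> q" "a \<le> p" "0 \<le> s" "0 \<le> s'" "q + s \<le> b" "q + s' \<le> b"
    and v: "norm (\<xi> - \<eta>) \<ge> 1" "K * norm \<eta> * \<bar>s - s'\<bar> \<le> c / 2 * norm (\<xi> - \<eta>)"
  shows "norm (integral {p..q} (\<lambda>t. cis (\<xi> \<bullet> g (t + s) - \<eta> \<bullet> g (t + s')))) \<le> decay / sqrt (norm (\<xi> - \<eta>))"
proof -
  interpret P: phase "\<lambda>t. \<xi> \<bullet> g (t + s) - \<eta> \<bullet> g (t + s')" "\<lambda>t. \<xi> \<bullet> g1 (t + s) - \<eta> \<bullet> g1 (t + s')"
    "\<lambda>t. \<xi> \<bullet> g2 (t + s) - \<eta> \<bullet> g2 (t + s')" p q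
    by (rule shift_phase[OF pq])
  define v where "v = \<xi> - \<eta>"
  \<comment> \<open>Half of the lower bound in \<open>curved\<close>; the other half absorbs the
    error caused by the shifts.\<close>
  define \<mu> where "\<mu> = c / 2 * norm v"
  have nv: "norm v \<ge> 1" using v by (simp add: v_def)
  have mu: "\<mu> > 0" unfolding \<mu>_def using c nv by (intro mult_pos_pos) auto
  have err: "\<bar>(\<xi> \<bullet> f (t + s) - \<eta> \<bullet> f (t + s')) - v \<bullet> f (t + s)\<bar> \<le> \<mu>"
    if "t \<in> {p..q}" "\<And>s t. s \<in> {a..b} \<Longrightarrow> t \<in> {a..b} \<Longrightarrow> norm (f s - f t) \<le> K * \<bar>s - t\<bar>" for f :: "real \<Rightarrow> real^2" and t
  proof -
    have "(\<xi> \<bullet> f (t + s) - \<eta> \<bullet> f (t + s')) - v \<bullet> f (t + s) = \<eta> \<bullet> (f (t + s) - f (t + s'))"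
      by (simp add: v_def inner_diff_left inner_diff_right)
    also have "\<bar>\<dots>\<bar> \<le> norm \<eta> * norm (f (t + s) - f (t + s'))" by (rule Cauchy_Schwarz_ineq2)
    also have "\<dots> \<le> norm \<eta> * (K * \<bar>(t + s) - (t + s')\<bar>)"
      using that(1) pq by (intro mult_left_mono that(2)) auto
    also have "\<dots> \<le> \<mu>" using v(2) by (simp add: \<mu>_def v_def mult_ac)
    finally show ?thesis .
  qed
  have in_ab: "t + s \<in> {a..b}" if "t \<in> {p..q}" for t using that pq by auto
  have two: "c * norm v = 2 * \<mu>" by (simp add: \<mu>_def)
  have "norm (integral {p..q} (\<lambda>t. cis (\<xi> \<bullet> g (t + s) - \<eta> \<bullet> g (t + s'))))
    \<le> max (2 / \<mu> + (K * norm v + \<mu>) * (q - p) / \<mu>\<^sup>2) (8 / sqrt \<mu>)"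
  proof (cases "(\<forall>t\<in>{a..b}. c * norm v \<le> v \<bullet> g1 t) \<or> (\<forall>t\<in>{a..b}. v \<bullet> g1 t \<le> - (c * norm v))")
    case True
    have "(\<forall>t\<in>{p..q}. \<mu> \<le> \<xi> \<bullet> g1 (t + s) - \<eta> \<bullet> g1 (t + s')) \<or> (\<forall>t\<in>{p..q}. \<xi> \<bullet> g1 (t + s) - \<eta> \<bullet> g1 (t + s') \<le> - \<mu>)"
      using True
    proof
      assume *: "\<forall>t\<in>{a..b}. c * norm v \<le> v \<bullet> g1 t"
      have "\<mu> \<le> \<xi> \<bullet> g1 (t + s) - \<eta> \<bullet> g1 (t + s')" if t: "t \<in> {p..q}" for t
        using err[of t g1, OF t lip1] bspec[OF * in_ab[OF t]] two unfolding abs_le_iff by linarith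
      then show ?thesis by blast
    next
      assume *: "\<forall>t\<in>{a..b}. v \<bullet> g1 t \<le> - (c * norm v)"
      have "\<xi> \<bullet> g1 (t + s) - \<eta> \<bullet> g1 (t + s') \<le> - \<mu>" if t: "t \<in> {p..q}" for t
        using err[of t g1, OF t lip1] bspec[OF * in_ab[OF t]] two unfolding abs_le_iff by linarith
      then show ?thesis by blast
    qed
    moreover have "\<bar>\<xi> \<bullet> g2 (t + s) - \<eta> \<bullet> g2 (t + s')\<bar> \<le> K * norm v + \<mu>" if t: "t \<in> {p..q}" for t
    proof -
      have "\<bar>v \<bullet> g2 (t + s)\<bar> \<le> norm v * norm (g2 (t + s))" by (rule Cauchy_Schwarz_ineq2)
      also have "\<dots> \<le> norm v * K" using bound2[OF in_ab[OF t]] by (rule mult_left_mono) simp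
      finally show ?thesis using err[of t g2, OF t lip2] by (simp add: mult.commute)
    qed
    ultimately show ?thesis using P.van_der_Corput_1[OF mu, of "K * norm v + \<mu>"] by (simp add: le_max_iff_disj)
  next
    case False
    then have "(\<forall>t\<in>{a..b}. c * norm v \<le> v \<bullet> g2 t) \<or> (\<forall>t\<in>{a..b}. v \<bullet> g2 t \<le> - (c * norm v))"
      using curved[of v] by blast
    then have "(\<forall>t\<in>{p..q}. \<mu> \<le> \<xi> \<bullet> g2 (t + s) - \<eta> \<bullet> g2 (t + s')) \<or> (\<forall>t\<in>{p..q}. \<xi> \<bullet> g2 (t + s) - \<eta> \<bullet> g2 (t + s') \<le> - \<mu>)"
    proof
      assume *: "\<forall>t\<in>{a..b}. c * norm v \<le> v \<bullet> g2 t"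
      have "\<mu> \<le> \<xi> \<bullet> g2 (t + s) - \<eta> \<bullet> g2 (t + s')" if t: "t \<in> {p..q}" for t
        using err[of t g2, OF t lip2] bspec[OF * in_ab[OF t]] two unfolding abs_le_iff by linarith
      then show ?thesis by blast
    next
      assume *: "\<forall>t\<in>{a..b}. v \<bullet> g2 t \<le> - (c * norm v)"
      have "\<xi> \<bullet> g2 (t + s) - \<eta> \<bullet> g2 (t + s') \<le> - \<mu>" if t: "t \<in> {p..q}" for t
        using err[of t g2, OF t lip2] bspec[OF * in_ab[OF t]] two unfolding abs_le_iff by linarith
      then show ?thesis by blast
    qed
    then show ?thesis using P.van_der_Corput_2[OF mu] by (simp add: le_max_iff_disj)
  qed
  also have "\<dots> \<le> decay / sqrt (norm v)"
  proof -
    define n where "n = norm v"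
    have n1: "n \<ge> 1" "sqrt n > 0" using nv by (auto simp: n_def)
    have sq: "sqrt n \<le> n" using n1 real_sqrt_le_iff[of n "n\<^sup>2"] self_le_power[of n 2] by (simp add: real_sqrt_abs)
    have "2 / \<mu> + (K * n + \<mu>) * (q - p) / \<mu>\<^sup>2 = 4 / (c * n) + (K + c / 2) * (q - p) * 4 / (c\<^sup>2 * n)"
      using n1 c by (simp add: \<mu>_def n_def[symmetric] field_simps power2_eq_square)
    also have "\<dots> \<le> 4 / (c * n) + (K + c) * (b - a) * 4 / (c\<^sup>2 * n)"
      using c K pq n1 by (intro add_left_mono divide_right_mono mult_right_mono mult_mono) auto
    also have "\<dots> = (4 / c + 4 * (K + c) * (b - a) / c\<^sup>2) / n" using c n1 by (simp add: field_simps)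
    also have "\<dots> \<le> (4 / c + 4 * (K + c) * (b - a) / c\<^sup>2) / sqrt n"
      using sq n1 c K ab by (intro divide_left_mono mult_pos_pos add_nonneg_nonneg divide_nonneg_nonneg mult_nonneg_nonneg) auto
    also have "\<dots> \<le> decay / sqrt n" using n1 c by (intro divide_right_mono) (auto simp: decay_def)
    finally have 1: "2 / \<mu> + (K * n + \<mu>) * (q - p) / \<mu>\<^sup>2 \<le> decay / sqrt n" .
    have "8 / sqrt \<mu> = (8 / sqrt (c / 2)) / sqrt n" by (simp add: \<mu>_def n_def real_sqrt_mult real_sqrt_divide)
    also have "\<dots> \<le> decay / sqrt n" using n1 c K ab
      unfolding decay_def by (intro divide_right_mono) (auto intro!: add_nonneg_nonneg divide_nonneg_nonneg mult_nonneg_nonneg)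
    finally show ?thesis using 1 by (simp add: n_def)
  qed
  finally show ?thesis by (simp add: v_def)
qed

lemma oscillation:
  assumes "p \<le> q" "a \<le> p" "q \<le> b" "norm v \<ge> 1"
  shows "norm (integral {p..q} (\<lambda>t. cis (v \<bullet> g t))) \<le> decay / sqrt (norm v)"
  using shifted_oscillation[of p q 0 0 v 0] assms c by simp

text \<open>The first term serves phases without a stationary point; the second is the mass of the
  majorant around a stationary point.\<close>

definition window_const :: real where
  "window_const = (2 / c + K * (b - a) / c\<^sup>2)\<^sup>2 * (b - a) + 12 * pi / c"

text \<open>Without a stationary point each window integral is of size \<open>1 / lam\<close>. With
  one at \<open>c0\<close> it is at most \<open>h\<close> near \<open>c0\<close> and of size
  \<open>1 / (lam * \<bar>t - c0\<bar>)\<close> further away, and the square of this profile has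
  integral of order \<open>h / lam\<close>.\<close>

lemma window_square_integral:
  assumes e: "a \<le> e" "e + h \<le> b" and h: "h > 0"
    and lam: "norm \<xi> = lam" "1 \<le> lam * h" "c * lam * h\<^sup>2 \<le> 3" "lam > 0"
  defines "G \<equiv> \<lambda>t. integral {t..t + h} (\<lambda>s. cis (\<xi> \<bullet> g s))"
  assumes int: "(\<lambda>t. (norm (G t))\<^sup>2) integrable_on {a..e}"
  shows "integral {a..e} (\<lambda>t. (norm (G t))\<^sup>2) \<le> window_const * (h / lam)"
proof -
  interpret P: phase "\<lambda>t. \<xi> \<bullet> g t" "\<lambda>t. \<xi> \<bullet> g1 t" "\<lambda>t. \<xi> \<bullet> g2 t" a b
    using shift_phase[of a b 0 0 \<xi> 0] ab by simp
  define m where "m = 2 / c + K * (b - a) / c\<^sup>2"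
  have wc: "m\<^sup>2 * (b - a) \<le> window_const" "12 * pi / c \<le> window_const"
    using c ab by (auto simp: window_const_def m_def)
  show ?thesis
  proof (cases "(\<forall>t\<in>{a..b}. c * lam \<le> \<xi> \<bullet> g1 t) \<or> (\<forall>t\<in>{a..b}. \<xi> \<bullet> g1 t \<le> - (c * lam))")
    case True
    have "(norm (G t))\<^sup>2 \<le> m\<^sup>2 / lam\<^sup>2" if t: "t \<in> {a..e}" for t
    proof -
      interpret Q: phase "\<lambda>t. \<xi> \<bullet> g t" "\<lambda>t. \<xi> \<bullet> g1 t" "\<lambda>t. \<xi> \<bullet> g2 t" t "t + h"
        using t e h by (intro P.subphase) auto
      have sub: "{t..t + h} \<subseteq> {a..b}" using t e by auto
      have "norm (G t) \<le> 2 / (c * lam) + (lam * K) * (t + h - t) / (c * lam)\<^sup>2"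
        unfolding G_def
      proof (rule Q.van_der_Corput_1)
        show "0 < c * lam" using c lam by simp
        show "(\<forall>s\<in>{t..t + h}. c * lam \<le> \<xi> \<bullet> g1 s) \<or> (\<forall>s\<in>{t..t + h}. \<xi> \<bullet> g1 s \<le> - (c * lam))"
          using True sub by blast
        fix s assume "s \<in> {t..t + h}"
        then have s: "s \<in> {a..b}" using sub by blast
        have "\<bar>\<xi> \<bullet> g2 s\<bar> \<le> norm \<xi> * norm (g2 s)" by (rule Cauchy_Schwarz_ineq2)
        also have "\<dots> \<le> lam * K" using bound2[OF s] lam by (simp add: mult_left_mono)
        finally show "\<bar>\<xi> \<bullet> g2 s\<bar> \<le> lam * K" .
      qed
      also have "\<dots> = (2 / c + K * h / c\<^sup>2) / lam" using lam c by (simp add: field_simps power2_eq_square)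
      also have "\<dots> \<le> m / lam"
        unfolding m_def using lam c K e by (intro divide_right_mono add_left_mono mult_left_mono) auto
      finally have "(norm (G t))\<^sup>2 \<le> (m / lam)\<^sup>2" by (rule power_mono) simp
      then show ?thesis by (simp add: power_divide)
    qed
    then have "integral {a..e} (\<lambda>t. (norm (G t))\<^sup>2) \<le> integral {a..e} (\<lambda>t. m\<^sup>2 / lam\<^sup>2)"
      by (intro integral_le int) auto
    also have "\<dots> = m\<^sup>2 / lam\<^sup>2 * (e - a)" using e by simp
    also have "\<dots> \<le> m\<^sup>2 / lam\<^sup>2 * (b - a)" using e h by (intro mult_left_mono) auto
    also have "\<dots> = m\<^sup>2 * (b - a) * (1 / lam\<^sup>2)" by simp
    also have "\<dots> \<le> m\<^sup>2 * (b - a) * (h / lam)"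
    proof (rule mult_left_mono)
      show "1 / lam\<^sup>2 \<le> h / lam" using lam(2,4) by (simp add: field_simps power2_eq_square)
    qed (use ab in simp)
    also have "\<dots> \<le> window_const * (h / lam)" using wc h lam by (intro mult_right_mono) auto
    finally show ?thesis .
  next
    case False
    moreover have "(\<forall>t\<in>{a..b}. c * lam \<le> \<xi> \<bullet> g1 t) \<or> (\<forall>t\<in>{a..b}. \<xi> \<bullet> g1 t \<le> - (c * lam))
      \<or> (\<forall>t\<in>{a..b}. c * lam \<le> \<xi> \<bullet> g2 t) \<or> (\<forall>t\<in>{a..b}. \<xi> \<bullet> g2 t \<le> - (c * lam))"
      using curved[of \<xi>] by (simp only: lam(1))
    ultimately have *: "(\<forall>t\<in>{a..b}. c * lam \<le> \<xi> \<bullet> g2 t) \<or> (\<forall>t\<in>{a..b}. \<xi> \<bullet> g2 t \<le> - (c * lam))"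
      by blast
    have "c * lam > 0" using c lam by simp
    from P.van_der_Corput_window[OF this h *]
    obtain c0 where c0: "\<forall>r. a \<le> r \<longrightarrow> r + h \<le> b \<longrightarrow> 2 * h \<le> \<bar>r - c0\<bar> \<longrightarrow>
      norm (integral {r..r + h} (\<lambda>t. cis (\<xi> \<bullet> g t))) \<le> 6 / (c * lam * \<bar>r - c0\<bar>)" ..
    \<comment> \<open>Scaled so that \<open>6 / (c * lam * \<bar>t - c0\<bar>)\<close> reads
      \<open>h / (k * \<bar>t - c0\<bar>)\<close>. A single Lorentzian then dominates both regimes,
      and its integral is an arctangent.\<close>
    define k where "k = c * lam * h / 6"
    have k: "k > 0" using c lam h by (simp add: k_def)
    have pos: "1 + (k * (t - c0))\<^sup>2 > 0" for t by (simp add: add_pos_nonneg)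
    have "(norm (G t))\<^sup>2 \<le> 2 * h\<^sup>2 / (1 + (k * (t - c0))\<^sup>2)" if t: "t \<in> {a..e}" for t
    proof -
      have triv: "norm (G t) \<le> h"
      proof -
        have "continuous_on {t..t + h} (\<lambda>s. \<xi> \<bullet> g s)"
          by (intro continuous_intros continuous_on_subset[OF cont_g]) (use t e in auto)
        from norm_integral_cis_le[OF _ this] show ?thesis using h by (simp add: G_def)
      qed
      have triv2: "(norm (G t))\<^sup>2 \<le> h\<^sup>2" using triv by (rule power_mono) simp
      have "(norm (G t))\<^sup>2 * (k * (t - c0))\<^sup>2 \<le> h\<^sup>2"
      proof (cases "2 * h \<le> \<bar>t - c0\<bar>")
        case True
        then have "norm (G t) \<le> 6 / (c * lam * \<bar>t - c0\<bar>)" unfolding G_def using t e by (intro c0[rule_format]) auto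
        then have "norm (G t) * (k * \<bar>t - c0\<bar>) \<le> 6 / (c * lam * \<bar>t - c0\<bar>) * (k * \<bar>t - c0\<bar>)"
          using k by (intro mult_right_mono) auto
        also have "\<dots> = h" using True h c lam by (simp add: k_def field_simps)
        finally have "(norm (G t) * (k * \<bar>t - c0\<bar>))\<^sup>2 \<le> h\<^sup>2" using k by (intro power_mono) auto
        then show ?thesis by (simp add: power_mult_distrib)
      next
        case False
        \<comment> \<open>Within \<open>2 * h\<close> of \<open>c0\<close> the trivial bound is
          enough, because \<open>c * lam * h^2 \<le> 3\<close> is exactly
          \<open>k * (2 * h) \<le> 1\<close>.\<close>
        have "k * \<bar>t - c0\<bar> \<le> k * (2 * h)" using False k by (intro mult_left_mono) auto
        also have "\<dots> \<le> 1" using lam(3) by (simp add: k_def power2_eq_square mult_ac)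
        finally have "(k * \<bar>t - c0\<bar>)\<^sup>2 \<le> 1\<^sup>2" using k by (intro power_mono) auto
        then have "(k * (t - c0))\<^sup>2 \<le> 1" by (simp add: power_mult_distrib)
        then show ?thesis using triv2 mult_mono[OF triv2, of "(k * (t - c0))\<^sup>2" 1] by simp
      qed
      then show ?thesis using triv2 pos[of t] by (simp add: field_simps)
    qed
    moreover have at: "((\<lambda>t. 2 * h\<^sup>2 / (1 + (k * (t - c0))\<^sup>2)) has_integral
        (2 * h\<^sup>2 / k * arctan (k * (e - c0)) - 2 * h\<^sup>2 / k * arctan (k * (a - c0)))) {a..e}"
    proof (rule fundamental_theorem_of_calculus[OF e(1)])
      fix t
      have "((\<lambda>t. 2 * h\<^sup>2 / k * arctan (k * (t - c0))) has_real_derivative 2 * h\<^sup>2 / (1 + (k * (t - c0))\<^sup>2)) (at t within {a..e})"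
        using k by (auto intro!: derivative_eq_intros simp: divide_inverse)
      then show "((\<lambda>t. 2 * h\<^sup>2 / k * arctan (k * (t - c0))) has_vector_derivative 2 * h\<^sup>2 / (1 + (k * (t - c0))\<^sup>2)) (at t within {a..e})"
        by (simp add: has_real_derivative_iff_has_vector_derivative)
    qed
    ultimately have "integral {a..e} (\<lambda>t. (norm (G t))\<^sup>2)
        \<le> 2 * h\<^sup>2 / k * arctan (k * (e - c0)) - 2 * h\<^sup>2 / k * arctan (k * (a - c0))"
      using has_integral_le[OF integrable_integral[OF int] at] by blast
    also have "\<dots> = 2 * h\<^sup>2 / k * (arctan (k * (e - c0)) - arctan (k * (a - c0)))" by (simp add: algebra_simps)
    also have "\<dots> \<le> 2 * h\<^sup>2 / k * pi"
      using arctan_ubound[of "k * (e - c0)"] arctan_lbound[of "k * (a - c0)"] k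
      by (intro mult_left_mono) auto
    also have "\<dots> = 12 * pi / c * (h / lam)" using h c lam by (simp add: k_def field_simps power2_eq_square)
    also have "\<dots> \<le> window_const * (h / lam)" using wc h lam by (intro mult_right_mono) auto
    finally show ?thesis .
  qed
qed

end

section \<open>Mean square estimates\<close>

text \<open>Schur's test for a symmetric kernel: each product is at most the mean of the two
  squares, and then only row sums matter.\<close>

lemma schur_test:
  fixes x :: "'a \<Rightarrow> real" and k :: "'a \<Rightarrow> 'a \<Rightarrow> real"
  assumes "finite E" and k: "\<And>\<xi> \<eta>. \<xi> \<in> E \<Longrightarrow> \<eta> \<in> E \<Longrightarrow> 0 \<le> k \<xi> \<eta>"
    and sym: "\<And>\<xi> \<eta>. \<xi> \<in> E \<Longrightarrow> \<eta> \<in> E \<Longrightarrow> k \<xi> \<eta> = k \<eta> \<xi>"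
    and row: "\<And>\<xi>. \<xi> \<in> E \<Longrightarrow> (\<Sum>\<eta>\<in>E. k \<xi> \<eta>) \<le> R"
  shows "(\<Sum>\<xi>\<in>E. \<Sum>\<eta>\<in>E. x \<xi> * x \<eta> * k \<xi> \<eta>) \<le> R * (\<Sum>\<xi>\<in>E. (x \<xi>)\<^sup>2)"
proof -
  have am: "u * v \<le> (u\<^sup>2 + v\<^sup>2) / 2" for u v :: real
    using sum_squares_bound[of u v] by simp
  have "(\<Sum>\<xi>\<in>E. \<Sum>\<eta>\<in>E. x \<xi> * x \<eta> * k \<xi> \<eta>) \<le> (\<Sum>\<xi>\<in>E. \<Sum>\<eta>\<in>E. ((x \<xi>)\<^sup>2 + (x \<eta>)\<^sup>2) / 2 * k \<xi> \<eta>)"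
    by (intro sum_mono mult_right_mono am k)
  also have "\<dots> = ((\<Sum>\<xi>\<in>E. \<Sum>\<eta>\<in>E. (x \<xi>)\<^sup>2 * k \<xi> \<eta>) + (\<Sum>\<xi>\<in>E. \<Sum>\<eta>\<in>E. (x \<eta>)\<^sup>2 * k \<xi> \<eta>)) / 2"
    by (simp add: sum.distrib[symmetric] sum_divide_distrib algebra_simps add_divide_distrib)
  also have "(\<Sum>\<xi>\<in>E. \<Sum>\<eta>\<in>E. (x \<eta>)\<^sup>2 * k \<xi> \<eta>) = (\<Sum>\<eta>\<in>E. \<Sum>\<xi>\<in>E. (x \<eta>)\<^sup>2 * k \<eta> \<xi>)"
    by (subst sum.swap) (intro sum.cong refl, simp add: sym)
  also have "((\<Sum>\<xi>\<in>E. \<Sum>\<eta>\<in>E. (x \<xi>)\<^sup>2 * k \<xi> \<eta>) + (\<Sum>\<eta>\<in>E. \<Sum>\<xi>\<in>E. (x \<eta>)\<^sup>2 * k \<eta> \<xi>)) / 2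
      = (\<Sum>\<xi>\<in>E. (x \<xi>)\<^sup>2 * (\<Sum>\<eta>\<in>E. k \<xi> \<eta>))"
    by (simp add: sum_distrib_left sum_distrib_right mult_ac)
  also have "\<dots> \<le> (\<Sum>\<xi>\<in>E. (x \<xi>)\<^sup>2 * R)"
    by (intro sum_mono mult_left_mono row) auto
  also have "\<dots> = R * (\<Sum>\<xi>\<in>E. (x \<xi>)\<^sup>2)" by (simp add: sum_distrib_left mult.commute)
  finally show ?thesis .
qed

text \<open>Separates the interactions that oscillation need not make small, the first two cases,
  from those that it does.\<close>

definition near_far :: "real \<Rightarrow> real \<Rightarrow> real \<Rightarrow> real \<Rightarrow> real^2 \<Rightarrow> real^2 \<Rightarrow> real" where
  "near_far R D0 D1 \<epsilon> \<xi> \<eta> = (if \<xi> = \<eta> then D0 else if norm (\<xi> - \<eta>) \<le> R then D1 else \<epsilon>)"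

text \<open>At scale \<open>R\<close> a lattice point of the circle has at most one companion on it,
  so \<open>D1\<close> occurs at most once in a row.\<close>

lemma near_far_row_sum:
  assumes R: "8 * R ^ 3 < lam" and nonneg: "0 \<le> R" "0 \<le> D0" "0 \<le> D1" "0 \<le> \<epsilon>"
    and \<xi>: "\<xi> \<in> lattice_circle lam"
  shows "(\<Sum>\<eta>\<in>lattice_circle lam. near_far R D0 D1 \<epsilon> \<xi> \<eta>) \<le> D0 + D1 + \<epsilon> * card (lattice_circle lam)"
proof -
  let ?E = "lattice_circle lam"
  have fin: "finite ?E" by (rule finite_lattice_circle)
  let ?N = "{\<eta> \<in> ?E. norm (\<eta> - \<xi>) \<le> R}"
  have "card ?N \<le> 2" by (rule card_lattice_circle_ball_le_2[OF R])
  moreover have "\<xi> \<in> ?N" using \<xi> nonneg by simp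
  ultimately have N1: "card (?N - {\<xi>}) \<le> 1" using fin by (simp add: card_Diff_singleton)
  have "(\<Sum>\<eta>\<in>?E. near_far R D0 D1 \<epsilon> \<xi> \<eta>)
      \<le> (\<Sum>\<eta>\<in>?E. (if \<eta> = \<xi> then D0 else 0) + ((if \<eta> \<in> ?N - {\<xi>} then D1 else 0) + \<epsilon>))"
    by (rule sum_mono) (use nonneg in \<open>auto simp: near_far_def norm_minus_commute\<close>)
  also have "\<dots> = (\<Sum>\<eta>\<in>?E. if \<eta> = \<xi> then D0 else 0) + ((\<Sum>\<eta>\<in>?E. if \<eta> \<in> ?N - {\<xi>} then D1 else 0) + (\<Sum>\<eta>\<in>?E. \<epsilon>))"
    by (simp only: sum.distrib)
  also have "(\<Sum>\<eta>\<in>?E. if \<eta> = \<xi> then D0 else 0) = D0" using fin \<xi> by simp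
  also have "(\<Sum>\<eta>\<in>?E. if \<eta> \<in> ?N - {\<xi>} then D1 else 0) = (\<Sum>\<eta>\<in>?E \<inter> (?N - {\<xi>}). D1)"
    by (rule sum.inter_restrict[OF fin, symmetric])
  also have "?E \<inter> (?N - {\<xi>}) = ?N - {\<xi>}" by blast
  also have "(\<Sum>\<eta>\<in>?N - {\<xi>}. D1) = real (card (?N - {\<xi>})) * D1" by simp
  also have "\<dots> \<le> 1 * D1" using N1 nonneg by (intro mult_right_mono) auto
  finally show ?thesis by (simp add: mult.commute)
qed

lemma near_far_form_bound:
  assumes R: "8 * R ^ 3 < lam" and nonneg: "0 \<le> R" "0 \<le> D0" "0 \<le> D1" "0 \<le> \<epsilon>"
    and M: "\<And>\<xi> \<eta>. \<xi> \<in> lattice_circle lam \<Longrightarrow> \<eta> \<in> lattice_circle lam \<Longrightarrow>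
      norm (M \<xi> \<eta> :: complex) \<le> near_far R D0 D1 \<epsilon> \<xi> \<eta>"
  shows "norm (\<Sum>\<xi>\<in>lattice_circle lam. \<Sum>\<eta>\<in>lattice_circle lam. a \<xi> * cnj (a \<eta>) * M \<xi> \<eta>)
    \<le> (D0 + D1 + \<epsilon> * card (lattice_circle lam)) * (\<Sum>\<xi>\<in>lattice_circle lam. (norm (a \<xi>))\<^sup>2)"
proof -
  let ?E = "lattice_circle lam"
  have "norm (\<Sum>\<xi>\<in>?E. \<Sum>\<eta>\<in>?E. a \<xi> * cnj (a \<eta>) * M \<xi> \<eta>)
      \<le> (\<Sum>\<xi>\<in>?E. \<Sum>\<eta>\<in>?E. norm (a \<xi> * cnj (a \<eta>) * M \<xi> \<eta>))"
    by (intro order_trans[OF norm_sum] sum_mono norm_sum)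
  also have "\<dots> \<le> (\<Sum>\<xi>\<in>?E. \<Sum>\<eta>\<in>?E. norm (a \<xi>) * norm (a \<eta>) * near_far R D0 D1 \<epsilon> \<xi> \<eta>)"
    by (intro sum_mono) (simp add: norm_mult M mult_left_mono)
  also have "\<dots> \<le> (D0 + D1 + \<epsilon> * card ?E) * (\<Sum>\<xi>\<in>?E. (norm (a \<xi>))\<^sup>2)"
  proof (rule schur_test[OF finite_lattice_circle])
    show "0 \<le> near_far R D0 D1 \<epsilon> \<xi> \<eta>" for \<xi> \<eta> using nonneg by (simp add: near_far_def)
    show "near_far R D0 D1 \<epsilon> \<xi> \<eta> = near_far R D0 D1 \<epsilon> \<eta> \<xi>" for \<xi> \<eta>
      by (auto simp: near_far_def norm_minus_commute)
  qed (rule near_far_row_sum[OF R nonneg])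
  finally show ?thesis .
qed

lemma integral_norm_sq_sum:
  fixes \<phi> :: "'a \<Rightarrow> real \<Rightarrow> complex"
  assumes "finite E" and cont: "\<And>\<xi>. \<xi> \<in> E \<Longrightarrow> continuous_on {p..q} (\<phi> \<xi>)"
  shows "complex_of_real (integral {p..q} (\<lambda>t. (norm (\<Sum>\<xi>\<in>E. a \<xi> * \<phi> \<xi> t))\<^sup>2))
    = (\<Sum>\<xi>\<in>E. \<Sum>\<eta>\<in>E. a \<xi> * cnj (a \<eta>) * integral {p..q} (\<lambda>t. \<phi> \<xi> t * cnj (\<phi> \<eta> t)))"
proof -
  have int: "(\<lambda>t. a \<xi> * cnj (a \<eta>) * (\<phi> \<xi> t * cnj (\<phi> \<eta> t))) integrable_on {p..q}" if "\<xi> \<in> E" "\<eta> \<in> E" for \<xi> \<eta>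
    by (intro integrable_continuous_real continuous_intros cont that)
  have sq: "complex_of_real ((norm (\<Sum>\<xi>\<in>E. a \<xi> * \<phi> \<xi> t))\<^sup>2)
      = (\<Sum>\<xi>\<in>E. \<Sum>\<eta>\<in>E. a \<xi> * cnj (a \<eta>) * (\<phi> \<xi> t * cnj (\<phi> \<eta> t)))" for t
    unfolding complex_norm_square by (simp add: sum_product mult_ac)
  have "((\<lambda>t. (norm (\<Sum>\<xi>\<in>E. a \<xi> * \<phi> \<xi> t))\<^sup>2) has_integral
      integral {p..q} (\<lambda>t. (norm (\<Sum>\<xi>\<in>E. a \<xi> * \<phi> \<xi> t))\<^sup>2)) {p..q}"
    by (intro integrable_integral integrable_continuous_real continuous_intros cont)
  from has_integral_linear[OF this bounded_linear_of_real[where 'a = complex]]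
  have "complex_of_real (integral {p..q} (\<lambda>t. (norm (\<Sum>\<xi>\<in>E. a \<xi> * \<phi> \<xi> t))\<^sup>2))
      = integral {p..q} (\<lambda>t. \<Sum>\<xi>\<in>E. \<Sum>\<eta>\<in>E. a \<xi> * cnj (a \<eta>) * (\<phi> \<xi> t * cnj (\<phi> \<eta> t)))"
    unfolding o_def sq by (simp only: integral_unique)
  also have "\<dots> = (\<Sum>\<xi>\<in>E. \<Sum>\<eta>\<in>E. integral {p..q} (\<lambda>t. a \<xi> * cnj (a \<eta>) * (\<phi> \<xi> t * cnj (\<phi> \<eta> t))))"
  proof -
    have "integral {p..q} (\<lambda>t. \<Sum>\<xi>\<in>E. \<Sum>\<eta>\<in>E. a \<xi> * cnj (a \<eta>) * (\<phi> \<xi> t * cnj (\<phi> \<eta> t)))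
        = (\<Sum>\<xi>\<in>E. integral {p..q} (\<lambda>t. \<Sum>\<eta>\<in>E. a \<xi> * cnj (a \<eta>) * (\<phi> \<xi> t * cnj (\<phi> \<eta> t))))"
      by (rule integral_sum[OF assms(1)]) (intro integrable_sum assms(1) int)
    also have "\<dots> = (\<Sum>\<xi>\<in>E. \<Sum>\<eta>\<in>E. integral {p..q} (\<lambda>t. a \<xi> * cnj (a \<eta>) * (\<phi> \<xi> t * cnj (\<phi> \<eta> t))))"
      by (intro sum.cong refl integral_sum[OF assms(1)] int)
    finally show ?thesis .
  qed
  also have "\<dots> = (\<Sum>\<xi>\<in>E. \<Sum>\<eta>\<in>E. a \<xi> * cnj (a \<eta>) * integral {p..q} (\<lambda>t. \<phi> \<xi> t * cnj (\<phi> \<eta> t)))"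
    by (simp only: integral_mult_right)
  finally show ?thesis .
qed

text \<open>Equality in \<open>norm_integral_cis_le\<close> forces the phase to be constant modulo \<open>2 pi\<close>.\<close>

lemma norm_integral_cis_less:
  assumes pq: "p < q" and der: "\<And>t. t \<in> {p..q} \<Longrightarrow> (\<psi> has_real_derivative \<psi>1 t) (at t within {p..q})"
    and t0: "t0 \<in> {p..q}" "\<psi>1 t0 \<noteq> 0"
  shows "norm (integral {p..q} (\<lambda>t. cis (\<psi> t))) < q - p"
proof (rule ccontr)
  assume *: "\<not> ?thesis"
  have cont: "continuous_on {p..q} \<psi>" by (rule DERIV_continuous_on[OF der])
  define I where "I = integral {p..q} (\<lambda>t. cis (\<psi> t))"
  have nI: "norm I = q - p"
    using * norm_integral_cis_le[OF _ cont] pq unfolding I_def by simp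
  \<comment> \<open>The rotation that makes the integral positive real:
    \<open>Re (w * cis (\<psi> t))\<close> is at most 1 and has mean 1, hence is identically
    1.\<close>
  define w where "w = cnj I / norm I"
  have I0: "I \<noteq> 0" using nI pq by auto
  then have nw: "norm w = 1" by (simp add: w_def norm_divide)
  have "cnj I * I = complex_of_real (norm I) * complex_of_real (norm I)"
    using complex_norm_square[of I] by (simp add: mult.commute power2_eq_square)
  then have wI: "w * I = of_real (q - p)"
    using I0 unfolding nI[symmetric] by (simp add: w_def)
  have int: "((\<lambda>t. cis (\<psi> t)) has_integral I) {p..q}"
    unfolding I_def by (intro integrable_integral integrable_continuous_real continuous_intros cont)
  have "((\<lambda>t. Re (w * cis (\<psi> t))) has_integral (q - p)) {p..q}"
    using has_integral_linear[OF has_integral_mult_right[OF int, of w] bounded_linear_Re] wI by (simp add: o_def)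
  moreover have "((\<lambda>t::real. 1::real) has_integral (q - p)) {p..q}"
    using has_integral_const_real[of "1::real" p q] pq by simp
  ultimately have "((\<lambda>t. 1 - Re (w * cis (\<psi> t))) has_integral ((q - p) - (q - p))) {p..q}"
    by (intro has_integral_diff)
  then have 0: "integral {p..q} (\<lambda>t. 1 - Re (w * cis (\<psi> t))) = 0" by (simp add: integral_unique)
  have le1: "Re (w * cis (\<psi> t)) \<le> 1" for t
    using complex_Re_le_cmod[of "w * cis (\<psi> t)"] nw by (simp add: norm_mult)
  have "\<forall>t\<in>{p..q}. 1 - Re (w * cis (\<psi> t)) = 0"
  proof -
    have "continuous_on {p..q} (\<lambda>t. 1 - Re (w * cis (\<psi> t)))" by (intro continuous_intros cont)
    moreover have "0 \<le> 1 - Re (w * cis (\<psi> t))" for t using le1[of t] by (simp only: diff_ge_0_iff_ge)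
    ultimately show ?thesis using integral_eq_0_iff[of p q "\<lambda>t. 1 - Re (w * cis (\<psi> t))"] pq 0 by blast
  qed
  then have one: "w * cis (\<psi> t) = 1" if "t \<in> {p..q}" for t
  proof -
    have "Re (w * cis (\<psi> t)) = 1" using \<open>\<forall>t\<in>{p..q}. 1 - Re (w * cis (\<psi> t)) = 0\<close> that by force
    moreover have "(Re (w * cis (\<psi> t)))\<^sup>2 + (Im (w * cis (\<psi> t)))\<^sup>2 = 1"
      unfolding cmod_power2[symmetric] by (simp add: norm_mult nw)
    ultimately have "Im (w * cis (\<psi> t)) = 0" by simp
    then show ?thesis using \<open>Re (w * cis (\<psi> t)) = 1\<close> by (simp only: complex_eq_iff one_complex.simps)
  qed
  have "((\<lambda>t. w * cis (\<psi> t)) has_vector_derivative w * (\<i> * of_real (\<psi>1 t0) * cis (\<psi> t0))) (at t0 within {p..q})"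
    by (intro has_vector_derivative_mult_right cis_compose_has_vector_derivative der t0)
  then have "((\<lambda>t. 1) has_vector_derivative w * (\<i> * of_real (\<psi>1 t0) * cis (\<psi> t0))) (at t0 within {p..q})"
    by (rule has_vector_derivative_transform[OF t0(1), rotated]) (simp add: one)
  then have "w * (\<i> * of_real (\<psi>1 t0) * cis (\<psi> t0)) = 0"
    using t0(1) has_vector_derivative_const
    by (intro vector_derivative_unique_within_closed_interval[OF pq, of t0 "\<lambda>t. 1"]) simp_all
  moreover have "w * (\<i> * of_real (\<psi>1 t0) * cis (\<psi> t0)) = \<i> * of_real (\<psi>1 t0)"
  proof -
    have "w * (\<i> * of_real (\<psi>1 t0) * cis (\<psi> t0)) = \<i> * of_real (\<psi>1 t0) * (w * cis (\<psi> t0))"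
      by (simp only: mult_ac)
    then show ?thesis by (simp only: one[OF t0(1)] mult_1_right)
  qed
  ultimately show False using t0(2) by simp
qed


text \<open>A window integral is an integral over shifts; exchanging the order of integration
  transfers a bound that is uniform in the shift to windows, at the price of the length
  \<open>h\<close>.\<close>

lemma norm_integral_swap_le:
  fixes P :: "real \<Rightarrow> complex" and Q :: "real \<Rightarrow> real \<Rightarrow> complex"
  assumes pq: "p \<le> q" and h: "h \<ge> 0"
    and P: "continuous_on {p..q} P" and Q: "continuous_on ({p..q} \<times> {0..h}) (\<lambda>(t, s). Q t s)"
    and M: "\<And>s. s \<in> {0..h} \<Longrightarrow> norm (integral {p..q} (\<lambda>t. P t * Q t s)) \<le> M"
  shows "norm (integral {p..q} (\<lambda>t. P t * integral {0..h} (Q t))) \<le> h * M"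
proof -
  have box: "cbox (p, 0) (q, h) = {p..q} \<times> {0..h}" by (simp add: cbox_Pair_eq)
  have cont: "continuous_on ({p..q} \<times> {0..h}) (\<lambda>(t, s). P t * Q t s)"
    using Q unfolding case_prod_unfold
    by (intro continuous_intros continuous_on_compose2[OF P]) auto
  have "integral {p..q} (\<lambda>t. P t * integral {0..h} (Q t)) = integral {p..q} (\<lambda>t. integral {0..h} (\<lambda>s. P t * Q t s))"
    by simp
  also have "\<dots> = integral {0..h} (\<lambda>s. integral {p..q} (\<lambda>t. P t * Q t s))"
    using integral_swap_continuous[of p 0 q h "\<lambda>t s. P t * Q t s"] cont unfolding box by simp
  finally have eq: "integral {p..q} (\<lambda>t. P t * integral {0..h} (Q t)) = integral {0..h} (\<lambda>s. integral {p..q} (\<lambda>t. P t * Q t s))" .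
  have cont': "continuous_on {0..h} (\<lambda>s. integral (cbox p q) (\<lambda>t. P t * Q t s))"
  proof (rule integral_continuous_on_param)
    have "continuous_on ({0..h} \<times> cbox p q) (\<lambda>z. (\<lambda>(t, s). P t * Q t s) (snd z, fst z))"
      by (rule continuous_on_compose2[OF cont]) (auto intro!: continuous_intros)
    then show "continuous_on ({0..h} \<times> cbox p q) (\<lambda>(s, t). P t * Q t s)" by (simp add: case_prod_unfold)
  qed
  have "norm (integral {0..h} (\<lambda>s. integral {p..q} (\<lambda>t. P t * Q t s))) \<le> integral {0..h} (\<lambda>s. M)"
    by (rule integral_norm_bound_integral) (use cont' M in \<open>auto intro!: integrable_continuous_real\<close>)
  then show ?thesis using eq h by simp
qed

lemma integral_window_shift:
  fixes f :: "real \<Rightarrow> 'a::euclidean_space"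
  shows "integral {t..t + h} f = integral {0..h} (\<lambda>s. f (t + s))"
  using integral_shift_Icc_real[of 0 h f t] by (simp add: o_def add.commute[of h t])

section \<open>First and second moments of exponential sums along the arc\<close>

context curved_arc
begin

definition wave :: "real^2 \<Rightarrow> real \<Rightarrow> complex" where
  "wave \<xi> t = cis (\<xi> \<bullet> g t)"

lemma continuous_on_wave: "S \<subseteq> {a..b} \<Longrightarrow> continuous_on S (wave \<xi>)"
  unfolding wave_def by (intro continuous_intros continuous_on_subset[OF cont_g])

lemma wave_mult_cnj: "wave \<xi> t * cnj (wave \<eta> t) = wave (\<xi> - \<eta>) t"
  by (simp add: wave_def cis_cnj cis_mult inner_diff_left)

lemma wave_0: "wave 0 t = 1"
  by (simp add: wave_def)

lemma norm_integral_wave_le: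
  "p \<le> q \<Longrightarrow> {p..q} \<subseteq> {a..b} \<Longrightarrow> norm (integral {p..q} (wave \<xi>)) \<le> q - p"
  unfolding wave_def
  by (intro norm_integral_cis_le continuous_intros continuous_on_subset[OF cont_g])

lemma wave_decay:
  assumes "p \<le> q" "a \<le> p" "q \<le> b" "norm v > R" "R \<ge> 1"
  shows "norm (integral {p..q} (wave v)) \<le> decay / sqrt R"
proof -
  have "norm (integral {p..q} (wave v)) \<le> decay / sqrt (norm v)"
    unfolding wave_def using assms by (intro oscillation) auto
  also have "\<dots> \<le> decay / sqrt R"
    using assms decay_pos by (intro divide_left_mono) (auto intro!: mult_pos_pos)
  finally show ?thesis .
qed

text \<open>If \<open>v \<bullet> g1\<close> vanished on the interval, so would its derivative
  \<open>v \<bullet> g2\<close> at \<open>p\<close>, against \<open>curved\<close>. Hence the phase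
  is not constant.\<close>

lemma wave_nonconstant:
  assumes pq: "a \<le> p" "p < q" "q \<le> b" and v: "v \<noteq> 0"
  shows "norm (integral {p..q} (wave v)) < q - p"
proof -
  interpret P: phase "\<lambda>t. v \<bullet> g t" "\<lambda>t. v \<bullet> g1 t" "\<lambda>t. v \<bullet> g2 t" p q
    using shift_phase[of p q 0 0 v 0] pq by simp
  have cv: "c * norm v > 0" using c v by simp
  have "\<exists>t0\<in>{p..q}. v \<bullet> g1 t0 \<noteq> 0"
  proof (rule ccontr)
    assume *: "\<not> ?thesis"
    then have z: "v \<bullet> g1 t = 0" if "t \<in> {p..q}" for t using that by blast
    have "v \<bullet> g2 p = 0"
    proof -
      have "((\<lambda>t. v \<bullet> g1 t) has_vector_derivative v \<bullet> g2 p) (at p within {p..q})"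
        using P.der2[of p] pq by (simp add: has_real_derivative_iff_has_vector_derivative)
      then have "((\<lambda>t. 0) has_vector_derivative v \<bullet> g2 p) (at p within {p..q})"
        by (rule has_vector_derivative_transform[rotated 2]) (use pq z in auto)
      then show ?thesis
        using vector_derivative_unique_within_closed_interval[OF pq(2), of p "\<lambda>t. 0::real"] pq has_vector_derivative_const
        by (simp add: cbox_interval)
    qed
    moreover have "v \<bullet> g1 p = 0" using z pq by simp
    moreover have "p \<in> {a..b}" using pq by simp
    ultimately show False using curved[of v] cv by (smt (verit))
  qed
  then show ?thesis unfolding wave_def
    using norm_integral_cis_less[OF pq(2) P.der1] by blast
qed

text \<open>Beyond some radius decay wins a factor 1/2; inside it there are finitely many integer
  frequencies, each with a strict inequality. Uniformity in \<open>v\<close> is essential, because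
  differences of lattice points can stay bounded while \<open>lam\<close> grows.\<close>

lemma wave_uniform_gap:
  assumes pq: "a \<le> p" "p < q" "q \<le> b"
  shows "\<exists>\<rho>. 0 \<le> \<rho> \<and> \<rho> < 1 \<and>
    (\<forall>v. (\<forall>i. v $ i \<in> \<int>) \<longrightarrow> v \<noteq> 0 \<longrightarrow> norm (integral {p..q} (wave v)) \<le> \<rho> * (q - p))"
proof -
  define R where "R = max 1 ((2 * decay / (q - p))\<^sup>2)"
  have R: "R \<ge> 1" "sqrt R \<ge> 2 * decay / (q - p)"
    using decay_pos pq by (auto simp: R_def intro!: real_le_rsqrt)
  define V where "V = {v::real^2. (\<forall>i. v $ i \<in> \<int>) \<and> norm v \<le> R} - {0}"
  have "finite V" unfolding V_def by (intro finite_Diff finite_lattice_cball)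
  \<comment> \<open>The entry 1/2 accounts for all frequencies beyond \<open>R\<close> and makes the
    set nonempty.\<close>
  define m where "m = Max (insert (1/2) ((\<lambda>v. norm (integral {p..q} (wave v)) / (q - p)) ` V))"
  have fin: "finite (insert (1/2) ((\<lambda>v. norm (integral {p..q} (wave v)) / (q - p)) ` V))"
    using \<open>finite V\<close> by simp
  show ?thesis
  proof (intro exI[of _ m] conjI allI impI)
    have half: "1/2 \<le> m" unfolding m_def using fin by (intro Max_ge) auto
    then show "0 \<le> m" by simp
    show "m < 1" unfolding m_def
      using fin wave_nonconstant[OF pq] pq by (subst Max_less_iff) (auto simp: V_def)
    fix v :: "real^2" assume v: "\<forall>i. v $ i \<in> \<int>" "v \<noteq> 0"
    show "norm (integral {p..q} (wave v)) \<le> m * (q - p)"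
    proof (cases "norm v \<le> R")
      case True
      then have "norm (integral {p..q} (wave v)) / (q - p) \<le> m"
        unfolding m_def using fin v by (intro Max_ge) (auto simp: V_def)
      then show ?thesis using pq by (simp add: field_simps)
    next
      case False
      then have "norm (integral {p..q} (wave v)) \<le> decay / sqrt R"
        using pq R by (intro wave_decay) auto
      also have "\<dots> \<le> 1/2 * (q - p)"
        using R pq by (simp add: field_simps)
      also have "\<dots> \<le> m * (q - p)" using half pq by (intro mult_right_mono) auto
      finally show ?thesis .
    qed
  qed
qed

definition trig_sum :: "(real^2) set \<Rightarrow> (real^2 \<Rightarrow> complex) \<Rightarrow> real \<Rightarrow> complex" where
  "trig_sum E x t = (\<Sum>\<xi>\<in>E. x \<xi> * wave \<xi> t)"

lemma continuous_on_trig_sum: "S \<subseteq> {a..b} \<Longrightarrow> continuous_on S (trig_sum E x)"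
  unfolding trig_sum_def by (intro continuous_intros continuous_on_wave)

text \<open>A near pair is bounded trivially, exactly like the diagonal, whence the factor
  2.\<close>

lemma L2_upper:
  assumes pq: "a \<le> p" "p \<le> q" "q \<le> b" and R: "8 * R ^ 3 < lam" "R \<ge> 1"
  defines "E \<equiv> lattice_circle lam"
  shows "integral {p..q} (\<lambda>t. (norm (trig_sum E x t))\<^sup>2)
    \<le> (2 * (q - p) + decay / sqrt R * card E) * (\<Sum>\<xi>\<in>E. (norm (x \<xi>))\<^sup>2)"
proof -
  have sub: "{p..q} \<subseteq> {a..b}" using pq by auto
  have eq: "complex_of_real (integral {p..q} (\<lambda>t. (norm (trig_sum E x t))\<^sup>2))
    = (\<Sum>\<xi>\<in>E. \<Sum>\<eta>\<in>E. x \<xi> * cnj (x \<eta>) * integral {p..q} (wave (\<xi> - \<eta>)))"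
    unfolding trig_sum_def E_def
    by (subst integral_norm_sq_sum[OF finite_lattice_circle])
      (auto simp: wave_mult_cnj intro!: continuous_on_wave sub)
  have "norm (\<Sum>\<xi>\<in>E. \<Sum>\<eta>\<in>E. x \<xi> * cnj (x \<eta>) * integral {p..q} (wave (\<xi> - \<eta>)))
    \<le> ((q - p) + (q - p) + decay / sqrt R * card E) * (\<Sum>\<xi>\<in>E. (norm (x \<xi>))\<^sup>2)"
    unfolding E_def
  proof (rule near_far_form_bound[OF R(1)])
    fix \<xi> \<eta> :: "real^2"
    show "norm (integral {p..q} (wave (\<xi> - \<eta>))) \<le> near_far R (q - p) (q - p) (decay / sqrt R) \<xi> \<eta>"
      using norm_integral_wave_le[OF pq(2) sub] wave_decay[OF pq(2,1,3), of R "\<xi> - \<eta>"] R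
      by (auto simp: near_far_def)
  qed (use pq R decay_pos in auto)
  also have "norm (\<Sum>\<xi>\<in>E. \<Sum>\<eta>\<in>E. x \<xi> * cnj (x \<eta>) * integral {p..q} (wave (\<xi> - \<eta>)))
      = \<bar>integral {p..q} (\<lambda>t. (norm (trig_sum E x t))\<^sup>2)\<bar>"
    unfolding eq[symmetric] by simp
  finally show ?thesis by simp
qed

text \<open>The diagonal contributes \<open>q - p\<close> times the sum of squares exactly. The
  remaining form \<open>M\<close> has at most one near entry per row, worth
  \<open>\<rho> * (q - p)\<close>, so a fraction \<open>1 - \<rho>\<close> of the diagonal survives,
  up to far pairs.\<close>

lemma L2_lower:
  assumes pq: "a \<le> p" "p \<le> q" "q \<le> b" and R: "8 * R ^ 3 < lam" "R \<ge> 1"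
    and \<rho>: "0 \<le> \<rho>" "\<And>v. (\<forall>i. v $ i \<in> \<int>) \<Longrightarrow> v \<noteq> 0 \<Longrightarrow> norm (integral {p..q} (wave v)) \<le> \<rho> * (q - p)"
  defines "E \<equiv> lattice_circle lam"
  shows "((1 - \<rho>) * (q - p) - decay / sqrt R * card E) * (\<Sum>\<xi>\<in>E. (norm (x \<xi>))\<^sup>2)
    \<le> integral {p..q} (\<lambda>t. (norm (trig_sum E x t))\<^sup>2)"
proof -
  have fin: "finite E" unfolding E_def by (rule finite_lattice_circle)
  have sub: "{p..q} \<subseteq> {a..b}" using pq by auto
  define M where "M = (\<lambda>\<xi> \<eta>. if \<xi> = \<eta> then 0 else integral {p..q} (wave (\<xi> - \<eta>)))"
  let ?A = "\<Sum>\<xi>\<in>E. (norm (x \<xi>))\<^sup>2"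
  let ?I = "integral {p..q} (\<lambda>t. (norm (trig_sum E x t))\<^sup>2)"
  have "complex_of_real ?I = (\<Sum>\<xi>\<in>E. \<Sum>\<eta>\<in>E. x \<xi> * cnj (x \<eta>) * integral {p..q} (wave (\<xi> - \<eta>)))"
    unfolding trig_sum_def E_def
    by (subst integral_norm_sq_sum[OF finite_lattice_circle])
      (auto simp: wave_mult_cnj intro!: continuous_on_wave sub)
  also have "\<dots> = (\<Sum>\<xi>\<in>E. \<Sum>\<eta>\<in>E. (if \<eta> = \<xi> then of_real ((norm (x \<xi>))\<^sup>2 * (q - p)) else 0) + x \<xi> * cnj (x \<eta>) * M \<xi> \<eta>)"
  proof (intro sum.cong refl)
    fix \<xi> \<eta>
    have "integral {p..q} (wave 0) = complex_of_real (q - p)"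
      using pq by (simp add: wave_0[abs_def] fun_eq_iff scaleR_conv_of_real)
    then show "x \<xi> * cnj (x \<eta>) * integral {p..q} (wave (\<xi> - \<eta>))
        = (if \<eta> = \<xi> then of_real ((norm (x \<xi>))\<^sup>2 * (q - p)) else 0) + x \<xi> * cnj (x \<eta>) * M \<xi> \<eta>"
      using complex_norm_square[of "x \<xi>"] by (auto simp: M_def simp del: of_real_diff)
  qed
  also have "\<dots> = of_real (?A * (q - p)) + (\<Sum>\<xi>\<in>E. \<Sum>\<eta>\<in>E. x \<xi> * cnj (x \<eta>) * M \<xi> \<eta>)"
    using fin by (simp add: sum.distrib sum_distrib_right)
  finally have "(\<Sum>\<xi>\<in>E. \<Sum>\<eta>\<in>E. x \<xi> * cnj (x \<eta>) * M \<xi> \<eta>) = of_real (?I - ?A * (q - p))" by simp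
  moreover have "norm (\<Sum>\<xi>\<in>E. \<Sum>\<eta>\<in>E. x \<xi> * cnj (x \<eta>) * M \<xi> \<eta>) \<le> (0 + \<rho> * (q - p) + decay / sqrt R * card E) * ?A"
    unfolding E_def
  proof (rule near_far_form_bound[OF R(1)])
    fix \<xi> \<eta> :: "real^2" assume \<xi>\<eta>: "\<xi> \<in> lattice_circle lam" "\<eta> \<in> lattice_circle lam"
    then have "\<forall>i. (\<xi> - \<eta>) $ i \<in> \<int>" by (simp add: lattice_circle_def)
    then show "norm (M \<xi> \<eta>) \<le> near_far R 0 (\<rho> * (q - p)) (decay / sqrt R) \<xi> \<eta>"
      using \<rho>(2)[of "\<xi> - \<eta>"] wave_decay[OF pq(2,1,3), of R "\<xi> - \<eta>"] R
      by (auto simp: near_far_def M_def)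
  qed (use pq R decay_pos \<rho> in auto)
  ultimately have "\<bar>?I - ?A * (q - p)\<bar> \<le> (\<rho> * (q - p) + decay / sqrt R * card E) * ?A"
    by (simp only: norm_of_real add_0)
  then show ?thesis by (simp add: algebra_simps abs_le_iff)
qed

section \<open>Second moment of window integrals\<close>

text \<open>Integrating over shifts keeps the domain independent of \<open>t\<close>, as exchanging
  the order of integration requires.\<close>

definition window :: "real \<Rightarrow> real^2 \<Rightarrow> real \<Rightarrow> complex" where
  "window h \<xi> t = integral {0..h} (\<lambda>s. wave \<xi> (t + s))"

lemma continuous_on_shifted_wave:
  assumes "a \<le> p" "q + h \<le> b"
  shows "continuous_on ({p..q} \<times> {0..h}) (\<lambda>(t, s). wave \<xi> (t + s))"
  unfolding case_prod_unfold
  by (rule continuous_on_compose2[OF continuous_on_wave[OF order_refl]])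
    (use assms in \<open>auto intro!: continuous_intros\<close>)

lemma continuous_on_window:
  assumes "a \<le> p" "q + h \<le> b"
  shows "continuous_on {p..q} (window h \<xi>)"
  unfolding window_def
  using integral_continuous_on_param[of "{p..q}" 0 h "\<lambda>t s. wave \<xi> (t + s)"] continuous_on_shifted_wave[OF assms]
  by simp

text \<open>Both windows are written as integrals over shifts \<open>s\<close> and
  \<open>s'\<close>. The last condition in \<open>far\<close> says that shifts of size at most
  \<open>h\<close> cannot undo the oscillation coming from the difference of the
  frequencies.\<close>

lemma window_far:
  assumes e: "a \<le> e" "e + h \<le> b" and h: "h \<ge> 0"
    and far: "norm (\<xi> - \<eta>) \<ge> R" "R \<ge> 1" "K * norm \<eta> * h \<le> c / 2 * R"
  shows "norm (integral {a..e} (\<lambda>t. window h \<xi> t * cnj (window h \<eta> t))) \<le> h\<^sup>2 * (decay / sqrt R)"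
proof -
  have M: "norm (integral {a..e} (\<lambda>t. cnj (wave \<eta> (t + s')) * wave \<xi> (t + s))) \<le> decay / sqrt R"
    if s: "s \<in> {0..h}" "s' \<in> {0..h}" for s s'
  proof -
    have "K * norm \<eta> * \<bar>s - s'\<bar> \<le> K * norm \<eta> * h" using s K by (intro mult_left_mono) auto
    also have "\<dots> \<le> c / 2 * R" by (rule far)
    also have "\<dots> \<le> c / 2 * norm (\<xi> - \<eta>)" using far c by (intro mult_left_mono) auto
    finally have "norm (integral {a..e} (\<lambda>t. cis (\<xi> \<bullet> g (t + s) - \<eta> \<bullet> g (t + s')))) \<le> decay / sqrt (norm (\<xi> - \<eta>))"
      using s e far by (intro shifted_oscillation) auto
    also have "\<dots> \<le> decay / sqrt R"
      using far decay_pos by (intro divide_left_mono) (auto intro!: mult_pos_pos)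
    finally show ?thesis by (simp add: wave_def cis_cnj cis_mult)
  qed
  have c1: "continuous_on {a..e} (\<lambda>t. cnj (wave \<eta> (t + s)))" if "s \<in> {0..h}" for s
    by (intro continuous_intros continuous_on_compose2[OF continuous_on_wave[OF order_refl]]) (use that e in auto)
  have *: "norm (integral {a..e} (\<lambda>t. cnj (wave \<eta> (t + s')) * window h \<xi> t)) \<le> h * (decay / sqrt R)"
    if "s' \<in> {0..h}" for s'
    unfolding window_def
    by (rule norm_integral_swap_le[OF e(1) h c1[OF that] continuous_on_shifted_wave])
      (use e M that in auto)
  have "norm (integral {a..e} (\<lambda>t. window h \<xi> t * integral {0..h} (\<lambda>s. cnj (wave \<eta> (t + s))))) \<le> h * (h * (decay / sqrt R))"
  proof (rule norm_integral_swap_le[OF e(1) h continuous_on_window])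
    show "continuous_on ({a..e} \<times> {0..h}) (\<lambda>(t, s). cnj (wave \<eta> (t + s)))"
      using continuous_on_cnj[OF continuous_on_shifted_wave[of a e h \<eta>]] e by (simp add: case_prod_unfold)
  qed (use e * in \<open>auto simp: mult.commute\<close>)
  then show ?thesis by (simp add: window_def integral_cnj power2_eq_square)
qed

text \<open>A near pair is at most the mean of two diagonal terms, a far pair is small by
  oscillation in \<open>t\<close>. So the near-far splitting applies with
  \<open>window_const * (h / lam)\<close> in the role of the interval length.\<close>

lemma window_L2:
  assumes e: "a \<le> e" "e + h \<le> b" and h: "h > 0"
    and lam: "1 \<le> lam * h" "c * lam * h\<^sup>2 \<le> 3" "lam > 0"
    and R: "8 * R ^ 3 < lam" "R \<ge> 1" "K * lam * h \<le> c / 2 * R"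
  defines "E \<equiv> lattice_circle lam"
  shows "integral {a..e} (\<lambda>t. (norm (integral {t..t + h} (trig_sum E x)))\<^sup>2)
    \<le> (2 * window_const * (h / lam) + h\<^sup>2 * (decay / sqrt R) * card E) * (\<Sum>\<xi>\<in>E. (norm (x \<xi>))\<^sup>2)"
proof -
  let ?D = "window_const * (h / lam)"
  have fin: "finite E" unfolding E_def by (rule finite_lattice_circle)
  have cont: "continuous_on {a..e} (window h \<xi>)" for \<xi> using e by (intro continuous_on_window) auto
  have win: "window h \<xi> t = integral {t..t + h} (\<lambda>s. cis (\<xi> \<bullet> g s))" if "t \<in> {a..e}" for \<xi> t
    using integral_window_shift[of t h "wave \<xi>"] by (simp add: window_def wave_def[abs_def])
  have diag: "integral {a..e} (\<lambda>t. (norm (window h \<xi> t))\<^sup>2) \<le> ?D" if "\<xi> \<in> E" for \<xi>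
  proof -
    have "(\<lambda>t. (norm (window h \<xi> t))\<^sup>2) integrable_on {a..e}"
      by (intro integrable_continuous_real continuous_intros cont)
    moreover have "(\<lambda>t. (norm (integral {t..t + h} (\<lambda>s. cis (\<xi> \<bullet> g s))))\<^sup>2) integrable_on {a..e}
        \<longleftrightarrow> (\<lambda>t. (norm (window h \<xi> t))\<^sup>2) integrable_on {a..e}"
      "integral {a..e} (\<lambda>t. (norm (integral {t..t + h} (\<lambda>s. cis (\<xi> \<bullet> g s))))\<^sup>2)
        = integral {a..e} (\<lambda>t. (norm (window h \<xi> t))\<^sup>2)"
      by (intro integrable_cong integral_cong; simp add: win)+
    ultimately show ?thesis
      using window_square_integral[OF e h _ lam, of \<xi>] that by (simp add: E_def lattice_circle_def)
  qed
  have avg: "(u + v) / 2 \<le> d" if "u \<le> d" "v \<le> d" for u v d :: real using that by simp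
  have near: "norm (integral {a..e} (\<lambda>t. window h \<xi> t * cnj (window h \<eta> t))) \<le> ?D" if "\<xi> \<in> E" "\<eta> \<in> E" for \<xi> \<eta>
  proof -
    have "norm (integral {a..e} (\<lambda>t. window h \<xi> t * cnj (window h \<eta> t)))
        \<le> integral {a..e} (\<lambda>t. ((norm (window h \<xi> t))\<^sup>2 + (norm (window h \<eta> t))\<^sup>2) / 2)"
    proof (rule integral_norm_bound_integral)
      show "norm (window h \<xi> t * cnj (window h \<eta> t)) \<le> ((norm (window h \<xi> t))\<^sup>2 + (norm (window h \<eta> t))\<^sup>2) / 2" for t
        using sum_squares_bound[of "norm (window h \<xi> t)" "norm (window h \<eta> t)"] by (simp add: norm_mult)
    qed (intro integrable_continuous_real continuous_intros cont; simp)+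
    also have "\<dots> = (integral {a..e} (\<lambda>t. (norm (window h \<xi> t))\<^sup>2) + integral {a..e} (\<lambda>t. (norm (window h \<eta> t))\<^sup>2)) / 2"
      unfolding integral_divide
      by (subst integral_add) (auto intro!: integrable_continuous_real continuous_intros cont)
    also have "\<dots> \<le> ?D" by (rule avg[OF diag[OF that(1)] diag[OF that(2)]])
    finally show ?thesis .
  qed
  have D0: "?D \<ge> 0"
    using c ab h lam by (auto simp: window_const_def intro!: mult_nonneg_nonneg add_nonneg_nonneg)
  have sum: "integral {t..t + h} (trig_sum E x) = (\<Sum>\<xi>\<in>E. x \<xi> * window h \<xi> t)" if "t \<in> {a..e}" for t
  proof -
    have "(\<lambda>s. x \<xi> * wave \<xi> s) integrable_on {t..t + h}" for \<xi>
      by (intro integrable_continuous_real continuous_intros continuous_on_wave) (use that e in auto)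
    then show ?thesis unfolding trig_sum_def win[OF that] wave_def[symmetric]
      by (subst integral_sum[OF fin]) auto
  qed
  have "integral {a..e} (\<lambda>t. (norm (integral {t..t + h} (trig_sum E x)))\<^sup>2)
      = integral {a..e} (\<lambda>t. (norm (\<Sum>\<xi>\<in>E. x \<xi> * window h \<xi> t))\<^sup>2)"
    by (rule integral_cong) (simp add: sum)
  also have "\<dots> \<le> norm (complex_of_real (integral {a..e} (\<lambda>t. (norm (\<Sum>\<xi>\<in>E. x \<xi> * window h \<xi> t))\<^sup>2)))"
    unfolding norm_of_real by (rule abs_ge_self)
  also have "\<dots> = norm (\<Sum>\<xi>\<in>E. \<Sum>\<eta>\<in>E. x \<xi> * cnj (x \<eta>) * integral {a..e} (\<lambda>t. window h \<xi> t * cnj (window h \<eta> t)))"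
    by (subst integral_norm_sq_sum[OF fin cont]) (rule refl)
  also have "\<dots> \<le> (?D + ?D + h\<^sup>2 * (decay / sqrt R) * card E) * (\<Sum>\<xi>\<in>E. (norm (x \<xi>))\<^sup>2)"
    unfolding E_def
  proof (rule near_far_form_bound[OF R(1)])
    fix \<xi> \<eta> :: "real^2" assume \<xi>\<eta>: "\<xi> \<in> lattice_circle lam" "\<eta> \<in> lattice_circle lam"
    have "norm (integral {a..e} (\<lambda>t. window h \<xi> t * cnj (window h \<eta> t))) \<le> h\<^sup>2 * (decay / sqrt R)"
      if "norm (\<xi> - \<eta>) > R"
      using window_far[OF e, where \<xi> = \<xi> and \<eta> = \<eta> and R = R] that h R \<xi>\<eta> by (simp add: lattice_circle_def)
    then show "norm (integral {a..e} (\<lambda>t. window h \<xi> t * cnj (window h \<eta> t)))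
        \<le> near_far R ?D ?D (h\<^sup>2 * (decay / sqrt R)) \<xi> \<eta>"
      using near \<xi>\<eta> by (auto simp: near_far_def E_def)
  qed (use R decay_pos D0 in auto)
  also have "?D + ?D = 2 * window_const * (h / lam)" by simp
  finally show ?thesis .
qed

end

section \<open>The fourth moment\<close>

lemma sum_inverse_sqrt_le: "(\<Sum>k=1..n. 1 / sqrt (real k)) \<le> 2 * sqrt (real n)"
proof (induction n)
  case (Suc n)
  define s where "s = sqrt (real n)"
  define t where "t = sqrt (real (Suc n))"
  have st: "0 \<le> s" "s \<le> t" "t > 0" "t\<^sup>2 = s\<^sup>2 + 1" by (simp_all add: s_def t_def)
  have "2 * s * t + 1 \<le> 2 * t\<^sup>2"
    using st sum_squares_bound[of s t] by simp
  then have "2 * s + 1 / t \<le> 2 * t" using st(3) by (simp add: field_simps power2_eq_square)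
  then show ?case using Suc by (simp add: s_def t_def)
qed simp

text \<open>The truncated weight \<open>min 1 (r / sqrt (p * q))\<close>, written so that \<open>p * q = 0\<close> gives \<open>1\<close>.\<close>

definition chord_weight :: "real \<Rightarrow> real \<Rightarrow> real \<Rightarrow> real" where
  "chord_weight r p q = 1 / max 1 (sqrt (p * q) / r)"

lemma chord_weight_nonneg: "0 \<le> chord_weight r p q"
  by (simp add: chord_weight_def)

text \<open>Blocks of length \<open>r\<close> at distance about \<open>j * r\<close> from
  \<open>x\<close> hold at most \<open>2 * B\<close> points, \<open>B\<close> on each side. With
  \<open>y = Q / r\<close> the weight there is at most \<open>1 / sqrt (j * y)\<close> and only
  about \<open>y\<close> blocks occur, so the sum over blocks is bounded independently of
  \<open>y\<close>; the restriction to \<open>Q + r\<close> is what makes this work.\<close>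

lemma sum_chord_weight_le:
  fixes u :: "'a \<Rightarrow> real"
  assumes fin: "finite S" and r: "r > 0" and Q: "Q \<ge> 0"
    and count: "\<And>x. card {\<eta> \<in> S. x \<le> u \<eta> \<and> u \<eta> \<le> x + r} \<le> B"
  shows "(\<Sum>\<eta> | \<eta> \<in> S \<and> \<bar>u \<eta> - x\<bar> \<le> Q + r. chord_weight r \<bar>u \<eta> - x\<bar> Q) \<le> 8 * real B"
proof -
  define k where "k = (\<lambda>\<eta>. nat \<lfloor>\<bar>u \<eta> - x\<bar> / r\<rfloor>)"
  define T where "T = {\<eta>. \<eta> \<in> S \<and> \<bar>u \<eta> - x\<bar> \<le> Q + r}"
  define y where "y = Q / r"
  \<comment> \<open>The additional block pays for the slack \<open>r\<close> in the range of
    \<open>\<bar>u \<eta> - x\<bar>\<close>.\<close>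
  define n where "n = nat \<lfloor>y\<rfloor> + 1"
  have y: "y \<ge> 0" using Q r by (simp add: y_def)
  have finT: "finite T" using fin by (simp add: T_def)
  have k: "real (k \<eta>) * r \<le> \<bar>u \<eta> - x\<bar>" "\<bar>u \<eta> - x\<bar> \<le> real (k \<eta>) * r + r" for \<eta>
  proof -
    have "real (k \<eta>) = of_int \<lfloor>\<bar>u \<eta> - x\<bar> / r\<rfloor>" using r by (simp add: k_def)
    then have "real (k \<eta>) \<le> \<bar>u \<eta> - x\<bar> / r" "\<bar>u \<eta> - x\<bar> / r \<le> real (k \<eta>) + 1" by linarith+
    then show "real (k \<eta>) * r \<le> \<bar>u \<eta> - x\<bar>" "\<bar>u \<eta> - x\<bar> \<le> real (k \<eta>) * r + r"
      using r by (simp_all add: field_simps)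
  qed
  have kn: "k ` T \<subseteq> {0..n}"
  proof
    fix j assume "j \<in> k ` T"
    then obtain \<eta> where \<eta>: "\<eta> \<in> T" "j = k \<eta>" by blast
    have "\<bar>u \<eta> - x\<bar> / r \<le> y + 1" using \<eta> r by (simp add: T_def y_def field_simps)
    then have "\<lfloor>\<bar>u \<eta> - x\<bar> / r\<rfloor> \<le> \<lfloor>y\<rfloor> + 1" by linarith
    then show "j \<in> {0..n}" using \<eta> y by (simp add: k_def n_def)
  qed
  have fiber: "card {\<eta> \<in> T. k \<eta> = j} \<le> 2 * B" for j
  proof -
    let ?A = "{\<eta> \<in> S. x + real j * r \<le> u \<eta> \<and> u \<eta> \<le> (x + real j * r) + r}"
    let ?A' = "{\<eta> \<in> S. x - real j * r - r \<le> u \<eta> \<and> u \<eta> \<le> (x - real j * r - r) + r}"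
    have "{\<eta> \<in> T. k \<eta> = j} \<subseteq> ?A \<union> ?A'"
    proof
      fix \<eta> assume "\<eta> \<in> {\<eta> \<in> T. k \<eta> = j}"
      then have *: "\<eta> \<in> S" "real j * r \<le> \<bar>u \<eta> - x\<bar>" "\<bar>u \<eta> - x\<bar> \<le> real j * r + r"
        using k[of \<eta>] by (auto simp: T_def)
      show "\<eta> \<in> ?A \<union> ?A'"
      proof (cases "u \<eta> \<ge> x")
        case True
        then have "\<bar>u \<eta> - x\<bar> = u \<eta> - x" by simp
        then show ?thesis using * by auto
      next
        case False
        then have "\<bar>u \<eta> - x\<bar> = x - u \<eta>" by simp
        then show ?thesis using * by auto
      qed
    qed
    then have "card {\<eta> \<in> T. k \<eta> = j} \<le> card (?A \<union> ?A')" using fin by (intro card_mono) auto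
    also have "\<dots> \<le> card ?A + card ?A'" by (rule card_Un_le)
    also have "\<dots> \<le> B + B" by (intro add_mono count)
    finally show ?thesis by simp
  qed
  define \<psi> where "\<psi> = (\<lambda>j. 1 / max 1 (sqrt (real j * y)))"
  have term_le: "chord_weight r \<bar>u \<eta> - x\<bar> Q \<le> \<psi> (k \<eta>)" for \<eta>
  proof -
    have "sqrt (real (k \<eta>) * y) = sqrt (real (k \<eta>) * r * Q) / r"
      using r by (simp add: y_def real_sqrt_mult real_sqrt_divide field_simps)
    also have "\<dots> \<le> sqrt (\<bar>u \<eta> - x\<bar> * Q) / r"
      using k(1)[of \<eta>] Q r by (intro divide_right_mono real_sqrt_le_mono mult_right_mono) auto
    finally show ?thesis unfolding chord_weight_def \<psi>_def by (intro divide_left_mono) auto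
  qed
  have "(\<Sum>\<eta>\<in>T. chord_weight r \<bar>u \<eta> - x\<bar> Q) \<le> (\<Sum>\<eta>\<in>T. \<psi> (k \<eta>))" by (intro sum_mono term_le)
  also have "\<dots> = (\<Sum>j\<in>{0..n}. \<Sum>\<eta> | \<eta> \<in> T \<and> k \<eta> = j. \<psi> (k \<eta>))"
    by (rule sum.group[symmetric]) (use finT kn in auto)
  also have "\<dots> = (\<Sum>j\<in>{0..n}. real (card {\<eta> \<in> T. k \<eta> = j}) * \<psi> j)"
    by (intro sum.cong refl) simp
  also have "\<dots> \<le> (\<Sum>j\<in>{0..n}. real (2 * B) * \<psi> j)"
    using fiber by (intro sum_mono mult_right_mono) (auto simp: \<psi>_def simp del: of_nat_mult)
  also have "\<dots> = real (2 * B) * (\<Sum>j\<in>{0..n}. \<psi> j)" by (simp only: sum_distrib_left)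
  also have "\<dots> \<le> real (2 * B) * 4"
  proof (rule mult_left_mono)
    \<comment> \<open>Block 0 contributes 1 and all others at most 3; with two sides this is 8 = 2 *
      4.\<close>
    have "(\<Sum>j\<in>{0..n}. \<psi> j) = \<psi> 0 + (\<Sum>j=1..n. \<psi> j)" by (simp add: sum.atLeast_Suc_atMost)
    moreover have "\<psi> 0 = 1" by (simp add: \<psi>_def)
    moreover have "(\<Sum>j=1..n. \<psi> j) \<le> 3"
    proof (cases "y < 1")
      case True
      then have "n = 1" using y by (simp add: n_def floor_eq_iff)
      moreover have "\<psi> 1 \<le> 1" by (simp add: \<psi>_def)
      ultimately show ?thesis by simp
    next
      case False
      have "(\<Sum>j=1..n. \<psi> j) \<le> (\<Sum>j=1..n. 1 / sqrt (real j) * (1 / sqrt y))"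
        using False by (intro sum_mono) (auto simp: \<psi>_def real_sqrt_mult intro!: divide_left_mono)
      also have "\<dots> = (\<Sum>j=1..n. 1 / sqrt (real j)) * (1 / sqrt y)" by (simp only: sum_distrib_right)
      also have "\<dots> \<le> 2 * sqrt (real n) * (1 / sqrt y)"
        using False by (intro mult_right_mono sum_inverse_sqrt_le) auto
      also have "\<dots> \<le> 2 * (3/2 * sqrt y) * (1 / sqrt y)"
      proof (intro mult_right_mono mult_left_mono)
        have "real n \<le> y + 1" using y by (simp add: n_def)
        moreover have "y + 1 \<le> 2 * y" using False by simp
        ultimately have "real n \<le> 9/4 * y" using y by simp
        then have "sqrt (real n) \<le> sqrt (9/4 * y)" by (rule real_sqrt_le_mono)
        then show "sqrt (real n) \<le> 3/2 * sqrt y" by (simp add: real_sqrt_mult real_sqrt_divide)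
      qed (use False in auto)
      finally show ?thesis using False by simp
    qed
    ultimately show "(\<Sum>j\<in>{0..n}. \<psi> j) \<le> 4" by simp
  qed simp
  finally show ?thesis by (simp add: T_def)
qed

section \<open>Almost closed quadruples of lattice points in an octant\<close>

text \<open>Coordinates in which all chords of an octant of the circle have slope between -1 and 0
  over the \<open>u\<close> axis, so that distances and inner products of chords are governed by
  differences of \<open>u\<close>.\<close>

locale sector =
  fixes u w :: "real^2 \<Rightarrow> real" and S :: "(real^2) set" and lam :: real
  assumes lin: "linear u" "linear w" and iso: "\<And>x. (norm x)\<^sup>2 = (u x)\<^sup>2 + (w x)\<^sup>2"
    and S: "S \<subseteq> lattice_circle lam" and oct: "\<And>x. x \<in> S \<Longrightarrow> 0 \<le> u x \<and> u x \<le> w x" and lam: "lam > 0"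
begin

lemma finite_S: "finite S"
  using S finite_lattice_circle by (rule finite_subset)

lemma circle: "x \<in> S \<Longrightarrow> (u x)\<^sup>2 + (w x)\<^sup>2 = lam\<^sup>2"
  using iso[of x] S by (auto simp: lattice_circle_def)

lemma w_pos: assumes "x \<in> S" shows "w x > 0"
proof (rule ccontr)
  assume "\<not> ?thesis"
  then have "w x = 0" "u x = 0" using oct[OF assms] by auto
  then show False using circle[OF assms] lam by simp
qed

lemma slope:
  assumes "x \<in> S" "y \<in> S"
  obtains \<alpha> where "0 \<le> \<alpha>" "\<alpha> \<le> 1" "w x - w y = - \<alpha> * (u x - u y)"
proof (rule that[of "(u x + u y) / (w x + w y)"])
  have pos: "w x + w y > 0" using w_pos assms by (simp add: add_pos_pos)
  show "0 \<le> (u x + u y) / (w x + w y)" "(u x + u y) / (w x + w y) \<le> 1"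
    using oct[OF assms(1)] oct[OF assms(2)] pos by (auto simp: divide_le_eq)
  have "(w x - w y) * (w x + w y) = - ((u x + u y) * (u x - u y))"
    using circle[OF assms(1)] circle[OF assms(2)] by (simp add: algebra_simps power2_eq_square)
  then show "w x - w y = - ((u x + u y) / (w x + w y)) * (u x - u y)"
    using pos by (simp add: field_simps)
qed

lemma abs_u_le: "\<bar>u x\<bar> \<le> norm x"
  using iso[of x] abs_le_square_iff[of "u x" "norm x"] by simp

text \<open>If \<open>x1 + x2 = x3 + x4\<close>, then \<open>x3 + x4 - x1\<close> lies on the
  circle. In general its squared norm differs from \<open>lam^2\<close> by twice the inner product
  of \<open>x1 - x3\<close> and \<open>x1 - x4\<close>. Both chords have slope of the same sign, so
  in absolute value this is at least twice the product of their \<open>u\<close>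
  differences.\<close>

lemma near_parallelogram:
  assumes "x1 \<in> S" "x2 \<in> S" "x3 \<in> S" "x4 \<in> S"
  shows "\<bar>u x1 - u x3\<bar> * \<bar>u x1 - u x4\<bar> \<le> 2 * lam * norm (x1 + x2 - x3 - x4)"
proof -
  define V where "V = x1 + x2 - x3 - x4"
  obtain \<alpha> where \<alpha>: "0 \<le> \<alpha>" "w x1 - w x3 = - \<alpha> * (u x1 - u x3)" using slope[OF assms(1,3)] by blast
  obtain \<beta> where \<beta>: "0 \<le> \<beta>" "w x1 - w x4 = - \<beta> * (u x1 - u x4)" using slope[OF assms(1,4)] by blast
  let ?n = "norm (x3 + x4 - x1)"
  have norms: "norm x1 = lam" "norm x2 = lam" "norm x3 = lam" "norm x4 = lam"
    using assms S by (auto simp: lattice_circle_def)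
  have "?n\<^sup>2 - lam\<^sup>2 = (u x3 + u x4 - u x1)\<^sup>2 + (w x3 + w x4 - w x1)\<^sup>2 - lam\<^sup>2"
    unfolding iso by (simp add: linear_add[OF lin(1)] linear_add[OF lin(2)] linear_diff[OF lin(1)] linear_diff[OF lin(2)])
  also have "\<dots> = 2 * ((u x1 - u x3) * (u x1 - u x4) + (w x1 - w x3) * (w x1 - w x4))"
    using circle[OF assms(1)] circle[OF assms(3)] circle[OF assms(4)]
    by (simp add: algebra_simps power2_eq_square)
  also have "\<dots> = 2 * (1 + \<alpha> * \<beta>) * ((u x1 - u x3) * (u x1 - u x4))"
    unfolding \<alpha> \<beta> by (simp add: algebra_simps)
  finally have eq: "?n\<^sup>2 - lam\<^sup>2 = 2 * (1 + \<alpha> * \<beta>) * ((u x1 - u x3) * (u x1 - u x4))" .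
  have "2 * (\<bar>u x1 - u x3\<bar> * \<bar>u x1 - u x4\<bar>) = 2 * 1 * \<bar>(u x1 - u x3) * (u x1 - u x4)\<bar>"
    by (simp add: abs_mult)
  also have "\<dots> \<le> 2 * (1 + \<alpha> * \<beta>) * \<bar>(u x1 - u x3) * (u x1 - u x4)\<bar>"
    using \<alpha>(1) \<beta>(1) by (intro mult_right_mono mult_left_mono) auto
  also have "\<dots> = \<bar>?n\<^sup>2 - lam\<^sup>2\<bar>" unfolding eq using \<alpha>(1) \<beta>(1) by (simp add: abs_mult)
  also have "\<dots> = \<bar>?n - lam\<bar> * (?n + lam)"
    using lam by (simp add: power2_eq_square square_diff_square_factored abs_mult mult.commute)
  also have "\<dots> \<le> norm V * (4 * lam)"
  proof (rule mult_mono)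
    have "x3 + x4 - x1 = x2 - V" by (simp add: V_def)
    then show "\<bar>?n - lam\<bar> \<le> norm V"
      using norm_triangle_ineq3[of "x2 - V" x2] norms by simp
    have "?n \<le> norm x3 + norm x4 + norm x1"
      using norm_triangle_ineq4[of "x3 + x4" x1] norm_triangle_ineq[of x3 x4] by simp
    then show "?n + lam \<le> 4 * lam" using norms by simp
  qed (use lam in auto)
  finally show ?thesis by (simp add: V_def mult_ac)
qed

text \<open>Since slopes are at most 1 in size, both coordinates vary by at most
  \<open>sqrt lam / 2\<close>, which keeps the diameter below \<open>sqrt lam\<close>.\<close>

lemma short_interval_count: "card {x \<in> S. y \<le> u x \<and> u x \<le> y + sqrt lam / 2} \<le> B_max lam"
proof (rule card_le_B_max)
  fix x x' assume x: "x \<in> {x \<in> S. y \<le> u x \<and> u x \<le> y + sqrt lam / 2}" "x' \<in> {x \<in> S. y \<le> u x \<and> u x \<le> y + sqrt lam / 2}"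
  then obtain \<alpha> where \<alpha>: "0 \<le> \<alpha>" "\<alpha> \<le> 1" "w x - w x' = - \<alpha> * (u x - u x')" using slope[of x x'] by blast
  have "\<bar>p - q\<bar> \<le> r" if "y \<le> p" "p \<le> y + r" "y \<le> q" "q \<le> y + r" for p q r :: real
    using that by linarith
  then have du: "\<bar>u x - u x'\<bar> \<le> sqrt lam / 2" using x by blast
  have "\<bar>w x - w x'\<bar> \<le> 1 * \<bar>u x - u x'\<bar>" unfolding \<alpha> abs_mult using \<alpha> by (intro mult_right_mono) auto
  then have dw: "\<bar>w x - w x'\<bar> \<le> sqrt lam / 2" using du by simp
  have "(norm (x - x'))\<^sup>2 = (u x - u x')\<^sup>2 + (w x - w x')\<^sup>2"
    unfolding iso by (simp add: linear_diff[OF lin(1)] linear_diff[OF lin(2)])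
  also have "\<dots> \<le> (sqrt lam / 2)\<^sup>2 + (sqrt lam / 2)\<^sup>2"
    by (intro add_mono abs_le_square_iff[THEN iffD1]) (use du dw lam in auto)
  also have "\<dots> \<le> (sqrt lam)\<^sup>2" using lam by (simp add: power_divide)
  finally show "norm (x - x') \<le> sqrt lam" by (rule power2_le_imp_le) (use lam in simp)
qed (use S in auto)

text \<open>Models the decay of the oscillatory integral that a quadruple produces in the fourth
  moment. Requiring \<open>x1 x3\<close> to be the shorter chord at \<open>x1\<close> picks one of
  two labellings and tells which variables to sum first.\<close>

definition quad_weight :: "real \<Rightarrow> real^2 \<Rightarrow> real^2 \<Rightarrow> real^2 \<Rightarrow> real^2 \<Rightarrow> real" where
  "quad_weight R x1 x2 x3 x4 = (if norm (x1 + x2 - x3 - x4) \<le> R \<and> \<bar>u x1 - u x3\<bar> \<le> \<bar>u x1 - u x4\<bar>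
     then 1 / max 1 (sqrt (norm (x1 + x2 - x3 - x4))) else 0)"

text \<open>By \<open>near_parallelogram\<close> the frequency is at least the chord product over
  \<open>2 * lam\<close>. Measured in the unit \<open>sqrt lam / 2\<close> this costs
  \<open>sqrt 8\<close>, rounded up to 3.\<close>

lemma inverse_sqrt_le_chord_weight:
  assumes "x1 \<in> S" "x2 \<in> S" "x3 \<in> S" "x4 \<in> S"
  shows "1 / max 1 (sqrt (norm (x1 + x2 - x3 - x4)))
    \<le> 3 * chord_weight (sqrt lam / 2) \<bar>u x1 - u x3\<bar> \<bar>u x1 - u x4\<bar>"
proof -
  let ?V = "norm (x1 + x2 - x3 - x4)" and ?pq = "\<bar>u x1 - u x3\<bar> * \<bar>u x1 - u x4\<bar>"
  have "sqrt ?pq / (sqrt lam / 2) \<le> sqrt (2 * lam * ?V) / (sqrt lam / 2)"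
    using near_parallelogram[OF assms] lam by (intro divide_right_mono real_sqrt_le_mono) auto
  also have "\<dots> = sqrt (8 * ?V)"
  proof -
    have "sqrt (2 * lam * ?V) / (sqrt lam / 2) = 2 * sqrt 2 * sqrt ?V" using lam by (simp add: real_sqrt_mult)
    also have "\<dots> = sqrt (2\<^sup>2 * 2 * ?V)" by (simp only: real_sqrt_mult real_sqrt_abs abs_numeral)
    finally show ?thesis by simp
  qed
  also have "\<dots> \<le> sqrt (9 * ?V)" by (intro real_sqrt_le_mono) simp
  also have "\<dots> = 3 * sqrt ?V" by (simp add: real_sqrt_mult)
  finally have le: "sqrt ?pq / (sqrt lam / 2) \<le> 3 * sqrt ?V" .
  have "max 1 p \<le> 3 * max 1 q" if "p \<le> 3 * q" for p q :: real using that by (auto simp: max_def)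
  from this[OF le] have "max 1 (sqrt ?pq / (sqrt lam / 2)) \<le> 3 * max 1 (sqrt ?V)" .
  then show ?thesis unfolding chord_weight_def by (simp add: field_simps)
qed

text \<open>Given \<open>y\<close>, almost closing pins \<open>x\<close> to a disc of radius
  \<open>R\<close> around \<open>p y\<close>, which holds at most two lattice points of the circle;
  the sum over \<open>y\<close> is a chord sum. Hence 48 = 2 * 3 * 8.\<close>

lemma chord_pair_sum:
  assumes R: "8 * R ^ 3 < lam" and Q: "Q \<ge> 0"
    and F: "\<And>y x. y \<in> S \<Longrightarrow> x \<in> S \<Longrightarrow> F y x
      \<le> (if norm (x - p y) \<le> R \<and> \<bar>u y - v\<bar> \<le> Q + sqrt lam / 2 then 3 * chord_weight (sqrt lam / 2) \<bar>u y - v\<bar> Q else 0)"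
  shows "(\<Sum>y\<in>S. \<Sum>x\<in>S. F y x) \<le> 48 * real (B_max lam)"
proof -
  let ?r = "sqrt lam / 2"
  let ?T = "{y. y \<in> S \<and> \<bar>u y - v\<bar> \<le> Q + ?r}"
  have "(\<Sum>x\<in>S. F y x) \<le> (if y \<in> ?T then 6 * chord_weight ?r \<bar>u y - v\<bar> Q else 0)" if y: "y \<in> S" for y
  proof -
    let ?k = "if y \<in> ?T then 3 * chord_weight ?r \<bar>u y - v\<bar> Q else 0"
    have "(\<Sum>x\<in>S. F y x) \<le> (\<Sum>x\<in>S. if x \<in> {x. norm (x - p y) \<le> R} then ?k else 0)"
      by (rule sum_mono, rule order_trans[OF F[OF y]]) (use y in auto)
    also have "\<dots> = (\<Sum>x\<in>S \<inter> {x. norm (x - p y) \<le> R}. ?k)"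
      by (rule sum.inter_restrict[OF finite_S, symmetric])
    also have "\<dots> = real (card (S \<inter> {x. norm (x - p y) \<le> R})) * ?k" by simp
    also have "\<dots> \<le> 2 * ?k"
    proof (rule mult_right_mono)
      have "card (S \<inter> {x. norm (x - p y) \<le> R}) \<le> card {x \<in> lattice_circle lam. norm (x - p y) \<le> R}"
        using S by (intro card_mono) (auto simp: finite_lattice_circle)
      also have "\<dots> \<le> 2" by (rule card_lattice_circle_ball_le_2[OF R])
      finally show "real (card (S \<inter> {x. norm (x - p y) \<le> R})) \<le> 2" by simp
    qed (simp add: chord_weight_nonneg)
    finally show ?thesis by (auto split: if_splits)
  qed
  then have "(\<Sum>y\<in>S. \<Sum>x\<in>S. F y x) \<le> (\<Sum>y\<in>S. if y \<in> ?T then 6 * chord_weight ?r \<bar>u y - v\<bar> Q else 0)"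
    by (rule sum_mono)
  also have "\<dots> = (\<Sum>y\<in>S \<inter> ?T. 6 * chord_weight ?r \<bar>u y - v\<bar> Q)"
    by (rule sum.inter_restrict[OF finite_S, symmetric])
  also have "S \<inter> ?T = ?T" by blast
  also have "(\<Sum>y\<in>?T. 6 * chord_weight ?r \<bar>u y - v\<bar> Q) = 6 * (\<Sum>y\<in>?T. chord_weight ?r \<bar>u y - v\<bar> Q)"
    by (simp only: sum_distrib_left)
  also have "\<dots> \<le> 6 * (8 * real (B_max lam))"
    using lam Q by (intro mult_left_mono sum_chord_weight_le finite_S short_interval_count) auto
  finally show ?thesis by simp
qed

text \<open>With the long chord \<open>x1 x4\<close> fixed, \<open>x3\<close> stays within its
  \<open>u\<close> extent around \<open>x1\<close>, and \<open>x2\<close> is then determined up to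
  two choices.\<close>

lemma quad_weight_row:
  assumes R: "8 * R ^ 3 < lam" and c: "x1 \<in> S" "x4 \<in> S"
  shows "(\<Sum>x3\<in>S. \<Sum>x2\<in>S. quad_weight R x1 x2 x3 x4) \<le> 48 * real (B_max lam)"
proof (rule chord_pair_sum[OF R, where Q = "\<bar>u x1 - u x4\<bar>" and v = "u x1" and p = "\<lambda>x3. x3 + x4 - x1"])
  fix x3 x2 assume x: "x3 \<in> S" "x2 \<in> S"
  let ?r = "sqrt lam / 2" and ?Q = "\<bar>u x1 - u x4\<bar>"
  have V: "x2 - (x3 + x4 - x1) = x1 + x2 - x3 - x4" by simp
  have "\<bar>u x1 - u x3\<bar> \<le> ?Q \<Longrightarrow> \<bar>u x3 - u x1\<bar> \<le> ?Q + ?r" using lam by (simp add: abs_minus_commute add_increasing2)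
  then show "quad_weight R x1 x2 x3 x4 \<le> (if norm (x2 - (x3 + x4 - x1)) \<le> R \<and> \<bar>u x3 - u x1\<bar> \<le> ?Q + ?r
      then 3 * chord_weight ?r \<bar>u x3 - u x1\<bar> ?Q else 0)"
    using inverse_sqrt_le_chord_weight[OF c(1) x(2,1) c(2)] chord_weight_nonneg[of ?r "\<bar>u x3 - u x1\<bar>" ?Q]
    unfolding V by (auto simp: quad_weight_def abs_minus_commute)
qed simp

text \<open>The closing side \<open>x1 - x4\<close> differs from \<open>x3 - x2\<close> by at most \<open>R\<close>, so the range of \<open>x1\<close> is
  again controlled by the fixed chord.\<close>

lemma quad_weight_column:
  assumes R: "8 * R ^ 3 < lam" "R \<le> sqrt lam / 2" and c: "x2 \<in> S" "x3 \<in> S"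
  shows "(\<Sum>x1\<in>S. \<Sum>x4\<in>S. quad_weight R x1 x2 x3 x4) \<le> 48 * real (B_max lam)"
proof (rule chord_pair_sum[OF R(1), where Q = "\<bar>u x3 - u x2\<bar>" and v = "u x3" and p = "\<lambda>x1. x1 + x2 - x3"])
  fix x1 x4 assume x: "x1 \<in> S" "x4 \<in> S"
  let ?r = "sqrt lam / 2" and ?Q = "\<bar>u x3 - u x2\<bar>"
  have V: "norm (x4 - (x1 + x2 - x3)) = norm (x1 + x2 - x3 - x4)" "norm (x3 + x4 - x1 - x2) = norm (x1 + x2 - x3 - x4)"
    using norm_minus_commute[of x4 "x1 + x2 - x3"] norm_minus_commute[of "x3 + x4" "x1 + x2"]
    by (simp_all add: algebra_simps)
  have "\<bar>u x1 - u x3\<bar> \<le> ?Q + ?r" if "norm (x1 + x2 - x3 - x4) \<le> R" "\<bar>u x1 - u x3\<bar> \<le> \<bar>u x1 - u x4\<bar>"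
  proof -
    have "u (x1 + x2 - x3 - x4) = (u x1 - u x4) - (u x3 - u x2)"
      by (simp add: linear_add[OF lin(1)] linear_diff[OF lin(1)])
    then have "\<bar>(u x1 - u x4) - (u x3 - u x2)\<bar> \<le> R"
      using abs_u_le[of "x1 + x2 - x3 - x4"] that(1) by simp
    then have "\<bar>u x1 - u x4\<bar> \<le> ?Q + R" by linarith
    then show ?thesis using that(2) R(2) by simp
  qed
  then show "quad_weight R x1 x2 x3 x4 \<le> (if norm (x4 - (x1 + x2 - x3)) \<le> R \<and> \<bar>u x1 - u x3\<bar> \<le> ?Q + ?r
      then 3 * chord_weight ?r \<bar>u x1 - u x3\<bar> ?Q else 0)"
    using inverse_sqrt_le_chord_weight[OF c(2) x(2,1) c(1)] chord_weight_nonneg[of ?r "\<bar>u x1 - u x3\<bar>" ?Q]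
    unfolding V by (auto simp: quad_weight_def abs_minus_commute)
qed simp

text \<open>The two long chords \<open>x1 x4\<close> and \<open>x2 x3\<close> are paired: summing over the short ones then loses
  no logarithm.\<close>

lemma quad_weight_sum:
  assumes R: "8 * R ^ 3 < lam" "R \<le> sqrt lam / 2"
  shows "(\<Sum>x1\<in>S. \<Sum>x2\<in>S. \<Sum>x3\<in>S. \<Sum>x4\<in>S. y x1 * y x2 * y x3 * y x4 * quad_weight R x1 x2 x3 x4)
    \<le> 48 * real (B_max lam) * (\<Sum>x\<in>S. (y x)\<^sup>2)\<^sup>2"
proof -
  let ?D = "48 * real (B_max lam)" and ?A = "\<Sum>x\<in>S. (y x)\<^sup>2"
  let ?L = "quad_weight R"
  have L0: "?L x1 x2 x3 x4 \<ge> 0" for x1 x2 x3 x4 by (simp add: quad_weight_def le_max_iff_disj)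
  have am: "y x1 * y x2 * y x3 * y x4 * l \<le> ((y x1 * y x4)\<^sup>2 * l + (y x2 * y x3)\<^sup>2 * l) / 2" if "l \<ge> 0" for x1 x2 x3 x4 l
  proof -
    have "2 * (y x1 * y x4) * (y x2 * y x3) \<le> (y x1 * y x4)\<^sup>2 + (y x2 * y x3)\<^sup>2" by (rule sum_squares_bound)
    from mult_right_mono[OF this that] show ?thesis by (simp add: algebra_simps)
  qed
  have A2: "?A\<^sup>2 = (\<Sum>x\<in>S. \<Sum>x'\<in>S. (y x * y x')\<^sup>2)"
    unfolding power2_eq_square[of ?A] sum_product by (simp add: power_mult_distrib)
  have "(\<Sum>x1\<in>S. \<Sum>x2\<in>S. \<Sum>x3\<in>S. \<Sum>x4\<in>S. y x1 * y x2 * y x3 * y x4 * ?L x1 x2 x3 x4)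
    \<le> (\<Sum>x1\<in>S. \<Sum>x2\<in>S. \<Sum>x3\<in>S. \<Sum>x4\<in>S. ((y x1 * y x4)\<^sup>2 * ?L x1 x2 x3 x4 + (y x2 * y x3)\<^sup>2 * ?L x1 x2 x3 x4) / 2)"
    by (intro sum_mono am L0)
  also have "\<dots> = ((\<Sum>x1\<in>S. \<Sum>x2\<in>S. \<Sum>x3\<in>S. \<Sum>x4\<in>S. (y x1 * y x4)\<^sup>2 * ?L x1 x2 x3 x4)
      + (\<Sum>x1\<in>S. \<Sum>x2\<in>S. \<Sum>x3\<in>S. \<Sum>x4\<in>S. (y x2 * y x3)\<^sup>2 * ?L x1 x2 x3 x4)) / 2"
    by (simp only: sum_divide_distrib[symmetric] sum.distrib)
  also have "(\<Sum>x1\<in>S. \<Sum>x2\<in>S. \<Sum>x3\<in>S. \<Sum>x4\<in>S. (y x1 * y x4)\<^sup>2 * ?L x1 x2 x3 x4) \<le> ?D * ?A\<^sup>2"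
  proof -
    have "(\<Sum>x1\<in>S. \<Sum>x2\<in>S. \<Sum>x3\<in>S. \<Sum>x4\<in>S. (y x1 * y x4)\<^sup>2 * ?L x1 x2 x3 x4)
        = (\<Sum>x1\<in>S. \<Sum>x4\<in>S. \<Sum>x3\<in>S. \<Sum>x2\<in>S. (y x1 * y x4)\<^sup>2 * ?L x1 x2 x3 x4)"
    proof (rule sum.cong[OF refl])
      fix x1 assume "x1 \<in> S"
      have "(\<Sum>x2\<in>S. \<Sum>x3\<in>S. \<Sum>x4\<in>S. F x2 x3 x4) = (\<Sum>x4\<in>S. \<Sum>x3\<in>S. \<Sum>x2\<in>S. F x2 x3 x4)" for F :: "_ \<Rightarrow> _ \<Rightarrow> _ \<Rightarrow> real"
      proof -
        have "(\<Sum>x2\<in>S. \<Sum>x3\<in>S. \<Sum>x4\<in>S. F x2 x3 x4) = (\<Sum>x2\<in>S. \<Sum>x4\<in>S. \<Sum>x3\<in>S. F x2 x3 x4)"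
          by (intro sum.cong refl sum.swap)
        also have "\<dots> = (\<Sum>x4\<in>S. \<Sum>x2\<in>S. \<Sum>x3\<in>S. F x2 x3 x4)" by (rule sum.swap)
        also have "\<dots> = (\<Sum>x4\<in>S. \<Sum>x3\<in>S. \<Sum>x2\<in>S. F x2 x3 x4)" by (intro sum.cong refl sum.swap)
        finally show ?thesis .
      qed
      then show "(\<Sum>x2\<in>S. \<Sum>x3\<in>S. \<Sum>x4\<in>S. (y x1 * y x4)\<^sup>2 * ?L x1 x2 x3 x4)
        = (\<Sum>x4\<in>S. \<Sum>x3\<in>S. \<Sum>x2\<in>S. (y x1 * y x4)\<^sup>2 * ?L x1 x2 x3 x4)" .
    qed
    also have "\<dots> = (\<Sum>x1\<in>S. \<Sum>x4\<in>S. (y x1 * y x4)\<^sup>2 * (\<Sum>x3\<in>S. \<Sum>x2\<in>S. ?L x1 x2 x3 x4))"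
      by (simp only: sum_distrib_left)
    also have "\<dots> \<le> (\<Sum>x1\<in>S. \<Sum>x4\<in>S. (y x1 * y x4)\<^sup>2 * ?D)"
      by (intro sum_mono mult_left_mono quad_weight_row R(1)) auto
    also have "\<dots> = ?D * ?A\<^sup>2" unfolding A2 by (simp only: sum_distrib_left mult.commute)
    finally show ?thesis .
  qed
  also have "(\<Sum>x1\<in>S. \<Sum>x2\<in>S. \<Sum>x3\<in>S. \<Sum>x4\<in>S. (y x2 * y x3)\<^sup>2 * ?L x1 x2 x3 x4) \<le> ?D * ?A\<^sup>2"
  proof -
    have "(\<Sum>x1\<in>S. \<Sum>x2\<in>S. \<Sum>x3\<in>S. \<Sum>x4\<in>S. (y x2 * y x3)\<^sup>2 * ?L x1 x2 x3 x4)
        = (\<Sum>x2\<in>S. \<Sum>x1\<in>S. \<Sum>x3\<in>S. \<Sum>x4\<in>S. (y x2 * y x3)\<^sup>2 * ?L x1 x2 x3 x4)" by (rule sum.swap)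
    also have "\<dots> = (\<Sum>x2\<in>S. \<Sum>x3\<in>S. \<Sum>x1\<in>S. \<Sum>x4\<in>S. (y x2 * y x3)\<^sup>2 * ?L x1 x2 x3 x4)"
      by (intro sum.cong refl sum.swap)
    also have "\<dots> = (\<Sum>x2\<in>S. \<Sum>x3\<in>S. (y x2 * y x3)\<^sup>2 * (\<Sum>x1\<in>S. \<Sum>x4\<in>S. ?L x1 x2 x3 x4))"
      by (simp only: sum_distrib_left)
    also have "\<dots> \<le> (\<Sum>x2\<in>S. \<Sum>x3\<in>S. (y x2 * y x3)\<^sup>2 * ?D)"
      by (intro sum_mono mult_left_mono quad_weight_column R) auto
    also have "\<dots> = ?D * ?A\<^sup>2" unfolding A2 by (simp only: sum_distrib_left mult.commute)
    finally show ?thesis .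
  qed
  finally show ?thesis by simp
qed

end


section \<open>Fourth moment of exponential sums along the arc\<close>

context curved_arc
begin

text \<open>Includes the trivial bound, so that frequencies of norm at most 1, among them 0, are
  covered by one formula.\<close>

definition decay_max :: real where
  "decay_max = max (b - a) decay"

lemma wave_decay_max:
  assumes "a \<le> p" "p \<le> q" "q \<le> b"
  shows "norm (integral {p..q} (wave v)) \<le> decay_max * (1 / max 1 (sqrt (norm v)))"
proof (cases "norm v \<le> 1")
  case True
  have "norm (integral {p..q} (wave v)) \<le> q - p"
    using assms by (intro norm_integral_wave_le) auto
  also have "\<dots> \<le> decay_max" using assms by (simp add: decay_max_def)
  finally show ?thesis using True by (simp add: max_absorb1)
next
  case False
  have "norm (integral {p..q} (wave v)) \<le> decay / sqrt (norm v)"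
    unfolding wave_def using assms False by (intro oscillation) auto
  also have "\<dots> \<le> decay_max / sqrt (norm v)"
    by (intro divide_right_mono) (auto simp: decay_max_def)
  finally show ?thesis using False by (simp add: max_absorb2)
qed

lemma decay_max_pos: "decay_max > 0"
  using decay_pos by (simp add: decay_max_def)

text \<open>The square of the exponential sum is an exponential sum over pairs, so its second moment
  runs over quadruples with frequency \<open>x1 + x2 - x3 - x4\<close>. Exchanging \<open>x3\<close>
  and \<open>x4\<close> if necessary makes \<open>x1 x3\<close> the shorter chord, whence 96 = 2 *
  48; quadruples with frequency beyond \<open>R\<close> gain \<open>sqrt R\<close>.\<close>

lemma L4_sector:
  assumes "sector u w S lam" and pq: "a \<le> p" "p \<le> q" "q \<le> b"
    and R: "8 * R ^ 3 < lam" "R \<le> sqrt lam / 2" "R \<ge> 1"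
  shows "integral {p..q} (\<lambda>t. norm (trig_sum S x t) ^ 4)
    \<le> (96 * decay_max * B_max lam + decay_max / sqrt R * (card S)\<^sup>2) * (\<Sum>\<xi>\<in>S. (norm (x \<xi>))\<^sup>2)\<^sup>2"
proof -
  interpret sec: sector u w S lam by fact
  note fin = sec.finite_S
  have sub: "{p..q} \<subseteq> {a..b}" using pq by auto
  let ?A = "\<Sum>\<xi>\<in>S. (norm (x \<xi>))\<^sup>2"
  let ?V = "\<lambda>x1 x2 x3 x4. norm (x1 + x2 - x3 - x4 :: real^2)"
  let ?y = "\<lambda>\<xi>. norm (x \<xi>)"
  have sq: "(trig_sum S x t)\<^sup>2 = (\<Sum>P\<in>S \<times> S. x (fst P) * x (snd P) * wave (fst P + snd P) t)" for t
    unfolding trig_sum_def power2_eq_square sum_product sum.cartesian_product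
    by (intro sum.cong refl) (auto simp: wave_def inner_add_left cis_mult[symmetric])
  have "complex_of_real (integral {p..q} (\<lambda>t. norm (trig_sum S x t) ^ 4))
      = complex_of_real (integral {p..q} (\<lambda>t. (norm (\<Sum>P\<in>S \<times> S. x (fst P) * x (snd P) * wave (fst P + snd P) t))\<^sup>2))"
    unfolding sq[symmetric] by (simp add: norm_power)
  also have "\<dots> = (\<Sum>P\<in>S \<times> S. \<Sum>P'\<in>S \<times> S. x (fst P) * x (snd P) * cnj (x (fst P') * x (snd P'))
      * integral {p..q} (wave (fst P + snd P - (fst P' + snd P'))))"
    using fin by (subst integral_norm_sq_sum) (auto simp: wave_mult_cnj intro!: continuous_on_wave sub)
  finally have eq: "complex_of_real (integral {p..q} (\<lambda>t. norm (trig_sum S x t) ^ 4))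
      = (\<Sum>P\<in>S \<times> S. \<Sum>P'\<in>S \<times> S. x (fst P) * x (snd P) * cnj (x (fst P') * x (snd P'))
      * integral {p..q} (wave (fst P + snd P - (fst P' + snd P'))))" .
  have "\<bar>integral {p..q} (\<lambda>t. norm (trig_sum S x t) ^ 4)\<bar>
      = norm (\<Sum>P\<in>S \<times> S. \<Sum>P'\<in>S \<times> S. x (fst P) * x (snd P) * cnj (x (fst P') * x (snd P'))
      * integral {p..q} (wave (fst P + snd P - (fst P' + snd P'))))"
    unfolding eq[symmetric] by (rule norm_of_real[symmetric])
  also have "\<dots> \<le> (\<Sum>P\<in>S \<times> S. \<Sum>P'\<in>S \<times> S. norm (x (fst P) * x (snd P) * cnj (x (fst P') * x (snd P'))
      * integral {p..q} (wave (fst P + snd P - (fst P' + snd P')))))"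
    by (intro order_trans[OF norm_sum] sum_mono norm_sum)
  also have "\<dots> \<le> (\<Sum>P\<in>S \<times> S. \<Sum>P'\<in>S \<times> S. ?y (fst P) * ?y (snd P) * ?y (fst P') * ?y (snd P')
      * (decay_max * (sec.quad_weight R (fst P) (snd P) (fst P') (snd P') + sec.quad_weight R (fst P) (snd P) (snd P') (fst P'))
        + decay_max / sqrt R))"
  proof (intro sum_mono)
    fix P P' :: "(real^2) \<times> (real^2)"
    obtain x1 x2 x3 x4 where P: "P = (x1, x2)" "P' = (x3, x4)" by (cases P, cases P') blast
    have v: "fst P + snd P - (fst P' + snd P') = x1 + x2 - x3 - x4" "x1 + x2 - x4 - x3 = x1 + x2 - x3 - x4"
      by (simp_all add: P algebra_simps)
    let ?w = "1 / max 1 (sqrt (?V x1 x2 x3 x4))"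
    have w0: "0 \<le> ?w" by (simp add: le_max_iff_disj)
    have q0: "0 \<le> sec.quad_weight R x1 x2 x3 x4" "0 \<le> sec.quad_weight R x1 x2 x4 x3"
      by (simp_all add: sec.quad_weight_def le_max_iff_disj)
    have "norm (integral {p..q} (wave (x1 + x2 - x3 - x4))) \<le> decay_max * ?w"
      by (rule wave_decay_max[OF pq])
    also have "\<dots> \<le> decay_max * (sec.quad_weight R x1 x2 x3 x4 + sec.quad_weight R x1 x2 x4 x3) + decay_max / sqrt R"
    proof (cases "?V x1 x2 x3 x4 \<le> R")
      case True
      have "?w \<le> sec.quad_weight R x1 x2 x3 x4 + sec.quad_weight R x1 x2 x4 x3"
      proof (cases "\<bar>u x1 - u x3\<bar> \<le> \<bar>u x1 - u x4\<bar>")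
        case True
        then have "sec.quad_weight R x1 x2 x3 x4 = ?w" using \<open>?V x1 x2 x3 x4 \<le> R\<close> by (simp add: sec.quad_weight_def)
        then show ?thesis using q0 by simp
      next
        case False
        then have "sec.quad_weight R x1 x2 x4 x3 = ?w" using \<open>?V x1 x2 x3 x4 \<le> R\<close> by (simp add: sec.quad_weight_def v(2))
        then show ?thesis using q0 by simp
      qed
      then have "decay_max * ?w \<le> decay_max * (sec.quad_weight R x1 x2 x3 x4 + sec.quad_weight R x1 x2 x4 x3)"
        using decay_max_pos by (intro mult_left_mono) auto
      then show ?thesis using decay_max_pos R by (simp add: add_increasing2)
    next
      case False
      have "?w \<le> 1 / sqrt R" using False R by (intro divide_left_mono) (auto simp: le_max_iff_disj intro!: mult_pos_pos)
      then have "decay_max * ?w \<le> decay_max * (1 / sqrt R)" using decay_max_pos by (intro mult_left_mono) auto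
      then show ?thesis using q0 decay_max_pos by (simp add: add_increasing)
    qed
    finally show "norm (x (fst P) * x (snd P) * cnj (x (fst P') * x (snd P')) * integral {p..q} (wave (fst P + snd P - (fst P' + snd P'))))
      \<le> ?y (fst P) * ?y (snd P) * ?y (fst P') * ?y (snd P')
      * (decay_max * (sec.quad_weight R (fst P) (snd P) (fst P') (snd P') + sec.quad_weight R (fst P) (snd P) (snd P') (fst P')) + decay_max / sqrt R)"
      unfolding v by (simp only: norm_mult complex_mod_cnj mult.assoc P fst_conv snd_conv) (intro mult_left_mono; simp)
  qed
  also have "\<dots> = (\<Sum>x1\<in>S. \<Sum>x2\<in>S. \<Sum>x3\<in>S. \<Sum>x4\<in>S. ?y x1 * ?y x2 * ?y x3 * ?y x4
      * (decay_max * (sec.quad_weight R x1 x2 x3 x4 + sec.quad_weight R x1 x2 x4 x3) + decay_max / sqrt R))"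
    unfolding sum.cartesian_product' by simp
  also have "\<dots> = decay_max * (\<Sum>x1\<in>S. \<Sum>x2\<in>S. \<Sum>x3\<in>S. \<Sum>x4\<in>S. ?y x1 * ?y x2 * ?y x3 * ?y x4 * sec.quad_weight R x1 x2 x3 x4)
     + decay_max * (\<Sum>x1\<in>S. \<Sum>x2\<in>S. \<Sum>x3\<in>S. \<Sum>x4\<in>S. ?y x1 * ?y x2 * ?y x3 * ?y x4 * sec.quad_weight R x1 x2 x4 x3)
     + decay_max / sqrt R * (\<Sum>x1\<in>S. \<Sum>x2\<in>S. \<Sum>x3\<in>S. \<Sum>x4\<in>S. ?y x1 * ?y x2 * ?y x3 * ?y x4)"
  proof -
    have "y * (d * (l + l') + e) = d * (y * l) + d * (y * l') + e * y" for y d l l' e :: real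
      by (simp add: algebra_simps)
    then show ?thesis by (simp only: sum.distrib sum_distrib_left)
  qed
  also have "(\<Sum>x1\<in>S. \<Sum>x2\<in>S. \<Sum>x3\<in>S. \<Sum>x4\<in>S. ?y x1 * ?y x2 * ?y x3 * ?y x4 * sec.quad_weight R x1 x2 x4 x3)
      = (\<Sum>x1\<in>S. \<Sum>x2\<in>S. \<Sum>x3\<in>S. \<Sum>x4\<in>S. ?y x1 * ?y x2 * ?y x3 * ?y x4 * sec.quad_weight R x1 x2 x3 x4)"
    by (rule sum.cong[OF refl], rule sum.cong[OF refl], subst sum.swap) (simp only: mult_ac)
  also have "(\<Sum>x1\<in>S. \<Sum>x2\<in>S. \<Sum>x3\<in>S. \<Sum>x4\<in>S. ?y x1 * ?y x2 * ?y x3 * ?y x4) = ((\<Sum>\<xi>\<in>S. ?y \<xi>)\<^sup>2)\<^sup>2"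
    unfolding power2_eq_square sum_product by (simp add: sum_distrib_left sum_distrib_right mult_ac)
  \<comment> \<open>Cauchy-Schwarz is enough for the quadruples far from closing, since
    \<open>sqrt R\<close> outweighs any power of the number of lattice points.\<close>
  also have "((\<Sum>\<xi>\<in>S. ?y \<xi>)\<^sup>2)\<^sup>2 \<le> (real (card S) * ?A)\<^sup>2"
  proof (rule power_mono)
    show "(\<Sum>\<xi>\<in>S. ?y \<xi>)\<^sup>2 \<le> real (card S) * ?A"
      using sum_squared_le_sum_of_squares[of ?y S] by (simp add: mult.commute)
  qed simp
  finally have "\<bar>integral {p..q} (\<lambda>t. norm (trig_sum S x t) ^ 4)\<bar>
    \<le> decay_max * (48 * real (B_max lam) * ?A\<^sup>2) + decay_max * (48 * real (B_max lam) * ?A\<^sup>2)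
      + decay_max / sqrt R * (real (card S) * ?A)\<^sup>2"
    using sec.quad_weight_sum[OF R(1,2), of ?y] decay_max_pos R
    by (smt (verit) mult_left_mono divide_nonneg_nonneg real_sqrt_ge_zero)
  also have "\<dots> = (96 * decay_max * B_max lam + decay_max / sqrt R * (card S)\<^sup>2) * ?A\<^sup>2"
    by (simp add: algebra_simps power_mult_distrib)
  finally show ?thesis by linarith
qed

text \<open>As the values of a function, the eight classes form a partition; points on the boundary
  between octants go to one side.\<close>

definition octant :: "real^2 \<Rightarrow> bool \<times> bool \<times> bool" where
  "octant \<xi> = (\<xi> $ 1 \<ge> 0, \<xi> $ 2 \<ge> 0, \<bar>\<xi> $ 1\<bar> \<le> \<bar>\<xi> $ 2\<bar>)"

lemma octant_sector:
  assumes "lam > 0"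
  shows "\<exists>u w. sector u w {\<xi> \<in> lattice_circle lam. octant \<xi> = j} lam"
proof -
  obtain s t o' where j: "j = (s, t, o')" by (cases j)
  define X where "X = (\<lambda>\<xi>::real^2. (if s then 1 else -1) * \<xi> $ 1)"
  define Y where "Y = (\<lambda>\<xi>::real^2. (if t then 1 else -1) * \<xi> $ 2)"
  have lin: "linear X" "linear Y"
    by (auto simp: X_def Y_def linear_iff algebra_simps)
  have iso: "(norm \<xi>)\<^sup>2 = (X \<xi>)\<^sup>2 + (Y \<xi>)\<^sup>2" for \<xi>
    unfolding norm_sq_2 X_def Y_def by auto
  show ?thesis
  proof (cases o')
    case True
    have "sector X Y {\<xi> \<in> lattice_circle lam. octant \<xi> = j} lam"
      by standard (use assms lin iso True in \<open>auto simp: j octant_def X_def Y_def\<close>)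
    then show ?thesis by blast
  next
    case False
    have "sector Y X {\<xi> \<in> lattice_circle lam. octant \<xi> = j} lam"
      by standard (use assms lin iso False in \<open>auto simp: j octant_def X_def Y_def\<close>)
    then show ?thesis by blast
  qed
qed

text \<open>Splitting into eight sectors costs 8^3 by convexity of the fourth power, and summing
  eight equal bounds one more 8: 4096 = 8^4.\<close>

lemma L4_upper:
  assumes pq: "a \<le> p" "p \<le> q" "q \<le> b"
    and R: "8 * R ^ 3 < lam" "R \<le> sqrt lam / 2" "R \<ge> 1" and lam: "lam > 0"
  defines "E \<equiv> lattice_circle lam"
  shows "integral {p..q} (\<lambda>t. norm (trig_sum E x t) ^ 4)
    \<le> 4096 * (96 * decay_max * B_max lam + decay_max / sqrt R * (card E)\<^sup>2) * (\<Sum>\<xi>\<in>E. (norm (x \<xi>))\<^sup>2)\<^sup>2"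
proof -
  have fin: "finite E" unfolding E_def by (rule finite_lattice_circle)
  have sub: "{p..q} \<subseteq> {a..b}" using pq by auto
  define S where "S = (\<lambda>j. {\<xi> \<in> E. octant \<xi> = j})"
  let ?A = "\<Sum>\<xi>\<in>E. (norm (x \<xi>))\<^sup>2"
  let ?C = "96 * decay_max * B_max lam + decay_max / sqrt R * (card E)\<^sup>2"
  have card8: "real (card (UNIV :: (bool \<times> bool \<times> bool) set)) = 8" by (simp add: card_cartesian_product flip: UNIV_Times_UNIV)
  have split: "trig_sum E x t = (\<Sum>j\<in>UNIV. trig_sum (S j) x t)" for t
    unfolding trig_sum_def S_def by (rule sum.group[symmetric]) (use fin in auto)
  have pm: "norm (trig_sum E x t) ^ 4 \<le> 512 * (\<Sum>j\<in>UNIV. norm (trig_sum (S j) x t) ^ 4)" for t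
  proof -
    let ?z = "\<lambda>j. norm (trig_sum (S j) x t)"
    have "norm (trig_sum E x t) \<le> (\<Sum>j\<in>UNIV. ?z j)" unfolding split by (rule norm_sum)
    then have "(norm (trig_sum E x t))\<^sup>2 \<le> (\<Sum>j\<in>UNIV. ?z j)\<^sup>2" by (rule power_mono) simp
    also have "\<dots> \<le> 8 * (\<Sum>j\<in>UNIV. (?z j)\<^sup>2)"
      using sum_squared_le_sum_of_squares[of ?z UNIV] card8 by (simp add: mult.commute)
    finally have "((norm (trig_sum E x t))\<^sup>2)\<^sup>2 \<le> (8 * (\<Sum>j\<in>UNIV. (?z j)\<^sup>2))\<^sup>2" by (rule power_mono) simp
    also have "\<dots> = 64 * (\<Sum>j\<in>UNIV. (?z j)\<^sup>2)\<^sup>2" by (simp add: power_mult_distrib)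
    also have "\<dots> \<le> 64 * (8 * (\<Sum>j\<in>UNIV. ((?z j)\<^sup>2)\<^sup>2))"
      using sum_squared_le_sum_of_squares[of "\<lambda>j. (?z j)\<^sup>2" UNIV] card8 by (simp add: mult.commute)
    finally show ?thesis by (simp flip: power_mult)
  qed
  have bound: "integral {p..q} (\<lambda>t. norm (trig_sum (S j) x t) ^ 4) \<le> ?C * ?A\<^sup>2" for j
  proof -
    obtain u w where uw: "sector u w (S j) lam" using octant_sector[OF lam] unfolding S_def E_def by blast
    have card: "card (S j) \<le> card E" unfolding S_def using fin by (intro card_mono) auto
    have "integral {p..q} (\<lambda>t. norm (trig_sum (S j) x t) ^ 4)
      \<le> (96 * decay_max * B_max lam + decay_max / sqrt R * (card (S j))\<^sup>2) * (\<Sum>\<xi>\<in>S j. (norm (x \<xi>))\<^sup>2)\<^sup>2"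
      by (rule L4_sector[OF uw pq R])
    also have "\<dots> \<le> ?C * ?A\<^sup>2"
    proof (rule mult_mono)
      show "96 * decay_max * B_max lam + decay_max / sqrt R * (card (S j))\<^sup>2 \<le> ?C"
        using card decay_max_pos R
        by (intro add_left_mono mult_left_mono) (auto intro!: power_mono)
      show "(\<Sum>\<xi>\<in>S j. (norm (x \<xi>))\<^sup>2)\<^sup>2 \<le> ?A\<^sup>2"
        unfolding S_def using fin by (intro power_mono sum_mono2 sum_nonneg) auto
    qed (use decay_max_pos R in auto)
    finally show ?thesis .
  qed
  have int: "(\<lambda>t. norm (trig_sum (S j) x t) ^ 4) integrable_on {p..q}" for j
    by (intro integrable_continuous_real continuous_intros continuous_on_trig_sum sub)
  have "integral {p..q} (\<lambda>t. norm (trig_sum E x t) ^ 4)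
      \<le> integral {p..q} (\<lambda>t. 512 * (\<Sum>j\<in>UNIV. norm (trig_sum (S j) x t) ^ 4))"
    by (rule integral_le[OF _ _ pm])
      (intro integrable_continuous_real continuous_intros continuous_on_trig_sum sub)+
  also have "\<dots> = 512 * (\<Sum>j\<in>UNIV. integral {p..q} (\<lambda>t. norm (trig_sum (S j) x t) ^ 4))"
    unfolding integral_mult_right by (subst integral_sum) (use int in auto)
  also have "\<dots> \<le> 512 * (\<Sum>j\<in>(UNIV :: (bool \<times> bool \<times> bool) set). ?C * ?A\<^sup>2)"
    by (intro mult_left_mono sum_mono bound) simp
  also have "\<dots> = 4096 * ?C * ?A\<^sup>2" by (simp only: sum_constant card8)
  finally show ?thesis .
qed

end

section \<open>Counting zeros\<close>

text \<open>Exchanging the integrals gives an average over shifts \<open>s\<close> of integrals over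
  \<open>{a + s..e + s}\<close>. The margins \<open>a + h \<le> m\<close> and
  \<open>e + h \<le> b\<close> keep each such interval between \<open>{m..e}\<close> and
  \<open>{a..b}\<close>.\<close>

lemma window_average:
  fixes \<phi> :: "real \<Rightarrow> real"
  assumes cont: "continuous_on {a..b} \<phi>" and pos: "\<And>t. t \<in> {a..b} \<Longrightarrow> 0 \<le> \<phi> t"
    and h: "0 \<le> h" "a + h \<le> m" "m \<le> e" "e + h \<le> b"
  shows "continuous_on {a..e} (\<lambda>t. integral {t..t + h} \<phi>)"
    and "h * integral {m..e} \<phi> \<le> integral {a..e} (\<lambda>t. integral {t..t + h} \<phi>)"
    and "integral {a..e} (\<lambda>t. integral {t..t + h} \<phi>) \<le> h * integral {a..b} \<phi>"
proof -
  have ab: "a \<le> e" using h by simp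
  have c2: "continuous_on ({a..e} \<times> {0..h}) (\<lambda>(t, s). \<phi> (t + s))"
    unfolding case_prod_unfold
    by (rule continuous_on_compose2[OF cont]) (use h in \<open>auto intro!: continuous_intros\<close>)
  have c2': "continuous_on ({0..h} \<times> {a..e}) (\<lambda>(s, t). \<phi> (t + s))"
    unfolding case_prod_unfold
    by (rule continuous_on_compose2[OF cont]) (use h in \<open>auto intro!: continuous_intros\<close>)
  show "continuous_on {a..e} (\<lambda>t. integral {t..t + h} \<phi>)"
    using integral_continuous_on_param[of "{a..e}" 0 h "\<lambda>t s. \<phi> (t + s)"] c2
    by (simp add: integral_window_shift)
  have cs: "continuous_on {0..h} (\<lambda>s. integral {a..e} (\<lambda>t. \<phi> (t + s)))"
    using integral_continuous_on_param[of "{0..h}" a e "\<lambda>s t. \<phi> (t + s)"] c2' by simp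
  have swap: "integral {a..e} (\<lambda>t. integral {t..t + h} \<phi>) = integral {0..h} (\<lambda>s. integral {a..e} (\<lambda>t. \<phi> (t + s)))"
    using integral_swap_continuous[of a 0 e h "\<lambda>t s. \<phi> (t + s)"] c2
    by (simp add: integral_window_shift cbox_Pair_eq)
  have shift: "integral {a..e} (\<lambda>t. \<phi> (t + s)) = integral {a + s..e + s} \<phi>" for s
    using integral_shift_Icc_real[of a e \<phi> s] by (simp add: o_def add.commute)
  have int: "\<phi> integrable_on {p..q}" if "a \<le> p" "q \<le> b" for p q
    by (rule integrable_continuous_real, rule continuous_on_subset[OF cont]) (use that in auto)
  have const: "integral {0..h} (\<lambda>s. C) = h * C" for C :: real using h by simp
  have "integral {m..e} \<phi> \<le> integral {a + s..e + s} \<phi>" "integral {a + s..e + s} \<phi> \<le> integral {a..b} \<phi>"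
    if s: "s \<in> {0..h}" for s
    by (rule integral_subset_le; use s h pos in \<open>auto intro!: int\<close>)+
  note bounds = this
  have ics: "(\<lambda>s. integral {a + s..e + s} \<phi>) integrable_on {0..h}"
    using integrable_continuous_real[OF cs] by (simp only: shift)
  show "h * integral {m..e} \<phi> \<le> integral {a..e} (\<lambda>t. integral {t..t + h} \<phi>)"
    unfolding swap shift const[symmetric] by (rule integral_le[OF integrable_const_ivl ics bounds(1)])
  show "integral {a..e} (\<lambda>t. integral {t..t + h} \<phi>) \<le> h * integral {a..b} \<phi>"
    unfolding swap shift const[symmetric] by (rule integral_le[OF ics integrable_const_ivl bounds(2)])
qed

lemma integral_abs_eq_of_no_zero:
  fixes f :: "real \<Rightarrow> real"
  assumes cont: "continuous_on {p..q} f" and nz: "\<And>t. t \<in> {p..q} \<Longrightarrow> f t \<noteq> 0" and pq: "p \<le> q"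
  shows "integral {p..q} (\<lambda>t. \<bar>f t\<bar>) = \<bar>integral {p..q} f\<bar>"
proof -
  have conn: "connected (f ` {p..q})" by (intro connected_continuous_image cont) auto
  have "(\<forall>t\<in>{p..q}. 0 \<le> f t) \<or> (\<forall>t\<in>{p..q}. f t \<le> 0)"
  proof (rule ccontr)
    assume "\<not> ?thesis"
    then obtain t1 t2 where t: "t1 \<in> {p..q}" "t2 \<in> {p..q}" "f t1 \<le> 0" "0 \<le> f t2" by force
    have "0 \<in> f ` {p..q}"
      by (rule connectedD_interval[OF conn imageI[OF t(1)] imageI[OF t(2)] t(3,4)])
    then show False using nz by force
  qed
  then show ?thesis
  proof
    assume *: "\<forall>t\<in>{p..q}. 0 \<le> f t"
    then have "integral {p..q} (\<lambda>t. \<bar>f t\<bar>) = integral {p..q} f" by (intro integral_cong) auto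
    moreover have "integral {p..q} f \<ge> 0"
      using * by (intro integral_nonneg integrable_continuous_real cont) auto
    ultimately show ?thesis by simp
  next
    assume *: "\<forall>t\<in>{p..q}. f t \<le> 0"
    then have "integral {p..q} (\<lambda>t. \<bar>f t\<bar>) = integral {p..q} (\<lambda>t. - f t)" by (intro integral_cong) auto
    moreover have "integral {p..q} (\<lambda>t. - f t) \<ge> 0"
      using * by (intro integral_nonneg integrable_continuous_real continuous_intros cont) auto
    ultimately show ?thesis by simp
  qed
qed

text \<open>Meant for \<open>{z - h..z}\<close>, the starts of the windows of length
  \<open>h\<close> that contain a zero \<open>z\<close>.\<close>

lemma integral_interval_indicator_le:
  fixes a e p q :: real
  assumes "p \<le> q"
  shows "(\<lambda>t. if t \<in> {p..q} then 1 else 0 :: real) integrable_on {a..e}"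
    and "integral {a..e} (\<lambda>t. if t \<in> {p..q} then 1 else 0 :: real) \<le> q - p"
proof -
  have Int: "{p..q} \<inter> {a..e} = {max p a..min q e}" by auto
  show "(\<lambda>t. if t \<in> {p..q} then 1 else 0 :: real) integrable_on {a..e}"
    unfolding integrable_restrict_Int Int by (rule integrable_const_ivl)
  have "integral {a..e} (\<lambda>t. if t \<in> {p..q} then 1 else 0 :: real) = integral {max p a..min q e} (\<lambda>_. 1)"
    unfolding integral_restrict_Int Int ..
  also have "\<dots> \<le> q - p" using assms by (cases "max p a \<le> min q e") auto
  finally show "integral {a..e} (\<lambda>t. if t \<in> {p..q} then 1 else 0 :: real) \<le> q - p" .
qed

text \<open>On a window without zeros the integral of \<open>f\<close> has the size of the integral of \<open>\<bar>f\<bar>\<close>; the other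
  windows are absorbed by \<open>\<bar>f\<bar> \<le> \<tau>/2 + f\<^sup>2/(2 \<tau>)\<close>.\<close>

lemma window_zero_count:
  fixes f :: "real \<Rightarrow> real"
  assumes cont: "continuous_on {a..b} f" and h: "0 < h" "a + h \<le> m" "m \<le> e" "e + h \<le> b"
    and fin: "finite {t \<in> {a..b}. f t = 0}" and tau: "\<tau> > 0" "\<sigma> > 0"
  shows "h * integral {m..e} (\<lambda>t. \<bar>f t\<bar>)
    \<le> (\<sigma> * (e - a) + integral {a..e} (\<lambda>t. (integral {t..t + h} f)\<^sup>2) / \<sigma>) / 2
      + \<tau> * h * (h * card {t \<in> {a..b}. f t = 0}) / 2 + h * integral {a..b} (\<lambda>t. (f t)\<^sup>2) / (2 * \<tau>)"
proof -
  define Z where "Z = {t \<in> {a..b}. f t = 0}"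
  \<comment> \<open>Counts the zeros in the window that starts at \<open>t\<close>; integrated over
    \<open>t\<close>, each zero contributes at most \<open>h\<close>.\<close>
  define n where "n = (\<lambda>t. \<Sum>z\<in>Z. if t \<in> {z - h..z} then 1 else 0 :: real)"
  have ae: "a \<le> e" using h by simp
  define G where "G = (\<lambda>t. integral {t..t + h} f)"
  define H where "H = (\<lambda>t. integral {t..t + h} (\<lambda>t. \<bar>f t\<bar>))"
  define H2 where "H2 = (\<lambda>t. integral {t..t + h} (\<lambda>t. (f t)\<^sup>2))"
  have contG: "continuous_on {a..e} G"
  proof -
    have c2: "continuous_on ({a..e} \<times> {0..h}) (\<lambda>(t, s). f (t + s))"
      unfolding case_prod_unfold
      by (rule continuous_on_compose2[OF cont]) (use h in \<open>auto intro!: continuous_intros\<close>)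
    then show ?thesis
      using integral_continuous_on_param[of "{a..e}" 0 h "\<lambda>t s. f (t + s)"]
      by (simp add: integral_window_shift G_def)
  qed
  have cabs: "continuous_on {a..b} (\<lambda>t. \<bar>f t\<bar>)" and csq: "continuous_on {a..b} (\<lambda>t. (f t)\<^sup>2)"
    by (intro continuous_intros cont)+
  have H: "continuous_on {a..e} H" "h * integral {m..e} (\<lambda>t. \<bar>f t\<bar>) \<le> integral {a..e} H"
    unfolding H_def using window_average[OF cabs _ _ h(2-4)] h(1) by auto
  have H2: "continuous_on {a..e} H2" "integral {a..e} H2 \<le> h * integral {a..b} (\<lambda>t. (f t)\<^sup>2)"
    unfolding H2_def using window_average[OF csq _ _ h(2-4)] h(1) by auto
  have n: "n integrable_on {a..e}" "integral {a..e} n \<le> h * card Z"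
  proof -
    have i: "(\<lambda>t. if t \<in> {z - h..z} then 1 else 0 :: real) integrable_on {a..e}"
      "integral {a..e} (\<lambda>t. if t \<in> {z - h..z} then 1 else 0 :: real) \<le> h" for z
      using integral_interval_indicator_le[of "z - h" z] h(1) by auto
    show "n integrable_on {a..e}" unfolding n_def using fin by (intro integrable_sum i) (simp add: Z_def)
    have "integral {a..e} n = (\<Sum>z\<in>Z. integral {a..e} (\<lambda>t. if t \<in> {z - h..z} then 1 else 0 :: real))"
      unfolding n_def using fin by (intro integral_sum i) (simp add: Z_def)
    also have "\<dots> \<le> (\<Sum>z\<in>Z. h)" by (intro sum_mono i)
    finally show "integral {a..e} n \<le> h * card Z" by (simp add: mult.commute)
  qed
  \<comment> \<open>Replaces Cauchy-Schwarz by a linear bound with a free weight: \<sigma> for the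
    window integrals, \<tau> for \<open>f\<close> itself.\<close>
  have young: "x \<le> (s + x\<^sup>2 / s) / 2" if "s > 0" for x s :: real
  proof -
    have "2 * x * s \<le> x\<^sup>2 + s\<^sup>2" by (rule sum_squares_bound)
    then show ?thesis using that by (simp add: field_simps power2_eq_square)
  qed
  have n0: "n t \<ge> 0" for t unfolding n_def by (intro sum_nonneg) auto
  have sub: "{t..t + h} \<subseteq> {a..b}" if "t \<in> {a..e}" for t using that h by auto
  have H2_nonneg: "H2 t \<ge> 0" if "t \<in> {a..e}" for t
    unfolding H2_def by (intro integral_nonneg integrable_continuous_real continuous_on_subset[OF csq sub[OF that]]) auto
  have point: "H t \<le> (\<sigma> + (G t)\<^sup>2 / \<sigma>) / 2 + \<tau> * h / 2 * n t + H2 t / (2 * \<tau>)" if t: "t \<in> {a..e}" for t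
  proof (cases "\<exists>z\<in>{t..t + h}. f z = 0")
    case False
    have "H t = \<bar>G t\<bar>" unfolding H_def G_def
      using False h(1) by (intro integral_abs_eq_of_no_zero continuous_on_subset[OF cont sub[OF t]]) auto
    also have "\<dots> \<le> (\<sigma> + (G t)\<^sup>2 / \<sigma>) / 2" using young[OF tau(2), of "\<bar>G t\<bar>"] by simp
    finally have "H t \<le> (\<sigma> + (G t)\<^sup>2 / \<sigma>) / 2" .
    moreover have "0 \<le> \<tau> * h / 2 * n t" "0 \<le> H2 t / (2 * \<tau>)" using n0 H2_nonneg[OF t] tau h(1) by auto
    ultimately show ?thesis by linarith
  next
    case True
    then obtain z where z: "z \<in> {t..t + h}" "f z = 0" by blast
    have "z \<in> Z" using z sub[OF t] by (auto simp: Z_def)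
    have "(1::real) = (if t \<in> {z - h..z} then 1 else 0)" using z by simp
    also have "\<dots> \<le> n t" unfolding n_def
      by (rule member_le_sum[OF \<open>z \<in> Z\<close>]) (use fin in \<open>auto simp: Z_def\<close>)
    finally have n1: "1 \<le> n t" .
    have "H t \<le> integral {t..t + h} (\<lambda>s. \<tau> / 2 + (f s)\<^sup>2 / (2 * \<tau>))" unfolding H_def
    proof (rule integral_le)
      show "\<bar>f s\<bar> \<le> \<tau> / 2 + (f s)\<^sup>2 / (2 * \<tau>)" for s
        using young[OF tau(1), of "\<bar>f s\<bar>"] by (simp add: field_simps)
    qed (use tau in \<open>auto intro!: integrable_continuous_real continuous_intros continuous_on_subset[OF cont sub[OF t]]\<close>)
    also have "\<dots> = \<tau> / 2 * h + H2 t / (2 * \<tau>)"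
    proof -
      have "integral {t..t + h} (\<lambda>s. \<tau> / 2 + (f s)\<^sup>2 / (2 * \<tau>))
        = integral {t..t + h} (\<lambda>s. \<tau> / 2) + integral {t..t + h} (\<lambda>s. (f s)\<^sup>2 / (2 * \<tau>))"
        using tau by (intro integral_add integrable_continuous_real continuous_intros continuous_on_subset[OF cont sub[OF t]]) auto
      then show ?thesis using h(1) by (simp add: H2_def)
    qed
    also have "\<tau> / 2 * h \<le> \<tau> * h / 2 * n t" using n1 tau h(1) by simp
    finally have "H t \<le> \<tau> * h / 2 * n t + H2 t / (2 * \<tau>)" by simp
    moreover have "0 \<le> (\<sigma> + (G t)\<^sup>2 / \<sigma>) / 2" using tau by simp
    ultimately show ?thesis by linarith
  qed
  have iG: "(\<lambda>t. (G t)\<^sup>2) integrable_on {a..e}" by (intro integrable_continuous_real continuous_intros contG)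
  have iH2: "H2 integrable_on {a..e}" by (intro integrable_continuous_real H2)
  have hi: "((\<lambda>t. (\<sigma> + (G t)\<^sup>2 / \<sigma>) / 2 + \<tau> * h / 2 * n t + H2 t / (2 * \<tau>)) has_integral
    ((\<sigma> * (e - a) + integral {a..e} (\<lambda>t. (G t)\<^sup>2) / \<sigma>) / 2 + \<tau> * h / 2 * integral {a..e} n + integral {a..e} H2 / (2 * \<tau>))) {a..e}"
    using has_integral_const_real[of \<sigma> a e] ae
    by (intro has_integral_add has_integral_divide has_integral_mult_right integrable_integral iG iH2 n)
      (simp add: mult.commute)
  have "integral {a..e} H \<le> (\<sigma> * (e - a) + integral {a..e} (\<lambda>t. (G t)\<^sup>2) / \<sigma>) / 2
      + \<tau> * h / 2 * integral {a..e} n + integral {a..e} H2 / (2 * \<tau>)"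
    by (rule has_integral_le[OF integrable_integral[OF integrable_continuous_real[OF H(1)]] hi point])
  also have "\<dots> \<le> (\<sigma> * (e - a) + integral {a..e} (\<lambda>t. (G t)\<^sup>2) / \<sigma>) / 2
      + \<tau> * h / 2 * (h * card Z) + h * integral {a..b} (\<lambda>t. (f t)\<^sup>2) / (2 * \<tau>)"
    using n H2 tau h(1) by (intro add_mono mult_left_mono divide_right_mono) auto
  finally show ?thesis using H(2) by (simp add: G_def Z_def)
qed

text \<open>A linearized Hoelder inequality between the exponents 1, 2 and 4. Pointwise it says
  \<open>y^2 - y^4 \<le> y\<close> for \<open>y = \<bar>x\<bar> / T\<close>; optimizing
  \<open>T\<close> gives the interpolated inequality up to a constant.\<close>

lemma L1_lower:
  fixes f :: "real \<Rightarrow> real"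
  assumes cont: "continuous_on {p..q} f" and T: "T > 0"
  shows "integral {p..q} (\<lambda>t. (f t)\<^sup>2) / T - integral {p..q} (\<lambda>t. (f t) ^ 4) / T ^ 3 \<le> integral {p..q} (\<lambda>t. \<bar>f t\<bar>)"
proof -
  have i: "(\<lambda>t. (f t)\<^sup>2) integrable_on {p..q}" "(\<lambda>t. (f t) ^ 4) integrable_on {p..q}" "(\<lambda>t. \<bar>f t\<bar>) integrable_on {p..q}"
    by (intro integrable_continuous_real continuous_intros cont)+
  have "x\<^sup>2 / T - x ^ 4 / T ^ 3 \<le> \<bar>x\<bar>" for x
  proof -
    define y where "y = \<bar>x\<bar> / T"
    have y: "y \<ge> 0" using T by (simp add: y_def)
    have "y\<^sup>2 - y ^ 4 \<le> y"
    proof (cases "y \<le> 1")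
      case True
      then have "y\<^sup>2 \<le> y" using y by (simp add: power2_eq_square mult_left_le)
      moreover have "0 \<le> y ^ 4" by simp
      ultimately show ?thesis by linarith
    next
      case False
      then have "y\<^sup>2 \<le> y ^ 4" by (intro power_increasing) auto
      then show ?thesis using y by linarith
    qed
    then have "T * (y\<^sup>2 - y ^ 4) \<le> T * y" using T by (intro mult_left_mono) auto
    moreover have "T * y = \<bar>x\<bar>" "T * (y\<^sup>2 - y ^ 4) = x\<^sup>2 / T - x ^ 4 / T ^ 3"
      using T by (simp_all add: y_def power_divide right_diff_distrib power2_eq_square power3_eq_cube power4_eq_xxxx)
    ultimately show ?thesis by simp
  qed
  from has_integral_le[OF has_integral_diff[OF has_integral_divide[OF integrable_integral[OF i(1)]]
        has_integral_divide[OF integrable_integral[OF i(2)]]] integrable_integral[OF i(3)] this]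
  show ?thesis .
qed

section \<open>Balancing the parameters\<close>

context curved_arc
begin

text \<open>The middle third of the arc carries the lower bound for the integral of
  \<open>\<bar>f\<bar>\<close>; the outer thirds leave room for windows of length at most
  \<open>l\<close>. Every loss from far pairs is a constant times at most the second power of the
  number of lattice points, divided by \<open>lam powr (1/8)\<close>.\<close>

lemma zero_count:
  "\<exists>c0>0. \<exists>lam0>0. \<forall>lam\<ge>lam0. \<forall>x f.
    (\<forall>t\<in>{a..b}. complex_of_real (f t) = trig_sum (lattice_circle lam) x t) \<longrightarrow>
    (\<exists>\<xi>\<in>lattice_circle lam. x \<xi> \<noteq> 0) \<longrightarrow> finite {t \<in> {a..b}. f t = 0} \<longrightarrow>
    c0 * lam / (real (B_max lam))\<^sup>2 \<le> real (card {t \<in> {a..b}. f t = 0})"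
proof -
  define l where "l = (b - a) / 3"
  have l: "l > 0" using ab by (simp add: l_def)
  have l3: "3 * l = b - a" by (simp add: l_def)
  define m where "m = a + l"
  define e where "e = a + 2 * l"
  have me: "a \<le> m" "m < e" "e \<le> b" "e - m = l" "e - a = 2 * l" "b - a = 3 * l" "a \<le> e" "m \<le> e" "e + l = b"
    using l l3 by (simp_all add: m_def e_def)
  from wave_uniform_gap[OF me(1-3)]
  obtain \<rho> where "0 \<le> \<rho> \<and> \<rho> < 1 \<and>
    (\<forall>v. (\<forall>i. v $ i \<in> \<int>) \<longrightarrow> v \<noteq> 0 \<longrightarrow> norm (integral {m..e} (wave v)) \<le> \<rho> * (e - m))" ..
  then have \<rho>: "0 \<le> \<rho>" "\<rho> < 1"
    "\<And>v. (\<forall>i. v $ i \<in> \<int>) \<Longrightarrow> v \<noteq> 0 \<Longrightarrow> norm (integral {m..e} (wave v)) \<le> \<rho> * (e - m)" by simp_all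
  \<comment> \<open>Half of the gap in \<open>L2_lower\<close>; the other half absorbs the far
    pairs.\<close>
  define c2 where "c2 = (1 - \<rho>) * l / 2"
  \<comment> \<open>97 is 96 for almost closed quadruples plus 1 for the rest.\<close>
  define C4 where "C4 = 4096 * (97 * decay_max)"
  define C5 where "C5 = 6 * l + 1"
  define C6 where "C6 = 2 * window_const + 1"
  have wc: "window_const \<ge> 0" using c ab by (auto simp: window_const_def)
  have pos: "c2 > 0" "C4 > 0" "C5 > 0" "C6 > 0"
    using \<rho> l decay_max_pos wc by (auto simp: c2_def C4_def C5_def C6_def)
  \<comment> \<open>For \<open>T = sqrt A * sqrt B * t0\<close> the quartic term in
    \<open>L1_lower\<close> is half of the quadratic one; what remains is
    \<open>c7 * sqrt A / sqrt B\<close>.\<close>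
  define t0 where "t0 = sqrt (2 * C4 / c2)"
  have t0: "t0 > 0" "t0\<^sup>2 = 2 * C4 / c2" using pos by (simp_all add: t0_def)
  define c7 where "c7 = c2 / (2 * t0)"
  have c7: "c7 > 0" using pos t0 by (simp add: c7_def)
  \<comment> \<open>The factor in \<open>h = \<kappa> * B / lam\<close>, large enough that the
    window integrals cost at most a quarter of the lower bound for the integral of
    \<open>\<bar>f\<bar>\<close>; that is what \<open>32 * l * C6 \<le> \<kappa> * c7^2\<close>
    expresses.\<close>
  define \<kappa> where "\<kappa> = 1 + 32 * l * C6 / c7\<^sup>2"
  have kap: "\<kappa> \<ge> 1" "32 * l * C6 \<le> \<kappa> * c7\<^sup>2" using pos l c7 by (auto simp: \<kappa>_def field_simps)
  \<comment> \<open>One summand for each comparison of a constant with a power of \<open>s\<close>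
    that large \<open>lam\<close> has to settle.\<close>
  define M where "M = 3 + 2 * decay / ((1 - \<rho>) * l) + c * \<kappa>\<^sup>2 + \<kappa> / l + 2 * K * \<kappa> / c + \<kappa> * decay"
  have Mpos: "0 \<le> 2 * decay / ((1 - \<rho>) * l)" "0 \<le> c * \<kappa>\<^sup>2" "0 \<le> \<kappa> / l" "0 \<le> 2 * K * \<kappa> / c" "0 \<le> \<kappa> * decay"
    using decay_pos \<rho> l c K kap by auto
  have M: "M \<ge> 3" "2 * decay / ((1 - \<rho>) * l) \<le> M" "c * \<kappa>\<^sup>2 \<le> M" "\<kappa> / l \<le> M" "2 * K * \<kappa> / c \<le> M" "\<kappa> * decay \<le> M"
    unfolding M_def using Mpos by linarith+
  obtain C where C: "C \<ge> 1" "\<And>lam. lam \<ge> 1 \<Longrightarrow> real (card (lattice_circle lam)) \<le> C * lam powr (1/32)"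
    using card_lattice_circle_le[of "1/32"] by auto
  \<comment> \<open>From \<open>N \<le> C * lam powr (1/32)\<close>, \<open>M * N^2\<close> is at
    most \<open>M * C^2 * lam powr (1/16)\<close>; this is at most \<open>s = lam powr (1/8)\<close>
    once \<open>lam \<ge> (M * C^2)^16\<close>.\<close>
  define lam0 where "lam0 = (M * C\<^sup>2) ^ 16"
  have MC: "M * C\<^sup>2 \<ge> 1"
  proof -
    have "C\<^sup>2 \<ge> 1" using C(1) by simp
    then have "1 * 1 \<le> M * C\<^sup>2" using M(1) by (intro mult_mono) auto
    then show ?thesis by simp
  qed
  have lam0: "lam0 \<ge> 1" unfolding lam0_def using MC by (rule one_le_power)
  have main: "c7\<^sup>2 / (2 * C5 * \<kappa>) * lam / (real (B_max lam))\<^sup>2 \<le> real (card {t \<in> {a..b}. f t = 0})"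
    if lam: "lam \<ge> lam0" and f: "\<forall>t\<in>{a..b}. complex_of_real (f t) = trig_sum (lattice_circle lam) x t"
      and nz: "\<exists>\<xi>\<in>lattice_circle lam. x \<xi> \<noteq> 0" and fin: "finite {t \<in> {a..b}. f t = 0}" for lam x f
  proof -
    let ?E = "lattice_circle lam"
    define N where "N = real (card ?E)"
    define B where "B = real (B_max lam)"
    define A where "A = (\<Sum>\<xi>\<in>?E. (norm (x \<xi>))\<^sup>2)"
    have lam1: "lam \<ge> 1" using lam lam0 by simp
    have ne: "?E \<noteq> {}" using nz by blast
    have B1: "1 \<le> B" "B \<le> N"
      using B_max_ge_1[OF ne] B_max_le_card[OF ne] lam1 by (simp_all add: B_def N_def)
    have A: "A > 0"
    proof -
      obtain \<xi> where \<xi>: "\<xi> \<in> ?E" "x \<xi> \<noteq> 0" using nz by blast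
      then show ?thesis unfolding A_def
        by (intro sum_pos2[OF finite_lattice_circle \<xi>(1)]) auto
    qed
    \<comment> \<open>Below the scale \<open>lam powr (1/3)\<close> of the three-point bound, so
      each point has at most one near neighbour, while far pairs gain
      \<open>sqrt R = s\<close>.\<close>
    define R where "R = lam powr (1/4)"
    define s where "s = lam powr (1/8)"
    have s: "s > 0" "R = s\<^sup>2" "lam = R ^ 4" "sqrt R = s" "sqrt lam = R\<^sup>2"
    proof -
      show "s > 0" using lam1 by (simp add: s_def)
      show R: "R = s\<^sup>2" using lam1 by (simp add: R_def s_def powr_powr flip: powr_numeral)
      then show "sqrt R = s" using \<open>s > 0\<close> by simp
      show l4: "lam = R ^ 4" using lam1 by (simp add: R_def powr_powr flip: powr_numeral)
      have "lam = (R\<^sup>2)\<^sup>2" unfolding l4 by (simp flip: power_mult)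
      then show "sqrt lam = R\<^sup>2" by (simp only: real_sqrt_abs abs_power2)
    qed
    have MN: "M * N\<^sup>2 \<le> s"
    proof -
      have "N \<le> C * lam powr (1/32)" unfolding N_def by (rule C(2)[OF lam1])
      then have "N\<^sup>2 \<le> (C * lam powr (1/32))\<^sup>2" by (rule power_mono) (simp add: N_def)
      also have "\<dots> = C\<^sup>2 * lam powr (1/16)" by (simp add: power_mult_distrib powr_powr flip: powr_numeral)
      finally have "M * N\<^sup>2 \<le> M * (C\<^sup>2 * lam powr (1/16))" using M(1) by (intro mult_left_mono) auto
      also have "\<dots> = (M * C\<^sup>2) * lam powr (1/16)" by simp
      also have "\<dots> \<le> lam powr (1/16) * lam powr (1/16)"
      proof (rule mult_right_mono)
        have "M * C\<^sup>2 = ((M * C\<^sup>2) powr 16) powr (1/16)" using MC by (subst powr_powr) simp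
        also have "(M * C\<^sup>2) powr 16 = lam0" unfolding lam0_def using MC by (simp add: powr_numeral)
        also have "lam0 powr (1/16) \<le> lam powr (1/16)" using lam lam0 by (intro powr_mono2) auto
        finally show "M * C\<^sup>2 \<le> lam powr (1/16)" .
      qed simp
      also have "\<dots> = s" by (simp add: s_def flip: powr_add)
      finally show ?thesis .
    qed
    have N1: "N \<ge> 1" "N \<le> N\<^sup>2" using B1 by (auto simp: power2_eq_square)
    have Ms: "M \<le> s" "M * N \<le> s" "M * B \<le> s"
    proof -
      have "M * B \<le> M * N" "M * N \<le> M * N\<^sup>2" "M * 1 \<le> M * N" using B1 N1 M(1) by (auto intro!: mult_left_mono)
      then show "M \<le> s" "M * N \<le> s" "M * B \<le> s" using MN by linarith+
    qed
    have s3: "s \<ge> 3" using Ms M by linarith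
    have sR: "s \<le> R" unfolding s(2) using s3 by (simp add: power2_eq_square)
    have R9: "R \<ge> 9" unfolding s(2) using s3 power_mono[of 3 s 2] by simp
    have R1: "8 * R ^ 3 < lam"
    proof -
      have "8 * R ^ 3 < R * R ^ 3" using R9 by (intro mult_strict_right_mono) auto
      then show ?thesis by (simp add: s(3) power_Suc[symmetric] del: power_Suc)
    qed
    have R2: "R \<le> sqrt lam / 2" unfolding s(5) using R9 by (simp add: power2_eq_square)
    have R3: "R \<ge> 1" using R9 by simp
    \<comment> \<open>Absorbs a constant \<open>d\<close> and a count \<open>n\<close> into the gain
      \<open>s\<close>.\<close>
    have over_s: "d * n / s \<le> y" if "d \<le> M * y" "M * n \<le> s" "0 \<le> y" "0 \<le> n" for d n y
    proof -
      have "d * n \<le> (M * y) * n" using that by (intro mult_right_mono) auto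
      also have "\<dots> = (M * n) * y" by simp
      also have "\<dots> \<le> s * y" using that by (intro mult_right_mono) auto
      finally show ?thesis using s(1) by (simp add: field_simps)
    qed
    have d1: "decay * N / s \<le> c2"
    proof (rule over_s)
      have "0 < (1 - \<rho>) * l" using \<rho> l by simp
      then show "decay \<le> M * c2" using M(2) by (simp add: c2_def field_simps)
    qed (use Ms N1 pos in auto)
    have d2: "decay * N / s \<le> 1"
    proof (rule over_s)
      have "1 * decay \<le> \<kappa> * decay" using kap decay_pos by (intro mult_right_mono) auto
      then show "decay \<le> M * 1" using M(6) by simp
    qed (use Ms N1 in auto)
    have d3: "1 * N\<^sup>2 / s \<le> 1" by (rule over_s) (use M MN in auto)
    define h where "h = \<kappa> * B / lam"
    have h0: "h > 0" using kap B1 lam1 by (simp add: h_def)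
    have lamh: "lam * h = \<kappa> * B" using lam1 by (simp add: h_def)
    have lamh1: "1 \<le> lam * h" unfolding lamh using mult_mono[OF kap(1) B1(1)] kap by simp
    have BR: "B \<le> R"
    proof -
      have "1 * B \<le> M * B" using M(1) B1 by (intro mult_right_mono) auto
      then show ?thesis using Ms(3) sR by simp
    qed
    have h1: "c * lam * h\<^sup>2 \<le> 3"
    proof -
      have "c * lam * h\<^sup>2 * lam = c * (lam * h)\<^sup>2" by (simp add: power2_eq_square)
      also have "\<dots> = c * \<kappa>\<^sup>2 * B\<^sup>2" by (simp add: lamh power_mult_distrib)
      also have "\<dots> \<le> R * R\<^sup>2"
      proof (rule mult_mono)
        show "c * \<kappa>\<^sup>2 \<le> R" using M(3) Ms(1) sR by linarith
        show "B\<^sup>2 \<le> R\<^sup>2" using BR B1 by (intro power_mono) auto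
      qed (use R3 in auto)
      also have "\<dots> \<le> lam"
        unfolding s(3) using R3 by (simp add: power2_eq_square power4_eq_xxxx mult_le_cancel_right1)
      finally have "c * lam * h\<^sup>2 * lam \<le> 1 * lam" by simp
      then have "c * lam * h\<^sup>2 \<le> 1" using lam1 mult_right_le_imp_le[of "c * lam * h\<^sup>2" lam 1] by simp
      then show ?thesis by simp
    qed
    have h2: "h \<le> l"
    proof -
      have "\<kappa> \<le> l * M" using M(4) l by (simp add: field_simps)
      then have "\<kappa> * B \<le> (l * M) * B" using B1 by (intro mult_right_mono) auto
      also have "\<dots> = l * (M * B)" by simp
      also have "\<dots> \<le> l * R" using Ms(3) sR l by (intro mult_left_mono) auto
      also have "\<dots> \<le> l * lam"
        unfolding s(3) using R3 l by (intro mult_left_mono self_le_power) auto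
      finally show ?thesis using lam1 by (simp add: h_def field_simps)
    qed
    \<comment> \<open>Since \<open>lam * h\<close> is only of order \<open>B\<close>, shifts within
      a window perturb a phase by less than a frequency difference of size \<open>R\<close> does;
      this is what far pairs of windows require.\<close>
    have h3: "K * lam * h \<le> c / 2 * R"
    proof -
      have "K * lam * h = K * \<kappa> * B" by (simp only: mult.assoc lamh)
      also have "\<dots> \<le> (c / 2 * M) * B"
        using M(5) c B1 by (intro mult_right_mono) (auto simp: field_simps)
      also have "\<dots> = c / 2 * (M * B)" by simp
      also have "\<dots> \<le> c / 2 * R" using Ms(3) sR c by (intro mult_left_mono) auto
      finally show ?thesis .
    qed
    \<comment> \<open>Far interactions of windows must not exceed the diagonal order
      \<open>h / lam\<close>. As \<open>lam * h = \<kappa> * B \<le> \<kappa> * N\<close>, this is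
      once more \<open>N^2\<close> against \<open>s\<close>.\<close>
    have d4: "h\<^sup>2 * (decay / sqrt R) * N \<le> h / lam"
    proof -
      have "(\<kappa> * decay) * N\<^sup>2 / s \<le> 1" by (rule over_s) (use M MN in auto)
      moreover have "\<kappa> * B * decay * N / s \<le> (\<kappa> * decay) * N\<^sup>2 / s"
      proof (rule divide_right_mono)
        have "B * N \<le> N\<^sup>2" unfolding power2_eq_square using B1 N1 by (intro mult_right_mono) auto
        then have "\<kappa> * decay * (B * N) \<le> \<kappa> * decay * N\<^sup>2"
          using kap decay_pos by (intro mult_left_mono) auto
        then show "\<kappa> * B * decay * N \<le> \<kappa> * decay * N\<^sup>2" by (simp only: mult_ac)
      qed (use s in auto)
      ultimately have "lam * h * (decay * N / s) \<le> 1" unfolding lamh by simp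
      then have "h / lam * (lam * h * (decay * N / s)) \<le> h / lam * 1"
        using h0 lam1 by (intro mult_left_mono) auto
      moreover have "h / lam * (lam * h * (decay * N / s)) = h\<^sup>2 * (decay / sqrt R) * N"
        using lam1 by (simp add: s(4) power2_eq_square)
      ultimately show ?thesis by simp
    qed
    have nf: "norm (trig_sum ?E x t) = \<bar>f t\<bar>" if "t \<in> {a..b}" for t
      using f that by (metis norm_of_real)
    have contf: "continuous_on {a..b} f"
    proof -
      have "continuous_on {a..b} (\<lambda>t. Re (trig_sum ?E x t))"
        by (intro continuous_intros continuous_on_trig_sum) simp
      then show ?thesis
        by (rule continuous_on_eq) (use f in \<open>metis Re_complex_of_real\<close>)
    qed
    have f2: "c2 * A \<le> integral {m..e} (\<lambda>t. (f t)\<^sup>2)"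
    proof -
      have "c2 \<le> (1 - \<rho>) * (e - m) - decay / sqrt R * N"
      proof -
        have "(1 - \<rho>) * (e - m) = 2 * c2" by (simp add: me c2_def)
        moreover have "decay / sqrt R * N = decay * N / s" by (simp add: s(4))
        ultimately show ?thesis using d1 by linarith
      qed
      then have "c2 * A \<le> ((1 - \<rho>) * (e - m) - decay / sqrt R * N) * A" using A by (intro mult_right_mono) auto
      also have "\<dots> \<le> integral {m..e} (\<lambda>t. (norm (trig_sum ?E x t))\<^sup>2)"
        unfolding A_def N_def by (rule L2_lower[OF me(1,8,3) R1 R3 \<rho>(1,3)])
      also have "\<dots> = integral {m..e} (\<lambda>t. (f t)\<^sup>2)"
        using me by (intro integral_cong) (simp add: nf)
      finally show ?thesis .
    qed
    have f4: "integral {m..e} (\<lambda>t. (f t) ^ 4) \<le> C4 * B * A\<^sup>2"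
    proof -
      have "integral {m..e} (\<lambda>t. (f t) ^ 4) = integral {m..e} (\<lambda>t. norm (trig_sum ?E x t) ^ 4)"
        using me by (intro integral_cong) (simp add: nf)
      also have "\<dots> \<le> 4096 * (96 * decay_max * B + decay_max / sqrt R * N\<^sup>2) * A\<^sup>2"
        using L4_upper[OF me(1,8,3) R1 R2 R3, of x] lam1 by (simp add: A_def N_def B_def)
      also have "\<dots> \<le> 4096 * (96 * decay_max * B + decay_max * B) * A\<^sup>2"
      proof (intro mult_right_mono mult_left_mono add_left_mono)
        have "N\<^sup>2 / s \<le> B" using d3 B1 by simp
        then have "decay_max * (N\<^sup>2 / s) \<le> decay_max * B" using decay_max_pos by (intro mult_left_mono) auto
        then show "decay_max / sqrt R * N\<^sup>2 \<le> decay_max * B" by (simp add: s(4))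
      qed auto
      also have "\<dots> = C4 * B * A\<^sup>2" by (simp add: C4_def)
      finally show ?thesis .
    qed
    have f2u: "integral {a..b} (\<lambda>t. (f t)\<^sup>2) \<le> C5 * A"
    proof -
      have "integral {a..b} (\<lambda>t. (f t)\<^sup>2) = integral {a..b} (\<lambda>t. (norm (trig_sum ?E x t))\<^sup>2)"
        by (intro integral_cong) (simp add: nf)
      also have "\<dots> \<le> (2 * (b - a) + decay / sqrt R * N) * A"
        using L2_upper[OF _ _ _ R1 R3, of a b x] ab by (simp add: A_def N_def)
      also have "\<dots> \<le> C5 * A"
        using d2 A by (intro mult_right_mono) (auto simp: me s(4) C5_def)
      finally show ?thesis .
    qed
    have G2: "integral {a..e} (\<lambda>t. (integral {t..t + h} f)\<^sup>2) \<le> C6 * (h / lam) * A"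
    proof -
      have "integral {a..e} (\<lambda>t. (integral {t..t + h} f)\<^sup>2) = integral {a..e} (\<lambda>t. (norm (integral {t..t + h} (trig_sum ?E x)))\<^sup>2)"
      proof (rule integral_cong)
        fix t assume t: "t \<in> {a..e}"
        then have sub: "{t..t + h} \<subseteq> {a..b}" using me h2 by auto
        have "integral {t..t + h} (trig_sum ?E x) = integral {t..t + h} (\<lambda>t. complex_of_real (f t))"
          using sub f by (intro integral_cong) auto
        also have "\<dots> = of_real (integral {t..t + h} f)"
          by (rule integral_unique, rule has_integral_of_real, rule integrable_integral,
              rule integrable_continuous_real, rule continuous_on_subset[OF contf sub])
        finally show "(integral {t..t + h} f)\<^sup>2 = (norm (integral {t..t + h} (trig_sum ?E x)))\<^sup>2" by simp
      qed
      also have "\<dots> \<le> (2 * window_const * (h / lam) + h\<^sup>2 * (decay / sqrt R) * N) * A"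
        unfolding A_def N_def
        by (rule window_L2[OF me(7) _ h0 lamh1 h1 _ R1 R3 h3]) (use me h2 lam1 in auto)
      also have "\<dots> \<le> (2 * window_const * (h / lam) + h / lam) * A"
        using d4 A by (intro mult_right_mono add_left_mono) auto
      also have "\<dots> = C6 * (h / lam) * A" by (simp add: C6_def algebra_simps add_divide_distrib)
      finally show ?thesis .
    qed
    define q where "q = sqrt A"
    define \<beta> where "\<beta> = sqrt B"
    have q: "q > 0" "q\<^sup>2 = A" using A by (simp_all add: q_def)
    have \<beta>: "\<beta> > 0" "\<beta>\<^sup>2 = B" using B1 by (simp_all add: \<beta>_def)
    define I1 where "I1 = integral {m..e} (\<lambda>t. \<bar>f t\<bar>)"
    have I1: "c7 * q / \<beta> \<le> I1"
    proof -
      define T where "T = q * \<beta> * t0"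
      have T: "T > 0" using q \<beta> t0 by (simp add: T_def)
      have contm: "continuous_on {m..e} f" using contf by (rule continuous_on_subset) (use me in auto)
      have "C4 * B * A\<^sup>2 / T ^ 3 = c2 * A / (2 * T)"
      proof -
        have "T\<^sup>2 = A * B * (2 * C4 / c2)" by (simp add: T_def power_mult_distrib q \<beta> t0)
        then have "c2 * T\<^sup>2 = 2 * C4 * B * A" using pos by (simp add: field_simps)
        then have "(C4 * B * A\<^sup>2) * (2 * T) = (c2 * A) * T ^ 3"
          by (simp add: power2_eq_square power3_eq_cube algebra_simps)
        then show ?thesis using T by (simp add: field_simps)
      qed
      then have "c2 * A / (2 * T) = c2 * A / T - C4 * B * A\<^sup>2 / T ^ 3" by simp
      also have "\<dots> \<le> integral {m..e} (\<lambda>t. (f t)\<^sup>2) / T - integral {m..e} (\<lambda>t. (f t) ^ 4) / T ^ 3"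
        using f2 f4 T by (intro diff_mono divide_right_mono) auto
      also have "\<dots> \<le> I1" unfolding I1_def by (rule L1_lower[OF contm T])
      also have "c2 * A / (2 * T) = c7 * q / \<beta>"
        using q(1) \<beta>(1) t0(1) unfolding T_def q(2)[symmetric] c7_def by (simp add: field_simps power2_eq_square)
      finally show ?thesis .
    qed
    \<comment> \<open>With these weights the two \<sigma> terms and the final \<tau> term are each
      at most a quarter of \<open>h * ?L\<close>. Their total is
      \<open>(1/4 + 1/4) / 2 + 1/4 = 1/2\<close>, so half of \<open>h * ?L\<close> is left for the
      zeros to account for.\<close>
    define \<sigma> where "\<sigma> = h * c7 * q / (8 * l * \<beta>)"
    define \<tau> where "\<tau> = 2 * C5 * q * \<beta> / c7"
    have st: "\<sigma> > 0" "\<tau> > 0" using h0 c7 q \<beta> l pos by (simp_all add: \<sigma>_def \<tau>_def)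
    let ?Z = "real (card {t \<in> {a..b}. f t = 0})"
    let ?L = "c7 * q / \<beta>"
    have "h * I1 \<le> (\<sigma> * (e - a) + integral {a..e} (\<lambda>t. (integral {t..t + h} f)\<^sup>2) / \<sigma>) / 2
      + \<tau> * h * (h * ?Z) / 2 + h * integral {a..b} (\<lambda>t. (f t)\<^sup>2) / (2 * \<tau>)"
      unfolding I1_def
      by (rule window_zero_count[OF contf h0 _ me(8) _ fin st(2,1)]) (use me h2 m_def in auto)
    also have "\<dots> \<le> (h * ?L / 4 + h * ?L / 4) / 2 + \<tau> * h * (h * ?Z) / 2 + h * ?L / 4"
    proof (intro add_mono divide_right_mono order_refl)
      show "\<sigma> * (e - a) \<le> h * ?L / 4" using l by (simp add: \<sigma>_def me mult_ac)
      have "integral {a..e} (\<lambda>t. (integral {t..t + h} f)\<^sup>2) / \<sigma> \<le> C6 * (h / lam) * A / \<sigma>"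
        using G2 st by (intro divide_right_mono) auto
      also have "\<dots> = 8 * l * C6 * q * \<beta> / (lam * c7)"
        using h0 c7 q(1) \<beta>(1) l lam1 unfolding q(2)[symmetric] \<sigma>_def by (simp add: field_simps power2_eq_square)
      also have "\<dots> \<le> h * ?L / 4"
      proof -
        have "32 * l * C6 * (q * \<beta>) \<le> \<kappa> * c7\<^sup>2 * (q * \<beta>)" using kap q \<beta> by (intro mult_right_mono) auto
        also have "\<dots> = \<kappa> * B * c7\<^sup>2 * q / \<beta>" using \<beta>(1) unfolding \<beta>(2)[symmetric] by (simp add: field_simps power2_eq_square)
        also have "\<dots> = lam * h * c7\<^sup>2 * q / \<beta>" by (simp only: lamh)
        finally show ?thesis using lam1 c7 \<beta>(1) by (simp add: field_simps power2_eq_square)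
      qed
      finally show "integral {a..e} (\<lambda>t. (integral {t..t + h} f)\<^sup>2) / \<sigma> \<le> h * ?L / 4" .
      have "h * integral {a..b} (\<lambda>t. (f t)\<^sup>2) / (2 * \<tau>) \<le> h * (C5 * A) / (2 * \<tau>)"
        using f2u h0 st by (intro divide_right_mono mult_left_mono) auto
      also have "\<dots> = h * ?L / 4"
        using c7 q(1) \<beta>(1) pos unfolding q(2)[symmetric] \<tau>_def by (simp add: field_simps power2_eq_square)
      finally show "h * integral {a..b} (\<lambda>t. (f t)\<^sup>2) / (2 * \<tau>) \<le> h * ?L / 4" .
    qed auto
    finally have "h * I1 \<le> h * ?L / 2 + \<tau> * h * (h * ?Z) / 2" by (simp add: field_simps)
    moreover have "h * ?L \<le> h * I1" using I1 h0 by (intro mult_left_mono) auto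
    ultimately have "h * ?L \<le> h * (\<tau> * h * ?Z)" by (simp add: field_simps)
    then have "?L \<le> \<tau> * h * ?Z" using h0 by (simp only: mult_le_cancel_left_pos)
    also have "\<dots> = q / \<beta> * (2 * C5 * B * h * ?Z / c7)"
      using \<beta>(1) c7 unfolding \<tau>_def \<beta>(2)[symmetric] by (simp add: field_simps power2_eq_square)
    also have "?L = q / \<beta> * c7" by (simp add: mult.commute)
    finally have "q / \<beta> * c7 \<le> q / \<beta> * (2 * C5 * B * h * ?Z / c7)" .
    moreover have "q / \<beta> > 0" using q \<beta> by simp
    ultimately have "c7 \<le> 2 * C5 * B * h * ?Z / c7" by (simp only: mult_le_cancel_left_pos)
    then have "c7\<^sup>2 \<le> 2 * C5 * B * h * ?Z" using c7 by (simp add: field_simps power2_eq_square)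
    then have "c7\<^sup>2 * lam \<le> 2 * C5 * B * (lam * h) * ?Z"
      using mult_right_mono[of "c7\<^sup>2" "2 * C5 * B * h * ?Z" lam] lam1 by (simp add: mult_ac)
    also have "\<dots> = (2 * C5 * \<kappa>) * B\<^sup>2 * ?Z" unfolding lamh by (simp add: power2_eq_square mult_ac)
    finally have *: "c7\<^sup>2 * lam \<le> (2 * C5 * \<kappa>) * B\<^sup>2 * ?Z" .
    have D: "0 < (2 * C5 * \<kappa>) * B\<^sup>2" using pos kap B1 by (intro mult_pos_pos) auto
    from * have "c7\<^sup>2 * lam \<le> ?Z * ((2 * C5 * \<kappa>) * B\<^sup>2)" by (simp only: mult_ac)
    then have "c7\<^sup>2 * lam / ((2 * C5 * \<kappa>) * B\<^sup>2) \<le> ?Z" by (simp only: pos_divide_le_eq[OF D])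
    then show ?thesis by (simp add: B_def)
  qed
  have "c7\<^sup>2 / (2 * C5 * \<kappa>) > 0" using c7 pos kap by simp
  then show ?thesis
    using main lam0 by (intro exI[of _ "c7\<^sup>2 / (2 * C5 * \<kappa>)"] conjI exI[of _ lam0]) auto
qed

end

section \<open>Curves with nowhere-zero curvature\<close>

text \<open>In the plane \<open>e2\<close> is a multiple \<open>k\<close> of \<open>e1\<close>
  turned by a right angle. The identity is Pythagoras in this frame, scaled by
  \<open>(norm e2)^2\<close> so that \<open>e2\<close> is never normalized.\<close>

lemma orthogonal_frame_norm:
  fixes e1 e2 v :: "real^2"
  assumes "norm e1 = 1" "e1 \<bullet> e2 = 0"
  shows "(norm e2)\<^sup>2 * (norm v)\<^sup>2 = (norm e2)\<^sup>2 * (v \<bullet> e1)\<^sup>2 + (v \<bullet> e2)\<^sup>2"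
proof -
  define p q r s where "p = e1 $ 1" and "q = e1 $ 2" and "r = e2 $ 1" and "s = e2 $ 2"
  note pq_defs = p_def q_def r_def s_def
  have 1: "p\<^sup>2 + q\<^sup>2 = 1" using norm_sq_2[of e1] assms(1) by (simp add: p_def q_def)
  have 2: "p * r + q * s = 0" using assms(2) by (simp add: inner_2 pq_defs)
  define k where "k = p * s - q * r"
  have "(p\<^sup>2 + q\<^sup>2) * r = p * (p * r + q * s) - q * k" "(p\<^sup>2 + q\<^sup>2) * s = q * (p * r + q * s) + p * k"
    by (simp_all add: k_def algebra_simps power2_eq_square)
  then have rs: "r = - q * k" "s = p * k" unfolding 1 2 by simp_all
  have "(norm e2)\<^sup>2 = (p\<^sup>2 + q\<^sup>2) * k\<^sup>2"
    unfolding norm_sq_2 r_def[symmetric] s_def[symmetric] rs by (simp add: algebra_simps power2_eq_square)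
  then have e2: "(norm e2)\<^sup>2 = k\<^sup>2" using 1 by simp
  define x y where "x = v $ 1" and "y = v $ 2"
  have "(norm e2)\<^sup>2 * (v \<bullet> e1)\<^sup>2 + (v \<bullet> e2)\<^sup>2 = k\<^sup>2 * (x * p + y * q)\<^sup>2 + (x * r + y * s)\<^sup>2"
    unfolding e2 by (simp add: inner_2 pq_defs x_def y_def)
  also have "\<dots> = k\<^sup>2 * ((p\<^sup>2 + q\<^sup>2) * (x\<^sup>2 + y\<^sup>2))"
    unfolding rs by (simp add: algebra_simps power2_eq_square)
  also have "\<dots> = (norm e2)\<^sup>2 * (norm v)\<^sup>2" unfolding 1 e2 norm_sq_2[of v] by (simp add: x_def y_def)
  finally show ?thesis by simp
qed

lemma lipschitz_of_vector_derivative: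
  fixes f :: "real \<Rightarrow> 'a::real_normed_vector"
  assumes "\<And>t. t \<in> {p..q} \<Longrightarrow> (f has_vector_derivative f' t) (at t within {p..q})"
    and "\<And>t. t \<in> {p..q} \<Longrightarrow> norm (f' t) \<le> K"
    and "s \<in> {p..q}" "t \<in> {p..q}"
  shows "norm (f s - f t) \<le> K * \<bar>s - t\<bar>"
proof -
  have "norm (f s - f t) \<le> K * norm (s - t)"
  proof (rule differentiable_bound[of "{p..q}" f "\<lambda>t h. h *\<^sub>R f' t"])
    show "(f has_derivative (\<lambda>h. h *\<^sub>R f' t)) (at t within {p..q})" if "t \<in> {p..q}" for t
      using assms(1)[OF that] by (simp add: has_vector_derivative_def)
    show "onorm (\<lambda>h. h *\<^sub>R f' t) \<le> K" if "t \<in> {p..q}" for t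
      by (rule onorm_le) (use assms(2)[OF that] in \<open>simp add: mult.commute[of K] mult_left_mono\<close>)
  qed (use assms in auto)
  then show ?thesis by simp
qed

text \<open>Coordinates of two lifts of a point differ by multiples of \<open>2 * pi\<close>, which
  exceeds 1.\<close>

lemma torus_proj_short_inj:
  assumes "torus_proj x = torus_proj y" "norm (x - y) \<le> 1"
  shows "x = y"
proof -
  have "x $ i = y $ i" for i
  proof -
    obtain k :: int where k: "x $ i - y $ i = 2 * pi * of_int k"
      using assms(1) unfolding torus_proj_eq_iff torus_rel_def by blast
    have "\<bar>x $ i - y $ i\<bar> \<le> 1"
      using component_le_norm_cart[of "x - y" i] assms(2) by simp
    then have "2 * pi * \<bar>of_int k\<bar> \<le> 1" unfolding k by (simp add: abs_mult)
    moreover have "2 * pi > 1" using pi_gt3 by simp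
    ultimately have "\<bar>real_of_int k\<bar> < 1"
      by (smt (verit) mult_le_cancel_left1)
    then have "k = 0" by linarith
    then show ?thesis using k by simp
  qed
  then show ?thesis by (simp add: vec_eq_iff)
qed

text \<open>Near an interior parameter, tangent and curvature vector stay close to their values
  \<open>e1\<close> and \<open>e2\<close> there, which are orthogonal because the speed is constant.
  Injectivity is included because zeros are counted as points of the torus, not as
  parameters.\<close>

lemma curved_arc_exists:
  assumes "smooth_curve_nonzero_curvature C"
  obtains g g1 g2 a b c K where "curved_arc g g1 g2 a b c K"
    "inj_on (\<lambda>t. torus_proj (g t)) {a..b}" "(\<lambda>t. torus_proj (g t)) ` {a..b} \<subseteq> C"
proof -
  obtain L g where arc: "arclength_param C L g" and curv: "\<forall>t\<in>{0..L}. curvature L g t \<noteq> 0"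
    using assms by (auto simp: smooth_curve_nonzero_curvature_def)
  have L: "L > 0" and smooth: "smooth_path L g" and unit: "\<And>t. t \<in> {0..L} \<Longrightarrow> norm (path_deriv L g t) = 1"
    and C: "C = (torus_proj \<circ> g) ` {0..L}"
    using arc by (auto simp: arclength_param_def)
  define g1 where "g1 = path_deriv L g"
  define g2 where "g2 = path_deriv L g1"
  define g3 where "g3 = path_deriv L g2"
  have diff: "((path_deriv L ^^ n) g) differentiable (at t within {0..L})" if "t \<in> {0..L}" for n t
    using smooth that by (simp add: smooth_path_def)
  have step: "(f has_vector_derivative path_deriv L f t) (at t within {0..L})"
    if "f differentiable (at t within {0..L})" for f t
    using that by (simp add: vector_derivative_works path_deriv_def)
  have d1: "(g has_vector_derivative g1 t) (at t within {0..L})"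
    and d2: "(g1 has_vector_derivative g2 t) (at t within {0..L})"
    and d3: "(g2 has_vector_derivative g3 t) (at t within {0..L})"
    and diff3: "g3 differentiable (at t within {0..L})" if "t \<in> {0..L}" for t
    using diff[OF that, of 0] diff[OF that, of 1] diff[OF that, of 2] diff[OF that, of 3] step
    by (simp_all add: g1_def g2_def g3_def numeral_2_eq_2 numeral_3_eq_3)
  have cont: "continuous_on {0..L} g2" "continuous_on {0..L} g3"
    by (simp_all add: continuous_on_eq_continuous_within has_vector_derivative_continuous[OF d3]
        differentiable_imp_continuous_within[OF diff3])
  have "bounded (g2 ` {0..L})" by (intro compact_imp_bounded compact_continuous_image cont) simp
  then obtain B2 where "\<forall>y\<in>g2 ` {0..L}. norm y \<le> B2" unfolding bounded_iff ..
  then have B2: "norm (g2 t) \<le> B2" if "t \<in> {0..L}" for t using that by blast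
  have "bounded (g3 ` {0..L})" by (intro compact_imp_bounded compact_continuous_image cont) simp
  then obtain B3 where "\<forall>y\<in>g3 ` {0..L}. norm y \<le> B3" unfolding bounded_iff ..
  then have B3: "norm (g3 t) \<le> B3" if "t \<in> {0..L}" for t using that by blast
  define K where "K = max 1 (max B2 B3)"
  have K: "K \<ge> 1" "B2 \<le> K" "B3 \<le> K" by (simp_all add: K_def)
  have n1: "norm (g1 t) = 1" and n2: "norm (g2 t) \<le> K" and n3: "norm (g3 t) \<le> K" if "t \<in> {0..L}" for t
    using unit[OF that] B2[OF that] B3[OF that] K by (simp_all add: g1_def)
  define t0 where "t0 = L / 2"
  have t0: "t0 \<in> {0..L}" using L by (simp add: t0_def)
  define e1 where "e1 = g1 t0"
  define e2 where "e2 = g2 t0"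
  have e1: "norm e1 = 1" using n1[OF t0] by (simp add: e1_def)
  have "curvature L g t0 \<noteq> 0" using curv t0 by blast
  then have e2: "norm e2 > 0" by (simp add: curvature_def e2_def g2_def g1_def)
  have orth: "e1 \<bullet> e2 = 0"
  proof -
    have "((\<lambda>t. g1 t \<bullet> g1 t) has_vector_derivative g1 t0 \<bullet> g2 t0 + g2 t0 \<bullet> g1 t0) (at t0 within {0..L})"
      by (rule bounded_bilinear.has_vector_derivative[OF bounded_bilinear_inner d2[OF t0] d2[OF t0]])
    then have "((\<lambda>t. 1) has_vector_derivative g1 t0 \<bullet> g2 t0 + g2 t0 \<bullet> g1 t0) (at t0 within {0..L})"
      by (rule has_vector_derivative_transform[OF t0, rotated]) (use n1 in \<open>simp add: dot_square_norm\<close>)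
    then have "g1 t0 \<bullet> g2 t0 + g2 t0 \<bullet> g1 t0 = 0"
      using t0 has_vector_derivative_const
      by (intro vector_derivative_unique_within_closed_interval[OF L, of t0 "\<lambda>t. 1::real"]) simp_all
    then show ?thesis by (simp add: e1_def e2_def inner_commute)
  qed
  \<comment> \<open>Not both components of \<open>v\<close> can be below
    \<open>2 * c * norm v\<close>, since by the frame identity \<open>v\<close> would be shorter
    than itself. The remaining factor 2 is spent on the variation of the frame along the
    arc.\<close>
  define c where "c = min 1 (norm e2) / 4"
  have c: "c > 0" "2 * c \<le> 1/2" "2 * c \<le> norm e2 / 2" using e2 by (auto simp: c_def)
  \<comment> \<open>\<open>c / K\<close> limits the variation of \<open>g1\<close> and
    \<open>g2\<close> to \<open>c\<close>, \<open>L / 4\<close> keeps the arc inside the parameter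
    interval, and \<open>1 / 2\<close> makes it too short to wrap around the torus.\<close>
  define \<delta> where "\<delta> = min (c / K) (min (L / 4) (1 / 2))"
  have \<delta>: "\<delta> > 0" "K * \<delta> \<le> c" "\<delta> \<le> L / 4" "2 * \<delta> \<le> 1"
  proof -
    have "\<delta> \<le> c / K" by (simp add: \<delta>_def)
    then show "K * \<delta> \<le> c" using K by (simp add: field_simps)
    show "\<delta> \<le> L / 4" unfolding \<delta>_def by (meson min.cobounded1 min.cobounded2 order_trans)
    have "\<delta> \<le> 1 / 2" unfolding \<delta>_def by (meson min.cobounded2 order_trans)
    then show "2 * \<delta> \<le> 1" by simp
  qed (use c K L in \<open>auto simp: \<delta>_def\<close>)
  define a where "a = t0 - \<delta>"
  define b where "b = t0 + \<delta>"
  have sub: "{a..b} \<subseteq> {0..L}" using \<delta> L by (auto simp: a_def b_def t0_def)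
  have ab: "a < b" "b - a \<le> 1" using \<delta> by (simp_all add: a_def b_def)
  have close: "\<bar>t - t0\<bar> \<le> \<delta>" if "t \<in> {a..b}" for t using that by (auto simp: a_def b_def)
  have lip: "norm (g1 s - g1 t) \<le> K * \<bar>s - t\<bar>" "norm (g2 s - g2 t) \<le> K * \<bar>s - t\<bar>"
    "norm (g s - g t) \<le> 1 * \<bar>s - t\<bar>" if "s \<in> {0..L}" "t \<in> {0..L}" for s t
    using lipschitz_of_vector_derivative[OF d2 n2 that] lipschitz_of_vector_derivative[OF d3 n3 that]
      lipschitz_of_vector_derivative[OF d1 eq_refl[OF n1] that] by auto
  have near: "norm (g1 t - e1) \<le> c" "norm (g2 t - e2) \<le> c" if "t \<in> {a..b}" for t
  proof -
    have t: "t \<in> {0..L}" using that sub by blast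
    have "K * \<bar>t - t0\<bar> \<le> K * \<delta>" using close[OF that] K by (intro mult_left_mono) auto
    then show "norm (g1 t - e1) \<le> c" "norm (g2 t - e2) \<le> c"
      using lip[OF t t0] \<delta>(2) by (auto simp: e1_def e2_def)
  qed
  have err: "\<bar>v \<bullet> x - v \<bullet> y\<bar> \<le> c * norm v" if "norm (x - y) \<le> c" for v x y :: "real^2"
  proof -
    have "\<bar>v \<bullet> (x - y)\<bar> \<le> norm v * norm (x - y)" by (rule Cauchy_Schwarz_ineq2)
    also have "\<dots> \<le> norm v * c" using that by (intro mult_left_mono) auto
    finally show ?thesis by (simp add: inner_diff_right mult.commute)
  qed
  have curved: "(\<forall>t\<in>{a..b}. c * norm v \<le> v \<bullet> g1 t) \<or> (\<forall>t\<in>{a..b}. v \<bullet> g1 t \<le> - (c * norm v))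
      \<or> (\<forall>t\<in>{a..b}. c * norm v \<le> v \<bullet> g2 t) \<or> (\<forall>t\<in>{a..b}. v \<bullet> g2 t \<le> - (c * norm v))" for v
  proof -
    have "2 * (c * norm v) \<le> \<bar>v \<bullet> e1\<bar> \<or> 2 * (c * norm v) \<le> \<bar>v \<bullet> e2\<bar>"
    proof (rule ccontr)
      assume "\<not> ?thesis"
      then have less: "\<bar>v \<bullet> e1\<bar> < 2 * c * norm v" "\<bar>v \<bullet> e2\<bar> < 2 * c * norm v" by auto
      have "2 * c * norm v \<le> 1/2 * norm v" "2 * c * norm v \<le> norm e2 / 2 * norm v"
        by (intro mult_right_mono c; simp)+
      then have "\<bar>v \<bullet> e1\<bar> < 1/2 * norm v" "\<bar>v \<bullet> e2\<bar> < norm e2 / 2 * norm v" using less by linarith+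
      then have "(v \<bullet> e1)\<^sup>2 < (1/2 * norm v)\<^sup>2" "(v \<bullet> e2)\<^sup>2 < (norm e2 / 2 * norm v)\<^sup>2"
        using abs_le_square_iff[of "1/2 * norm v" "v \<bullet> e1"] abs_le_square_iff[of "norm e2 / 2 * norm v" "v \<bullet> e2"]
        by (auto simp: abs_mult not_le[symmetric])
      then have sq: "(v \<bullet> e1)\<^sup>2 < (norm v)\<^sup>2 / 4" "(v \<bullet> e2)\<^sup>2 < (norm e2)\<^sup>2 * (norm v)\<^sup>2 / 4"
        by (simp_all add: power_mult_distrib power_divide)
      have "(norm e2)\<^sup>2 * (v \<bullet> e1)\<^sup>2 < (norm e2)\<^sup>2 * ((norm v)\<^sup>2 / 4)"
        using sq(1) e2 by (intro mult_strict_left_mono) auto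
      moreover have "0 \<le> (norm e2)\<^sup>2 * (norm v)\<^sup>2" by simp
      ultimately show False using sq(2) orthogonal_frame_norm[OF e1 orth, of v] by simp
    qed
    then consider "2 * (c * norm v) \<le> v \<bullet> e1" | "v \<bullet> e1 \<le> - (2 * (c * norm v))"
      | "2 * (c * norm v) \<le> v \<bullet> e2" | "v \<bullet> e2 \<le> - (2 * (c * norm v))" by linarith
    then show ?thesis
    proof cases
      case 1
      have "c * norm v \<le> v \<bullet> g1 t" if "t \<in> {a..b}" for t
        using err[OF near(1)[OF that], of v] 1 unfolding abs_le_iff by linarith
      then show ?thesis by blast
    next
      case 2
      have "v \<bullet> g1 t \<le> - (c * norm v)" if "t \<in> {a..b}" for t
        using err[OF near(1)[OF that], of v] 2 unfolding abs_le_iff by linarith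
      then show ?thesis by blast
    next
      case 3
      have "c * norm v \<le> v \<bullet> g2 t" if "t \<in> {a..b}" for t
        using err[OF near(2)[OF that], of v] 3 unfolding abs_le_iff by linarith
      then show ?thesis by blast
    next
      case 4
      have "v \<bullet> g2 t \<le> - (c * norm v)" if "t \<in> {a..b}" for t
        using err[OF near(2)[OF that], of v] 4 unfolding abs_le_iff by linarith
      then show ?thesis by blast
    qed
  qed
  have arc: "curved_arc g g1 g2 a b c K"
  proof
    fix s t assume st: "s \<in> {a..b}" "t \<in> {a..b}"
    then have st': "s \<in> {0..L}" "t \<in> {0..L}" using sub by blast+
    show "norm (g1 s - g1 t) \<le> K * \<bar>s - t\<bar>" "norm (g2 s - g2 t) \<le> K * \<bar>s - t\<bar>"
      by (rule lip[OF st'])+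
  next
    fix t assume "t \<in> {a..b}"
    then have t: "t \<in> {0..L}" using sub by blast
    show "(g has_vector_derivative g1 t) (at t within {a..b})" "(g1 has_vector_derivative g2 t) (at t within {a..b})"
      by (rule has_vector_derivative_within_subset[OF d1[OF t] sub] has_vector_derivative_within_subset[OF d2[OF t] sub])+
    show "norm (g2 t) \<le> K" by (rule n2[OF t])
  qed (use ab c K curved in auto)
  \<comment> \<open>The arc advances in direction \<open>e1\<close> with speed at least 1/2, so the
    lift never returns to a point.\<close>
  have less: "e1 \<bullet> g s < e1 \<bullet> g t" if st: "s \<in> {a..b}" "t \<in> {a..b}" "s < t" for s t
  proof -
    have st_sub: "{s..t} \<subseteq> {a..b}" "{s..t} \<subseteq> {0..L}" using st sub by auto
    have I: "((\<lambda>u. e1 \<bullet> g1 u) has_integral (e1 \<bullet> g t - e1 \<bullet> g s)) {s..t}"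
    proof (rule fundamental_theorem_of_calculus)
      fix u assume "u \<in> {s..t}"
      then have u: "u \<in> {0..L}" using st_sub by blast
      show "((\<lambda>u. e1 \<bullet> g u) has_vector_derivative e1 \<bullet> g1 u) (at u within {s..t})"
        by (rule bounded_linear.has_vector_derivative[OF bounded_linear_inner_right])
          (rule has_vector_derivative_within_subset[OF d1[OF u] st_sub(2)])
    qed (use st in simp)
    have I': "((\<lambda>u. 1/2) has_integral (1/2 * (t - s))) {s..t}"
      using has_integral_const_real[of "1/2::real" s t] st(3) by (simp add: mult.commute)
    have "1/2 * (t - s) \<le> e1 \<bullet> g t - e1 \<bullet> g s"
    proof (rule has_integral_le[OF I' I])
      fix u assume "u \<in> {s..t}"
      then have "u \<in> {a..b}" using st_sub by blast
      from err[OF near(1)[OF this], of e1] have "\<bar>e1 \<bullet> g1 u - 1\<bar> \<le> c"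
        using e1 by (simp add: dot_square_norm)
      then show "1/2 \<le> e1 \<bullet> g1 u" using c(1,2) unfolding abs_le_iff by linarith
    qed
    then show ?thesis using st(3) by simp
  qed
  have inj: "inj_on (\<lambda>t. torus_proj (g t)) {a..b}"
  proof (rule inj_onI, rule ccontr)
    fix s t assume st: "s \<in> {a..b}" "t \<in> {a..b}" "torus_proj (g s) = torus_proj (g t)" "s \<noteq> t"
    have "norm (g s - g t) \<le> 1 * \<bar>s - t\<bar>" using st sub by (intro lip) auto
    also have "\<dots> \<le> 1" using st ab by auto
    finally have "g s = g t" by (rule torus_proj_short_inj[OF st(3)])
    then show False using less[OF st(1,2)] less[OF st(2,1)] st(4) by (cases s t rule: linorder_cases) auto
  qed
  have "(\<lambda>t. torus_proj (g t)) ` {a..b} \<subseteq> C" unfolding C using sub by auto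
  then show ?thesis using that[OF arc inj] by blast
qed

section \<open>From zeros of the restriction to points of the curve\<close>

lemma torus_proj_surj: "\<exists>x. torus_proj x = p"
  unfolding torus_proj_def by (metis Quotient_abs_rep Quotient_torus)

theorem theorem1p1:
  fixes C :: "torus set"
  assumes "smooth_curve_nonzero_curvature C"
  shows "\<exists>c>0. \<exists>lam0>0. \<forall>lam\<ge>lam0. \<forall>F :: torus \<Rightarrow> real.
           F \<noteq> (\<lambda>_. 0) \<longrightarrow> torus_C2 F \<longrightarrow> (\<forall>p. - torus_laplacian F p = lam\<^sup>2 * F p) \<longrightarrow>
           ereal_of_enat (num_zeros F C) \<ge> ereal (c * lam / real (B_max lam) powr (5/2))"
proof -
  obtain g g1 g2 a b c K where arc: "curved_arc g g1 g2 a b c K"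
    and inj: "inj_on (\<lambda>t. torus_proj (g t)) {a..b}" and sub: "(\<lambda>t. torus_proj (g t)) ` {a..b} \<subseteq> C"
    using curved_arc_exists[OF assms] by blast
  interpret curved_arc g g1 g2 a b c K by (rule arc)
  obtain c0 lam0 where c0: "c0 > 0" "lam0 > 0" and count: "\<And>lam x f. lam \<ge> lam0 \<Longrightarrow>
    (\<forall>t\<in>{a..b}. complex_of_real (f t) = trig_sum (lattice_circle lam) x t) \<Longrightarrow>
    (\<exists>\<xi>\<in>lattice_circle lam. x \<xi> \<noteq> 0) \<Longrightarrow> finite {t \<in> {a..b}. f t = 0} \<Longrightarrow>
    c0 * lam / (real (B_max lam))\<^sup>2 \<le> real (card {t \<in> {a..b}. f t = 0})"
    using zero_count by blast
  have "ereal (c0 * lam / real (B_max lam) powr (5/2)) \<le> ereal_of_enat (num_zeros F C)"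
    if lam: "lam \<ge> lam0" and F: "F \<noteq> (\<lambda>_. 0)" "torus_C2 F" "\<forall>p. - torus_laplacian F p = lam\<^sup>2 * F p"
    for lam and F :: "torus \<Rightarrow> real"
  proof (cases "finite ({p. F p = 0} \<inter> C)")
    case False
    then show ?thesis by (simp add: num_zeros_def)
  next
    case True
    have lam_pos: "lam > 0" using lam c0 by simp
    obtain x where x: "\<And>z. of_real (F (torus_proj z)) = (\<Sum>\<xi>\<in>lattice_circle lam. x \<xi> * cis (\<xi> \<bullet> z))"
      using eigenfunction_expansion[OF F(2,3)] lam_pos by (metis less_imp_le)
    define f where "f = (\<lambda>t. F (torus_proj (g t)))"
    define Z where "Z = {t \<in> {a..b}. f t = 0}"
    have img: "(\<lambda>t. torus_proj (g t)) ` Z \<subseteq> {p. F p = 0} \<inter> C"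
      using sub by (auto simp: Z_def f_def)
    have injZ: "inj_on (\<lambda>t. torus_proj (g t)) Z"
      by (rule inj_on_subset[OF inj]) (auto simp: Z_def)
    have finZ: "finite Z" using inj_on_finite[OF injZ img True] .
    have cardZ: "card Z \<le> card ({p. F p = 0} \<inter> C)" by (rule card_inj_on_le[OF injZ img True])
    \<comment> \<open>Also shows that the circle carries a lattice point, so that
      \<open>B_max lam \<ge> 1\<close>.\<close>
    have nz: "\<exists>\<xi>\<in>lattice_circle lam. x \<xi> \<noteq> 0"
    proof (rule ccontr)
      assume "\<not> ?thesis"
      then have "of_real (F (torus_proj z)) = (0::complex)" for z unfolding x by simp
      then have "F p = 0" for p using torus_proj_surj[of p] by (metis of_real_eq_0_iff)
      then show False using F(1) by blast
    qed
    then have B1: "1 \<le> B_max lam" using lam_pos by (intro B_max_ge_1) auto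
    \<comment> \<open>The arc yields the exponent 2, and \<open>B_max lam \<ge> 1\<close> relaxes it
      to 5/2.\<close>
    have "c0 * lam / real (B_max lam) powr (5/2) \<le> c0 * lam / (real (B_max lam))\<^sup>2"
    proof (rule divide_left_mono)
      have "real (B_max lam) powr 2 \<le> real (B_max lam) powr (5/2)" using B1 by (intro powr_mono) auto
      then show "(real (B_max lam))\<^sup>2 \<le> real (B_max lam) powr (5/2)" using B1 by (simp add: powr_numeral)
    qed (use c0 lam_pos B1 in auto)
    also have "\<dots> \<le> real (card Z)"
      unfolding Z_def
      by (rule count[OF lam _ nz finZ[unfolded Z_def]]) (simp add: f_def x trig_sum_def wave_def)
    also have "\<dots> \<le> real (card ({p. F p = 0} \<inter> C))" using cardZ by simp
    finally show ?thesis using True by (simp add: num_zeros_def Let_def)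
  qed
  then show ?thesis using c0 by blast
qed

end
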